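(* Let $u$, $w$, $\rho$, $x_0$ and the random variable $\widetilde\rho$ be as in the context. Consider the portfolio choice problem under rank-dependent utility $$\text{(R)}\qquad \sup_X\ \int_0^\infty u(x)\,d\bigl(1-w(1-F_X(x))\bigr)\quad\text{subject to}\quad \mathbf E[\rho X]=x_0,\ X\ge0,$$ and the portfolio choice problem under expected utility $$\text{(E)}\qquad \sup_X\ \mathbf E[u(X)]\quad\text{subject to}\quad \mathbf E[\widetilde\rho X]=x_0,\ X\ge0,$$ where $X$ ranges over random variables and $F_X$ is the distribution function of $X$. (1) Let $\widetilde X^*$ be an optimal solution to (E) and let $\widetilde Q^*$ be its quantile function. Then $$X^*:=\widetilde Q^*\bigl(1-w(F_\rho(\rho))\bigr)$$ is an optimal solution to (R). (2) Conversely, if $X^*$ is an optimal solution to (R), then there exists a unique quantile function $\widetilde Q^*$ such that $$X^*=\widetilde Q^*\bigl(1-w(F_\rho(\rho))\bigr).$$ Moreover, $\widetilde Q^*(1-U)$ is an optimal solution to (E), where $U$ is any random variable uniformly distributed on $(0,1)$ and comonotonic with $\widetilde\rho$.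
   Context: Standing setting. $\mathbb R^+=[0,\infty)$. All random variables live on a fixed probability space with probability $\mathbf P$. The utility function $u$ is strictly increasing and twice differentiable on $\mathbb R^+$ with $u''<0$ (derivatives are understood on $(0,\infty)$, and $u(0)=\lim_{y\downarrow0}u(y)$). $(u')^{-1}$, the inverse function of $u'$, is implicitly taken to be defined at the values $\lambda\delta'(x)$, $\lambda>0$, $x\in(0,1)$ (with $\delta$ as below), where $(u')^{-1}(p)$ is identified with the maximizer of $y\mapsto u(y)-py$ over $y\in\mathbb R^+$. The probability weighting function $w:[0,1]\to[0,1]$ is differentiable and strictly increasing with $w(0)=0$, $w(1)=1$. The pricing kernel $\rho>0$ is a random variable with $\mathbf E[\rho]<\infty$, and it is atomless, meaning that its cumulative distribution function $F_\rho$ is continuous. The number $x_0>0$ is the initial endowment. The quantile function of a real random variable with distribution function $F$ is its right-continuous inverse $x\mapsto\sup\{t\in\mathbb R:F(t)\le x\}$, $x\in(0,1)$; $F_\rho^{-1}$ denotes the quantile function of $\rho$. In this setting a "quantile function" means an element of the set $\mathcal G$ of all functions $(0,1)\to\mathbb R^+$ that are increasing (in the weak sense) and right-continuous with left limits. Put $\nu(x):=1-w^{-1}(1-x)$, $x\in[0,1]$; $\nu$ is also differentiable and strictly increasing on $[0,1]$. Define $$\varphi(x):=-\int_x^1F_\rho^{-1}(1-\nu(y))\,\nu'(y)\,dy=-\int_0^{w^{-1}(1-x)}F_\rho^{-1}(y)\,dy,\qquad x\in[0,1],$$ which is differentiable and strictly increasing with $\varphi(0)=-\mathbf E[\rho]$,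 $\varphi(1)=0$. Let $\delta$ be the concave envelope of $\varphi$ on $[0,1]$: $$\delta(x)=\sup_{0\le a\le x\le b\le 1}\frac{(b-x)\varphi(a)+(x-a)\varphi(b)}{b-a},\qquad x\in[0,1].$$ Its derivative $\delta'$ is decreasing, and $\widetilde\rho$ is a positive random variable whose quantile function is $F_{\widetilde\rho}^{-1}(x):=\delta'(1-x)$, $x\in(0,1)$, chosen to be comonotonic with $\rho$; concretely, $\widetilde\rho=\delta'(1-F_\rho(\rho))$. (The variable $\widetilde\rho$ may have atoms.) Two random variables $X,Y$ are comonotonic if $(X(\omega')-X(\omega))(Y(\omega')-Y(\omega))\ge0$ almost surely under $\mathbf P\otimes\mathbf P$. An optimal solution is an admissible $X$ attaining the supremum; equalities between random variables are almost sure.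
   Formalization: An optimal solution is required to attain a finite supremum; if the supremum is +∞, admissible X of infinite utility would count as optimal and both (1) and (2) fail (e.g. u = √ with E[1/ρ̃] = ∞). *)

theory Defs
  imports "HOL-Probability.Probability"
begin

abbreviation dist_fun :: "'a measure \<Rightarrow> ('a \<Rightarrow> real) \<Rightarrow> real \<Rightarrow> real" where
  "dist_fun M X \<equiv> cdf (distr M borel X)"

definition quantile :: "'a measure \<Rightarrow> ('a \<Rightarrow> real) \<Rightarrow> real \<Rightarrow> real" where
  "quantile M X = (\<lambda>x\<in>{0<..<1}. Sup {t. dist_fun M X t \<le> x})"

definition quantile_functions :: "(real \<Rightarrow> real) set" where
  "quantile_functions =
     {Q \<in> {0<..<1} \<rightarrow>\<^sub>E {0..}.
        mono_on {0<..<1} Q \<and>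
        (\<forall>x\<in>{0<..<1}. continuous (at_right x) Q \<and> (\<exists>l. (Q \<longlongrightarrow> l) (at_left x)))}"

definition phi :: "'a measure \<Rightarrow> ('a \<Rightarrow> real) \<Rightarrow> (real \<Rightarrow> real) \<Rightarrow> real \<Rightarrow> real" where
  "phi M \<rho> w x = - (LINT y:{0<..<inv_into {0..1} w (1 - x)}|lborel. quantile M \<rho> y)"

(* a < b excludes only the degenerate quotient 0/0 at a = x = b; the value f x is still
   among the chords (a = x or b = x). *)
definition concave_envelope :: "(real \<Rightarrow> real) \<Rightarrow> real \<Rightarrow> real" where
  "concave_envelope f x =
     Sup {((b - x) * f a + (x - a) * f b) / (b - a) | a b.
            0 \<le> a \<and> a \<le> x \<and> x \<le> b \<and> b \<le> 1 \<and> a < b}"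

definition delta :: "'a measure \<Rightarrow> ('a \<Rightarrow> real) \<Rightarrow> (real \<Rightarrow> real) \<Rightarrow> real \<Rightarrow> real" where
  "delta M \<rho> w = concave_envelope (phi M \<rho> w)"

(* The left derivative of the concave function delta: it exists on all of (0,1), is the
   derivative wherever delta is differentiable, and makes x |-> delta' (1 - x)
   right-continuous, as a quantile function has to be. *)
definition delta' :: "'a measure \<Rightarrow> ('a \<Rightarrow> real) \<Rightarrow> (real \<Rightarrow> real) \<Rightarrow> real \<Rightarrow> real" where
  "delta' M \<rho> w x = vector_derivative (delta M \<rho> w) (at_left x)"

definition rho_tilde :: "'a measure \<Rightarrow> ('a \<Rightarrow> real) \<Rightarrow> (real \<Rightarrow> real) \<Rightarrow> 'a \<Rightarrow> real" where
  "rho_tilde M \<rho> w \<omega> = delta' M \<rho> w (1 - dist_fun M \<rho> (\<rho> \<omega>))"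

definition comonotonic :: "'a measure \<Rightarrow> ('a \<Rightarrow> real) \<Rightarrow> ('a \<Rightarrow> real) \<Rightarrow> bool" where
  "comonotonic M X Y \<longleftrightarrow>
     (AE (\<omega>, \<omega>') in M \<Otimes>\<^sub>M M. (X \<omega>' - X \<omega>) * (Y \<omega>' - Y \<omega>) \<ge> 0)"

(* The Bochner integral is 0 on non-integrable functions; an unbounded utility needs the
   value \<infinity> instead. A utility on [0,\<infinity>) is bounded below, so the second term is finite
   in both objectives. *)
definition ext_integral :: "'b measure \<Rightarrow> ('b \<Rightarrow> real) \<Rightarrow> ereal" where
  "ext_integral N f =
     enn2ereal (\<integral>\<^sup>+ x. ennreal (f x) \<partial>N) - enn2ereal (\<integral>\<^sup>+ x. ennreal (- f x) \<partial>N)"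

(* Lebesgue-Stieltjes integral over the closed half-line: an atom of X at 0 contributes. *)
definition rdu :: "'a measure \<Rightarrow> (real \<Rightarrow> real) \<Rightarrow> (real \<Rightarrow> real) \<Rightarrow> ('a \<Rightarrow> real) \<Rightarrow> ereal" where
  "rdu M w u X =
     ext_integral (interval_measure (\<lambda>x. 1 - w (1 - dist_fun M X x)))
       (\<lambda>x. indicator {0..} x * u x)"

definition expected_utility :: "'a measure \<Rightarrow> (real \<Rightarrow> real) \<Rightarrow> ('a \<Rightarrow> real) \<Rightarrow> ereal" where
  "expected_utility M u X = ext_integral M (\<lambda>\<omega>. u (X \<omega>))"

definition admissible :: "'a measure \<Rightarrow> ('a \<Rightarrow> real) \<Rightarrow> real \<Rightarrow> ('a \<Rightarrow> real) set" where
  "admissible M \<xi> x0 =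
     {X \<in> borel_measurable M.
        (AE \<omega> in M. X \<omega> \<ge> 0) \<and>
        integrable M (\<lambda>\<omega>. \<xi> \<omega> * X \<omega>) \<and> (\<integral>\<omega>. \<xi> \<omega> * X \<omega> \<partial>M) = x0}"

(* The supremum is required to be a real number: if it is \<infinity>, every admissible X of infinite
   utility would count as a maximizer and the correspondence between the two problems fails. *)
definition optimal_solution ::
    "(('a \<Rightarrow> real) \<Rightarrow> ereal) \<Rightarrow> ('a \<Rightarrow> real) set \<Rightarrow> ('a \<Rightarrow> real) \<Rightarrow> bool" where
  "optimal_solution J A X \<longleftrightarrow> X \<in> A \<and> J X = (SUP Y\<in>A. J Y) \<and> \<bar>J X\<bar> \<noteq> \<infinity>"

definition optimal_R :: "'a measure \<Rightarrow> (real \<Rightarrow> real) \<Rightarrow> (real \<Rightarrow> real) \<Rightarrow>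
    ('a \<Rightarrow> real) \<Rightarrow> real \<Rightarrow> ('a \<Rightarrow> real) \<Rightarrow> bool" where
  "optimal_R M u w \<rho> x0 = optimal_solution (rdu M w u) (admissible M \<rho> x0)"

definition optimal_E :: "'a measure \<Rightarrow> (real \<Rightarrow> real) \<Rightarrow> (real \<Rightarrow> real) \<Rightarrow>
    ('a \<Rightarrow> real) \<Rightarrow> real \<Rightarrow> ('a \<Rightarrow> real) \<Rightarrow> bool" where
  "optimal_E M u w \<rho> x0 =
     optimal_solution (expected_utility M u) (admissible M (rho_tilde M \<rho> w) x0)"

end

theory Submission
  imports Defs
begin

text \<open>
  On the level of quantiles both problems maximise the integral of \<open>u \<circ> Q\<close> over the unit interval among
  increasing \<open>Q \<ge> 0\<close>. In (R) the budget is the integral of \<open>Q\<close> against the measure \<open>N\<close> that gives \<open>{c<..1}\<close>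
  the mass \<open>\<phi> 1 - \<phi> c\<close>, in (E) it is the integral of \<open>Q\<close> against \<open>\<delta>' dx\<close>. (Since \<open>w'\<close> may vanish, \<open>\<phi>\<close> need
  not be absolutely continuous and \<open>N\<close> need not have a density.) By the layer cake formula both budgets
  depend on \<open>Q\<close> only through the lengths of the sets \<open>Q \<le> t\<close>, so \<open>\<phi> \<le> \<delta>\<close> makes every \<open>Q\<close> at most as
  expensive in (E) as in (R), with equality if all these lengths are points where \<open>\<phi> = \<delta>\<close>. Averaging \<open>Q\<close>
  over the components of \<open>\<phi> < \<delta>\<close>, on which \<open>\<delta>'\<close> is constant, keeps its price in (E), does not decrease the
  utility by Jensen's inequality, and produces this equality. Hence the two quantile problems have the same
  maximisers, and no Lagrange multiplier is needed.

  Random variables enter through rearrangement: among all variables with a given law, the one antimonotone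
  with the pricing kernel is cheapest, and it is the only cheapest one because the kernel is atomless.
\<close>

section \<open>The concave envelope of a continuous function on the unit interval\<close>

text \<open>The transfer of maximisers is not symmetric. From (R) to (E), flattening turns any
  competitor into one whose price in (R) is its cost in (E). From (E) to (R), the given maximiser
  itself must be shown to cost the same in both problems: its midpoint with its own flattening has
  the same cost, so strict concavity forces it to be flat on the gaps already. Such strict
  comparisons of integrals break down for infinite values, which is where finiteness of the optimum
  enters. Optimality is only known against competitors that spend exactly \<open>x0\<close>, whereas
  the estimates produce competitors that spend at most \<open>x0\<close>. The slack is spent on an
  added constant, whose price is the same in both problems because both pricing measures have total
  mass \<open>f 1 - f 0\<close>. Replacing the utility by \<open>v = u - u 0 \<ge> 0\<close> lets
  all of this run in \<open>ennreal\<close>. The coordinate \<open>P\<close> (one minus the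
  distribution function at \<rho>) is uniform and carries (E); its distortion \<open>V\<close>
  carries (R).\<close>

lemma frac_le_fracI:
  fixes a b c d :: real
  assumes "0 < b" "0 < d" "a * d \<le> c * b"
  shows "a / b \<le> c / d"
  using assms by (simp add: pos_divide_le_eq pos_le_divide_eq)

locale envelope =
  fixes f :: "real \<Rightarrow> real"
  assumes cont: "continuous_on {0..1} f"
begin

abbreviation g :: "real \<Rightarrow> real" where "g \<equiv> concave_envelope f"

abbreviation chord :: "real \<Rightarrow> real \<Rightarrow> real \<Rightarrow> real" where
  "chord a b x \<equiv> ((b - x) * f a + (x - a) * f b) / (b - a)"

lemma chord_le_affine:
  assumes "a \<le> x" "x \<le> b" "a < b" "f a \<le> c + s * a" "f b \<le> c + s * b"
  shows "chord a b x \<le> c + s * x"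
proof -
  have "(b - x) * f a + (x - a) * f b \<le> (b - x) * (c + s * a) + (x - a) * (c + s * b)"
    using assms by (intro add_mono mult_left_mono) auto
  also have "\<dots> = (c + s * x) * (b - a)" by (simp add: algebra_simps)
  finally show ?thesis using assms by (simp add: pos_divide_le_eq)
qed

lemma f_bounded: obtains B where "\<And>z. z \<in> {0..1} \<Longrightarrow> \<bar>f z\<bar> \<le> B"
proof -
  have "bounded (f ` {0..1})" using cont by (intro compact_imp_bounded compact_continuous_image) auto
  then obtain B where "\<forall>v\<in>f ` {0..1}. norm v \<le> B" unfolding bounded_iff by blast
  then show thesis using that[of B] by auto
qed

lemma chords_bdd:
  "bdd_above {chord a b x | a b. 0 \<le> a \<and> a \<le> x \<and> x \<le> b \<and> b \<le> 1 \<and> a < b}"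
proof -
  obtain B where B: "\<And>z. z \<in> {0..1} \<Longrightarrow> \<bar>f z\<bar> \<le> B" using f_bounded by blast
  show ?thesis
  proof (rule bdd_aboveI, clarify)
    fix a b assume "0 \<le> a" "a \<le> x" "x \<le> b" "b \<le> 1" "a < b"
    then show "chord a b x \<le> B" using chord_le_affine[of a x b B 0] B[of a] B[of b] by auto
  qed
qed

lemma chord_le_env:
  assumes "0 \<le> a" "a \<le> x" "x \<le> b" "b \<le> 1" "a < b"
  shows "chord a b x \<le> g x"
  unfolding concave_envelope_def using assms by (intro cSup_upper chords_bdd) auto

lemma env_le_affine:
  assumes "x \<in> {0..1}" "\<And>z. z \<in> {0..1} \<Longrightarrow> f z \<le> c + s * z"
  shows "g x \<le> c + s * x"
  unfolding concave_envelope_def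
proof (rule cSup_least)
  show "{chord a b x | a b. 0 \<le> a \<and> a \<le> x \<and> x \<le> b \<and> b \<le> 1 \<and> a < b} \<noteq> {}"
    using assms(1) zero_less_one by fastforce
qed (use assms in \<open>auto intro!: chord_le_affine\<close>)

lemma le_env:
  assumes "x \<in> {0..1}"
  shows "f x \<le> g x"
proof (cases "x = 1")
  case True then show ?thesis using chord_le_env[of 0 1 1] by simp
next
  case False
  then show ?thesis using chord_le_env[of x x 1] assms by simp
qed

text \<open>At an end of the unit interval every admissible chord starts there and puts its whole
  weight on that end, so the supremum runs over a single value.\<close>

lemma env_0: "g 0 = f 0"
proof -
  have "{chord a b 0 | a b. 0 \<le> a \<and> a \<le> 0 \<and> 0 \<le> b \<and> b \<le> 1 \<and> a < b} = {f 0}"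
    (is "?A = _")
  proof
    have "f 0 = chord 0 1 0" by simp
    then show "{f 0} \<subseteq> ?A" by (smt (verit) CollectI empty_subsetI insert_subset)
  qed auto
  then show ?thesis unfolding concave_envelope_def by (metis cSup_singleton)
qed

lemma env_1: "g 1 = f 1"
proof -
  have "{chord a b 1 | a b. 0 \<le> a \<and> a \<le> 1 \<and> 1 \<le> b \<and> b \<le> 1 \<and> a < b} = {f 1}"
    (is "?A = _")
  proof
    have "f 1 = chord 0 1 1" by simp
    then show "{f 1} \<subseteq> ?A" by (smt (verit) CollectI empty_subsetI insert_subset)
  qed auto
  then show ?thesis unfolding concave_envelope_def by (metis cSup_singleton)
qed

text \<open>The slope is squeezed between the slopes of the chords to the right and to the left of \<open>x\<close>: that no chord
passes above the point is exactly the compatibility of these slopes.\<close>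

lemma env_support:
  assumes x: "x \<in> {0<..<1}"
  obtains s where "\<And>z. z \<in> {0..1} \<Longrightarrow> f z \<le> g x + s * (z - x)"
proof -
  have cmp: "(f b - g x) / (b - x) \<le> (g x - f a) / (x - a)"
    if "a \<in> {0..<x}" "b \<in> {x<..1}" for a b
  proof -
    have "chord a b x \<le> g x" using that x by (intro chord_le_env) auto
    then have "(b - x) * f a + (x - a) * f b \<le> g x * (b - a)"
      using that by (simp add: pos_divide_le_eq)
    then show ?thesis using that by (intro frac_le_fracI) (auto simp: algebra_simps)
  qed
  define s where "s = Sup ((\<lambda>b. (f b - g x) / (b - x)) ` {x<..1})"
  have ne: "{x<..1} \<noteq> {}" using x by auto
  have bdd: "bdd_above ((\<lambda>b. (f b - g x) / (b - x)) ` {x<..1})"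
    using cmp[of 0] x by (intro bdd_aboveI2[of _ _ "(g x - f 0) / (x - 0)"]) auto
  have "f z \<le> g x + s * (z - x)" if z: "z \<in> {0..1}" for z
  proof (cases z x rule: linorder_cases)
    case less
    have "s \<le> (g x - f z) / (x - z)"
      unfolding s_def using ne cmp[of z] less z by (intro cSUP_least) auto
    then have "s * (x - z) \<le> g x - f z" using less by (simp add: pos_le_divide_eq)
    then show ?thesis by (simp add: algebra_simps)
  next
    case equal
    then show ?thesis using le_env z by simp
  next
    case greater
    have "(f z - g x) / (z - x) \<le> s"
      unfolding s_def using bdd greater z by (intro cSUP_upper) auto
    then show ?thesis using greater by (simp add: pos_divide_le_eq algebra_simps)
  qed
  then show thesis by (rule that)
qed

text \<open>The line supporting \<open>f\<close> from above is an affine majorant of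
  \<open>f\<close>, hence by \<open>env_le_affine\<close> also of the envelope. All concavity of
  \<open>g\<close> below is drawn from this.\<close>

lemma env_supergradient:
  assumes "x \<in> {0<..<1}"
  obtains s where "\<And>z. z \<in> {0..1} \<Longrightarrow> f z \<le> g x + s * (z - x)"
    "\<And>z. z \<in> {0..1} \<Longrightarrow> g z \<le> g x + s * (z - x)"
proof -
  obtain s where s: "\<And>z. z \<in> {0..1} \<Longrightarrow> f z \<le> g x + s * (z - x)"
    using env_support[OF assms] by blast
  have "g z \<le> g x + s * (z - x)" if "z \<in> {0..1}" for z
    using env_le_affine[OF that, of "g x - s * x" s] s by (simp add: algebra_simps)
  then show thesis using s that by blast
qed

text \<open>A supergradient at the middle point \<open>y\<close> separates the secant slope on its
  right from the one on its left.\<close>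

lemma env_slopes:
  assumes "0 \<le> x" "x < y" "y < z" "z \<le> 1"
  shows "(g z - g x) / (z - x) \<le> (g y - g x) / (y - x)"
    and "(g z - g y) / (z - y) \<le> (g z - g x) / (z - x)"
    and "(g z - g y) / (z - y) \<le> (g y - g x) / (y - x)"
proof -
  obtain s where s: "\<And>z. z \<in> {0..1} \<Longrightarrow> g z \<le> g y + s * (z - y)"
    using env_supergradient[of y] assms by (metis greaterThanLessThan_iff le_less_trans less_le_trans)
  have 1: "(g z - g y) \<le> s * (z - y)" "s * (y - x) \<le> g y - g x"
    using s[of x] s[of z] assms by (auto simp: algebra_simps)
  have 2: "(g z - g y) / (z - y) \<le> s" "s \<le> (g y - g x) / (y - x)"
    using 1 assms by (auto simp: field_simps)
  \<comment> \<open>The comparison with denominators cleared; the two slopes over the long interval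
    from \<open>x\<close> to \<open>z\<close> then follow by pure algebra.\<close>
  have A: "(g z - g y) * (y - x) \<le> (g y - g x) * (z - y)"
  proof -
    have "(g z - g y) * (y - x) \<le> s * (z - y) * (y - x)" using 1 assms by (intro mult_right_mono) auto
    also have "\<dots> = (s * (y - x)) * (z - y)" by simp
    also have "\<dots> \<le> (g y - g x) * (z - y)" using 1 assms by (intro mult_right_mono) auto
    finally show ?thesis .
  qed
  show "(g z - g y) / (z - y) \<le> (g y - g x) / (y - x)" using 2 by linarith
  have "(g z - g x) * (y - x) \<le> (g y - g x) * (z - x)" "(g z - g y) * (z - x) \<le> (g z - g x) * (z - y)"
    using A by (simp_all add: algebra_simps)
  then show "(g z - g x) / (z - x) \<le> (g y - g x) / (y - x)"
    "(g z - g y) / (z - y) \<le> (g z - g x) / (z - x)"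
    using assms by (simp_all add: frac_le_fracI)
qed

text \<open>Compactness gives a best chord. Every degenerate chord takes the value
  \<open>f x\<close>, which is below \<open>g x\<close>, so the best one has its ends strictly on
  either side of \<open>x\<close>.\<close>

lemma env_attained:
  assumes x: "x \<in> {0<..<1}" and gt: "f x < g x"
  obtains a b where "0 \<le> a" "a < x" "x < b" "b \<le> 1" "chord a b x = g x"
proof -
  \<comment> \<open>The quotient in \<open>chord\<close> is not continuous where
    \<open>a = b\<close>. Parametrising by the weight \<open>t\<close> instead keeps these
    degenerate triples and makes the domain compact; the order of \<open>a\<close> and
    \<open>b\<close> is left free and restored at the end by swapping.\<close>
  define K where "K = ({0..1::real} \<times> {0..1::real} \<times> {0..1::real}) \<inter>
      {p. (1 - snd (snd p)) * fst p + snd (snd p) * fst (snd p) = x}"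
  define h where "h = (\<lambda>p::real \<times> real \<times> real.
      (1 - snd (snd p)) * f (fst p) + snd (snd p) * f (fst (snd p)))"
  have cl: "closed {p::real \<times> real \<times> real. (1 - snd (snd p)) * fst p + snd (snd p) * fst (snd p) = x}"
    by (intro closed_Collect_eq continuous_intros)
  have K: "compact K" unfolding K_def by (intro compact_Int_closed compact_Times cl) auto
  have "(x, x, 0) \<in> K" using x unfolding K_def by auto
  then have ne: "K \<noteq> {}" by auto
  have "continuous_on K h" unfolding h_def
    by (intro continuous_intros continuous_on_compose2[OF cont]) (auto simp: K_def)
  then obtain p where p: "p \<in> K" "\<And>q. q \<in> K \<Longrightarrow> h q \<le> h p"
    using continuous_attains_sup[OF K ne] by blast
  obtain a b t where abt: "p = (a, b, t)" by (cases p) auto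
  have pK: "a \<in> {0..1}" "b \<in> {0..1}" "t \<in> {0..1}" "(1 - t) * a + t * b = x"
    using p(1) unfolding K_def abt by auto
  have "g x \<le> h p"
    unfolding concave_envelope_def
  proof (rule cSup_least)
    show "{chord a b x | a b. 0 \<le> a \<and> a \<le> x \<and> x \<le> b \<and> b \<le> 1 \<and> a < b} \<noteq> {}"
      using x chord_le_env[of 0 x 1] by fastforce
    fix v assume "v \<in> {chord a b x | a b. 0 \<le> a \<and> a \<le> x \<and> x \<le> b \<and> b \<le> 1 \<and> a < b}"
    then obtain c d where v: "v = chord c d x" and cd: "0 \<le> c" "c \<le> x" "x \<le> d" "d \<le> 1" "c < d"
      by blast
    define r where "r = (x - c) / (d - c)"
    have r: "0 \<le> r" "r \<le> 1" "1 - r = (d - x) / (d - c)"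
      using cd unfolding r_def by (auto simp: field_simps)
    have "v = (1 - r) * f c + r * f d" unfolding v r(3) unfolding r_def
      by (simp add: add_divide_distrib)
    moreover have "r * (d - c) = x - c" using cd unfolding r_def by simp
    then have "(1 - r) * c + r * d = x" by (simp add: algebra_simps)
    then have "(c, d, r) \<in> K" using cd r unfolding K_def by auto
    ultimately show "v \<le> h p" using p(2)[of "(c, d, r)"] unfolding h_def by simp
  qed
  then have ge: "g x \<le> (1 - t) * f a + t * f b" unfolding h_def abt by simp
  have t: "t \<noteq> 0" "t \<noteq> 1" "a \<noteq> b"
  proof -
    show "t \<noteq> 0" "t \<noteq> 1" using ge gt pK(4) by auto
    show "a \<noteq> b"
    proof
      assume "a = b"
      then have "a = x" "g x \<le> f a" using ge pK(4) by (auto simp: left_diff_distrib)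
      then show False using gt by simp
    qed
  qed
  note witness = that
  have main: thesis
    if "c \<in> {0..1}" "d \<in> {0..1}" "0 < r" "r < 1" "(1 - r) * c + r * d = x" "c < d"
      "g x \<le> (1 - r) * f c + r * f d" for c d r
  proof -
    have xc: "x - c = r * (d - c)" "d - x = (1 - r) * (d - c)"
    proof -
      show "x - c = r * (d - c)" using that(5) by (simp add: algebra_simps)
      then show "d - x = (1 - r) * (d - c)" by (simp add: left_diff_distrib)
    qed
    have "0 < x - c" "0 < d - x" unfolding xc using that by auto
    then have lt: "c < x" "x < d" by auto
    have "((1 - r) * (d - c)) * f c + (r * (d - c)) * f d = ((1 - r) * f c + r * f d) * (d - c)"
      by (simp add: algebra_simps)
    then have "(d - x) * f c + (x - c) * f d = ((1 - r) * f c + r * f d) * (d - c)"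
      using xc by presburger
    then have "chord c d x = (1 - r) * f c + r * f d" using that(6) by simp
    moreover have "chord c d x \<le> g x" using that lt by (intro chord_le_env) auto
    ultimately show thesis using that lt by (intro witness[of c d]) auto
  qed
  show thesis
  proof (cases "a < b")
    case True
    then show ?thesis using main[of a b t] pK t ge by auto
  next
    case False
    then show ?thesis using main[of b a "1 - t"] pK t ge by (auto simp: algebra_simps)
  qed
qed

text \<open>The attaining chord meets a supporting line at \<open>x\<close>. Its end values lie
  below that line while their weighted mean lies on it, so both ends lie on it. Between the ends
  \<open>g\<close> is squeezed between chord and line.\<close>

lemma env_affine_piece:
  assumes x: "x \<in> {0<..<1}" and gt: "f x < g x"
  obtains a b s where "0 \<le> a" "a < x" "x < b" "b \<le> 1" "f a = g a" "f b = g b"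
    "\<And>z. z \<in> {a..b} \<Longrightarrow> g z = g x + s * (z - x)"
proof -
  obtain a b where ab: "0 \<le> a" "a < x" "x < b" "b \<le> 1" "chord a b x = g x"
    using env_attained[OF assms] by blast
  obtain s where s: "\<And>z. z \<in> {0..1} \<Longrightarrow> f z \<le> g x + s * (z - x)"
    "\<And>z. z \<in> {0..1} \<Longrightarrow> g z \<le> g x + s * (z - x)"
    using env_supergradient[OF x] by blast
  have eq: "(b - x) * f a + (x - a) * f b = g x * (b - a)"
    using ab by (simp add: field_simps)
  have la: "f a \<le> g x + s * (a - x)" and lb: "f b \<le> g x + s * (b - x)" using s(1) ab by auto
  have fa: "f a = g x + s * (a - x)"
  proof (rule ccontr)
    assume "f a \<noteq> g x + s * (a - x)"
    then have "(b - x) * f a < (b - x) * (g x + s * (a - x))"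
      using la ab by (intro mult_strict_left_mono) auto
    moreover have "(x - a) * f b \<le> (x - a) * (g x + s * (b - x))"
      using lb ab by (intro mult_left_mono) auto
    ultimately show False using eq by (simp add: algebra_simps)
  qed
  have fb: "f b = g x + s * (b - x)"
  proof (rule ccontr)
    assume "f b \<noteq> g x + s * (b - x)"
    then have "(x - a) * f b < (x - a) * (g x + s * (b - x))"
      using lb ab by (intro mult_strict_left_mono) auto
    moreover have "(b - x) * f a \<le> (b - x) * (g x + s * (a - x))"
      using la ab by (intro mult_left_mono) auto
    ultimately show False using eq by (simp add: algebra_simps)
  qed
  have lin: "g z = g x + s * (z - x)" if "z \<in> {a..b}" for z
  proof (rule antisym)
    show "g z \<le> g x + s * (z - x)" using s(2) that ab by auto
    have "(b - z) * f a + (z - a) * f b = (g x + s * (z - x)) * (b - a)"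
      unfolding fa fb by (simp add: algebra_simps)
    moreover have "b - a \<noteq> 0" using ab by simp
    ultimately have "chord a b z = g x + s * (z - x)" by (metis nonzero_mult_div_cancel_right)
    then show "g x + s * (z - x) \<le> g z" using chord_le_env[of a z b] that ab by auto
  qed
  show thesis
  proof (rule that)
    have "a \<in> {a..b}" "b \<in> {a..b}" using ab by auto
    then show "f a = g a" "f b = g b" using lin fa fb by metis+
  qed (fact ab lin)+
qed

text \<open>Upper bounds for the envelope must come from affine majorants on the whole interval:
  continuity of \<open>f\<close> at 0 controls \<open>z < d\<close>, and a steep slope takes care of
  the rest.\<close>

lemma env_le_near_0:
  assumes e: "0 < e"
  obtains K where "\<And>x. x \<in> {0..1} \<Longrightarrow> g x \<le> f 0 + e + K * x"
proof -
  obtain B where B: "\<And>z. z \<in> {0..1} \<Longrightarrow> \<bar>f z\<bar> \<le> B" using f_bounded by blast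
  have B0: "0 \<le> B" using B[of 0] by auto
  obtain d where d: "0 < d" "\<And>z. z \<in> {0..1} \<Longrightarrow> dist z 0 < d \<Longrightarrow> dist (f z) (f 0) < e"
    using cont e unfolding continuous_on_iff by (metis atLeastAtMost_iff order_refl zero_le_one)
  \<comment> \<open>The slope \<open>2 * B / d\<close> gains at least \<open>2 * B\<close> beyond
    \<open>d\<close>, which is the largest possible oscillation of \<open>f\<close>.\<close>
  have "f z \<le> f 0 + e + 2 * B / d * z" if z: "z \<in> {0..1}" for z
  proof (cases "z < d")
    case True
    then have "f z \<le> f 0 + e" using d(2)[OF z] z by (auto simp: dist_real_def)
    moreover have "0 \<le> 2 * B / d * z" using B0 d z by auto
    ultimately show ?thesis by linarith
  next
    case False
    then have "2 * B / d * d \<le> 2 * B / d * z" using B0 d z by (intro mult_left_mono) auto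
    then have "2 * B \<le> 2 * B / d * z" using d(1) by simp
    then show ?thesis using B[OF z] B[of 0] e by auto
  qed
  then show thesis using env_le_affine that by blast
qed

lemma env_tendsto_0: "(g \<longlongrightarrow> g 0) (at_right 0)"
proof (rule order_tendstoI)
  have I: "\<forall>\<^sub>F x in at_right 0. x \<in> {0<..<1::real}"
    by (intro eventually_at_right_real) auto
  fix a assume a: "g 0 < a"
  define e where "e = (a - f 0) / 2"
  have e: "0 < e" using a env_0 unfolding e_def by simp
  obtain K where K: "\<And>x. x \<in> {0..1} \<Longrightarrow> g x \<le> f 0 + e + K * x"
    using env_le_near_0[OF e] by blast
  have "((\<lambda>x. f 0 + e + K * x) \<longlongrightarrow> f 0 + e + K * 0) (at_right 0)"
    by (intro tendsto_intros)
  then have "\<forall>\<^sub>F x in at_right 0. f 0 + e + K * x < a"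
    by (rule order_tendstoD) (use e in \<open>auto simp: e_def field_simps\<close>)
  with I show "\<forall>\<^sub>F x in at_right 0. g x < a"
  proof eventually_elim
    case (elim x)
    then show ?case using K[of x] by auto
  qed
next
  have I: "\<forall>\<^sub>F x in at_right 0. x \<in> {0<..<1::real}"
    by (intro eventually_at_right_real) auto
  fix a assume a: "a < g 0"
  have "((\<lambda>x. (1 - x) * f 0 + x * f 1) \<longlongrightarrow> (1 - 0) * f 0 + 0 * f 1) (at_right 0)"
    by (intro tendsto_intros)
  then have "\<forall>\<^sub>F x in at_right 0. a < (1 - x) * f 0 + x * f 1"
    by (rule order_tendstoD) (use a env_0 in auto)
  with I show "\<forall>\<^sub>F x in at_right 0. a < g x"
  proof eventually_elim
    case (elim x)
    then show ?case using chord_le_env[of 0 x 1] by auto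
  qed
qed

text \<open>The secant slopes \<open>q z\<close> decrease as \<open>z\<close> increases to
  \<open>x\<close>, so they converge to their infimum. Every slope to the right of \<open>x\<close>
  is a lower bound for them, hence the infimum is itself a supergradient.\<close>

lemma env_left_derivative:
  assumes x: "x \<in> {0<..<1}"
  obtains D where "(g has_vector_derivative D) (at_left x)"
    "\<And>z. z \<in> {0..1} \<Longrightarrow> g z \<le> g x + D * (z - x)"
proof -
  define q where "q = (\<lambda>z. (g x - g z) / (x - z))"
  define D where "D = Inf (q ` {0<..<x})"
  have above: "(g y - g x) / (y - x) \<le> q z" if "z \<in> {0..<x}" "y \<in> {x<..1}" for y z
    using env_slopes(3)[of z x y] that unfolding q_def by auto
  have anti: "q z \<le> q y" if "0 \<le> y" "y \<le> z" "z < x" for y z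
    using env_slopes(2)[of y z x] that x unfolding q_def by (cases "y = z") auto
  have ne: "q ` {0<..<x} \<noteq> {}" using x by auto
  have bdd: "bdd_below (q ` {0<..<x})"
    using above[of _ 1] x by (intro bdd_belowI2[of _ "(g 1 - g x) / (1 - x)"]) auto
  have near: "\<forall>\<^sub>F z in at_left x. z \<in> {c<..<x}" if "c < x" for c
    using that by (intro eventually_at_left_real) auto
  have "(q \<longlongrightarrow> D) (at_left x)"
  proof (rule decreasing_tendsto)
    show "\<forall>\<^sub>F z in at_left x. D \<le> q z"
      using near[of 0] x by (auto elim!: eventually_mono simp: D_def intro!: cInf_lower bdd)
    fix c assume "D < c"
    then obtain v where "v \<in> q ` {0<..<x}" "v < c"
      using cInf_lessD[OF ne] unfolding D_def by blast
    then obtain y where y: "y \<in> {0<..<x}" "q y < c" by blast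
    have "\<forall>\<^sub>F z in at_left x. z \<in> {y<..<x}" using near y by auto
    then show "\<forall>\<^sub>F z in at_left x. q z < c"
    proof eventually_elim
      case (elim z)
      then show ?case using anti[of y z] y by auto
    qed
  qed
  moreover have "q = (\<lambda>z. (g z - g x) / (z - x))"
  proof
    fix z show "q z = (g z - g x) / (z - x)"
      unfolding q_def using minus_divide_divide[of "g z - g x" "z - x"] by simp
  qed
  ultimately have der: "(g has_vector_derivative D) (at_left x)"
    by (simp add: has_field_derivative_iff flip: has_real_derivative_iff_has_vector_derivative)
  \<comment> \<open>The infimum ranges over \<open>z > 0\<close> only, so \<open>z = 0\<close> is
    reached through the midpoint of \<open>z\<close> and \<open>x\<close>.\<close>
  have Dle: "D \<le> q z" if "z \<in> {0..<x}" for z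
  proof -
    have "D \<le> q ((z + x) / 2)" unfolding D_def using that x by (intro cInf_lower bdd) auto
    also have "\<dots> \<le> q z" using anti[of z "(z + x) / 2"] that by auto
    finally show ?thesis .
  qed
  have "g z \<le> g x + D * (z - x)" if z: "z \<in> {0..1}" for z
  proof (cases z x rule: linorder_cases)
    case less
    then have "D \<le> (g x - g z) / (x - z)" "0 < x - z" using Dle[of z] z unfolding q_def by auto
    then have "D * (x - z) \<le> g x - g z" by (metis pos_le_divide_eq)
    then show ?thesis by (simp add: algebra_simps)
  next
    case greater
    then have "(g z - g x) / (z - x) \<le> D"
      unfolding D_def using above z by (intro cINF_greatest) (use x in auto)
    moreover have "0 < z - x" using greater by simp
    ultimately have "g z - g x \<le> D * (z - x)" by (metis pos_divide_le_eq)
    then show ?thesis by (simp add: algebra_simps)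
  qed auto
  then show thesis using der that by blast
qed

definition env' :: "real \<Rightarrow> real" where
  "env' x = vector_derivative g (at_left x)"

lemma env'_supergradient:
  assumes "x \<in> {0<..<1}" "z \<in> {0..1}"
  shows "g z \<le> g x + env' x * (z - x)"
proof -
  obtain D where D: "(g has_vector_derivative D) (at_left x)"
    "\<And>z. z \<in> {0..1} \<Longrightarrow> g z \<le> g x + D * (z - x)"
    using env_left_derivative[OF assms(1)] by blast
  have "env' x = D"
    unfolding env'_def by (rule vector_derivative_within[OF trivial_limit_at_left_real D(1)])
  then show ?thesis using D(2)[OF assms(2)] by simp
qed

lemma env'_sandwich:
  assumes "0 < x" "x < y" "y < 1"
  shows "env' y * (y - x) \<le> g y - g x" "g y - g x \<le> env' x * (y - x)"
  using env'_supergradient[of x y] env'_supergradient[of y x] assms by (auto simp: algebra_simps)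

lemma env'_antimono:
  assumes "0 < x" "x \<le> y" "y < 1"
  shows "env' y \<le> env' x"
proof (cases "x = y")
  case False
  then have "env' y * (y - x) \<le> env' x * (y - x)"
    using env'_sandwich[of x y] assms by (meson le_less_trans order.trans order_le_imp_less_or_eq)
  then show ?thesis using False assms by simp
qed auto

text \<open>The supergradient inequality, tested at the two ends of the affine stretch, pins the
  slope from both sides.\<close>

lemma env'_affine:
  assumes "x \<in> {a<..<b}" "0 \<le> a" "b \<le> 1" "\<And>z. z \<in> {a..b} \<Longrightarrow> g z = c + s * z"
  shows "env' x = s"
proof (rule antisym)
  have x: "x \<in> {0<..<1}" and eq: "g a = c + s * a" "g b = c + s * b" "g x = c + s * x"
    using assms by auto
  have "g a \<le> g x + env' x * (a - x)" "g b \<le> g x + env' x * (b - x)"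
    using env'_supergradient[OF x, of a] env'_supergradient[OF x, of b] assms(1-3) by auto
  then have "env' x * (x - a) \<le> s * (x - a)" "s * (b - x) \<le> env' x * (b - x)"
    unfolding eq by (simp_all add: algebra_simps)
  then show "env' x \<le> s" "s \<le> env' x"
    using assms(1) by (auto dest: mult_right_le_imp_le)
qed

text \<open>On each side of \<open>x\<close> the envelope lies between the supergradient line and
  the chord to the end point of the unit interval on that side.\<close>

lemma env_continuous: "continuous_on {0<..<1} g"
proof -
  have lim: "((\<lambda>z. g x + c * (z - x)) \<longlongrightarrow> g x) (at x within S)" for x c S
  proof -
    have "((\<lambda>z. g x + c * (z - x)) \<longlongrightarrow> g x + c * (x - x)) (at x within S)"
      by (intro tendsto_intros)
    then show ?thesis by simp
  qed
  have flip: "A - B \<le> c * (x - z) \<Longrightarrow> A + c * (z - x) \<le> B" for A B c x z :: real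
    by (simp add: algebra_simps)
  have "isCont g x" if x: "x \<in> {0<..<1}" for x
  proof -
    have "(g \<longlongrightarrow> g x) (at_right x)"
    proof (rule tendsto_sandwich[OF _ _ lim lim])
      have near: "\<forall>\<^sub>F z in at_right x. z \<in> {x<..<1}"
        using x by (intro eventually_at_right_real) auto
      show "\<forall>\<^sub>F z in at_right x. g z \<le> g x + env' x * (z - x)"
        using near by eventually_elim (use env'_supergradient[OF x] x in auto)
      show "\<forall>\<^sub>F z in at_right x. g x + (g 1 - g x) / (1 - x) * (z - x) \<le> g z"
        using near
      proof eventually_elim
        case (elim z)
        then have "(g 1 - g x) / (1 - x) \<le> (g z - g x) / (z - x)" "0 < z - x"
          using env_slopes(1)[of x z 1] x by auto
        then show ?case by (metis pos_le_divide_eq le_diff_eq add.commute)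
      qed
    qed
    moreover have "(g \<longlongrightarrow> g x) (at_left x)"
    proof (rule tendsto_sandwich[OF _ _ lim lim])
      have near: "\<forall>\<^sub>F z in at_left x. z \<in> {0<..<x}"
        using x by (intro eventually_at_left_real) auto
      show "\<forall>\<^sub>F z in at_left x. g z \<le> g x + env' x * (z - x)"
        using near by eventually_elim (use env'_supergradient[OF x] x in auto)
      show "\<forall>\<^sub>F z in at_left x. g x + (g x - g 0) / (x - 0) * (z - x) \<le> g z"
        using near
      proof eventually_elim
        case (elim z)
        then have "(g x - g z) / (x - z) \<le> (g x - g 0) / (x - 0)" "0 < x - z"
          using env_slopes(2)[of 0 z x] x by auto
        then have "g x - g z \<le> (g x - g 0) / (x - 0) * (x - z)" by (metis pos_divide_le_eq)
        then show ?case by (rule flip)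
      qed
    qed
    ultimately show ?thesis unfolding isCont_def using filterlim_at_split by blast
  qed
  then show ?thesis by (intro continuous_at_imp_continuous_on) auto
qed

end

section \<open>The left derivative of the envelope as a density\<close>

text \<open>A fundamental theorem of calculus for supergradients, which need not be two-sided
  derivatives. On each cell of a partition both the integral of \<open>D\<close> and the increment
  of \<open>G\<close> lie between the lower and upper rectangle; for \<open>n\<close> equal cells
  the gaps telescope to \<open>(D a - D b) * (b - a) / n\<close>.\<close>

lemma has_integral_of_monotone_slopes:
  fixes G D :: "real \<Rightarrow> real"
  assumes ab: "a \<le> b"
    and slopes: "\<And>x y. a \<le> x \<Longrightarrow> x < y \<Longrightarrow> y \<le> b \<Longrightarrow>
      D y * (y - x) \<le> G y - G x \<and> G y - G x \<le> D x * (y - x)"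
  shows "(D has_integral G b - G a) {a..b}"
proof -
  have anti: "D y \<le> D x" if "a \<le> x" "x \<le> y" "y \<le> b" for x y
  proof (cases "x = y")
    case False
    then have "x < y" using that by simp
    then have "D y * (y - x) \<le> D x * (y - x)" using slopes[of x y] that by (meson order.trans)
    then show ?thesis using \<open>x < y\<close> by simp
  qed auto
  have int: "D integrable_on {x..y}" if "a \<le> x" "y \<le> b" for x y
  proof -
    have "mono_on {x..y} (\<lambda>t. - D t)" using that anti by (auto intro!: mono_onI)
    then show ?thesis using integrable_on_mono_on integrable_neg by fastforce
  qed
  define I where "I = (\<lambda>x y. integral {x..y} D)"
  have bounds: "D y * (y - x) \<le> I x y \<and> I x y \<le> D x * (y - x)" if "a \<le> x" "x \<le> y" "y \<le> b" for x y
  proof -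
    have "integral {x..y} (\<lambda>_. D y) \<le> I x y"
      unfolding I_def by (rule integral_le) (use that in \<open>auto intro!: int anti\<close>)
    moreover have "I x y \<le> integral {x..y} (\<lambda>_. D x)"
      unfolding I_def by (rule integral_le) (use that in \<open>auto intro!: int anti\<close>)
    ultimately show ?thesis using that by (simp add: mult.commute)
  qed
  have err: "\<bar>I a b - (G b - G a)\<bar> \<le> (D a - D b) * (b - a) / real n" if n: "n > 0" for n :: nat
  proof -
    define h where "h = (b - a) / real n"
    have h: "h \<ge> 0" "real n * h = b - a" using ab n by (auto simp: h_def)
    define x where "x = (\<lambda>i::nat. a + real i * h)"
    have xa: "a \<le> x i" "x i \<le> x (Suc i)" "x (Suc i) - x i = h" for i
      using h by (auto simp: x_def algebra_simps)
    have xb: "x i \<le> b" if "i \<le> n" for i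
    proof -
      have "real i * h \<le> real n * h" using that h by (intro mult_right_mono) auto
      then show ?thesis unfolding x_def using h by auto
    qed
    \<comment> \<open>The induction carries the telescoped error of the first \<open>i\<close>
      cells.\<close>
    have "\<bar>I a (x i) - (G (x i) - G a)\<bar> \<le> (D a - D (x i)) * h" if "i \<le> n" for i
      using that
    proof (induction i)
      case 0
      then show ?case by (simp add: x_def I_def)
    next
      case (Suc i)
      let ?x = "x i" and ?y = "x (Suc i)"
      have y: "?y \<le> b" using xb Suc by auto
      have split: "I a ?y = I a ?x + I ?x ?y"
        unfolding I_def using y xa by (intro Henstock_Kurzweil_Integration.integral_combine[symmetric] int) auto
      have b1: "D ?y * h \<le> I ?x ?y" "I ?x ?y \<le> D ?x * h"
        using bounds[of ?x ?y] xa y by auto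
      have b2: "D ?y * h \<le> G ?y - G ?x \<and> G ?y - G ?x \<le> D ?x * h"
      proof (cases "?x = ?y")
        case True
        then have "h = 0" using xa(3)[of i] by simp
        then show ?thesis using True by simp
      next
        case False
        then have "?x < ?y" using xa(2)[of i] by simp
        from slopes[OF xa(1) this y] show ?thesis using xa(3)[of i] by simp
      qed
      have "\<bar>I a ?y - (G ?y - G a)\<bar> \<le> (D a - D ?x) * h + (D ?x * h - D ?y * h)"
        using Suc b1 b2 split by (auto simp: abs_le_iff)
      then show ?case by (simp add: algebra_simps)
    qed
    from this[of n] have "\<bar>I a (x n) - (G (x n) - G a)\<bar> \<le> (D a - D (x n)) * h" by simp
    moreover have "x n = b" unfolding x_def using h by simp
    ultimately show ?thesis unfolding h_def by simp
  qed
  have "(\<lambda>n. (D a - D b) * (b - a) / real n) \<longlonglongrightarrow> 0" by (rule lim_const_over_n)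
  then have "\<bar>I a b - (G b - G a)\<bar> \<le> 0"
  proof (rule tendsto_lowerbound)
    show "\<forall>\<^sub>F n in sequentially. \<bar>I a b - (G b - G a)\<bar> \<le> (D a - D b) * (b - a) / real n"
      using eventually_gt_at_top[of 0] by eventually_elim (rule err)
  qed simp
  then show ?thesis using int[of a b] unfolding I_def
    by (metis abs_le_zero_iff eq_iff_diff_eq_0 order_refl has_integral_integral)
qed

lemma borel_measurable_indicator_mono_on:
  fixes h :: "real \<Rightarrow> real"
  assumes "mono_on A h" "A \<in> sets borel"
  shows "(\<lambda>x. indicator A x * h x) \<in> borel_measurable borel"
  using borel_measurable_mono_on_fnc[OF assms(1)] assms(2)
  by (subst (asm) borel_measurable_restrict_space_iff) auto

locale increasing_envelope = envelope +
  assumes mono: "strict_mono_on {0..1} f"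
begin

lemma f_le: "x \<in> {0..1} \<Longrightarrow> y \<in> {0..1} \<Longrightarrow> x \<le> y \<Longrightarrow> f x \<le> f y"
  using mono by (auto simp: strict_mono_on_def le_less)

lemma env_le_1: "x \<in> {0..1} \<Longrightarrow> g x \<le> f 1"
  using env_le_affine[of x "f 1" 0] f_le by simp

lemma env_tendsto_1: "(g \<longlongrightarrow> g 1) (at_left 1)"
proof (rule tendsto_sandwich)
  have I: "\<forall>\<^sub>F x in at_left 1. x \<in> {0<..<1::real}"
    by (intro eventually_at_left_real) auto
  show "\<forall>\<^sub>F x in at_left 1. g x \<le> f 1"
    using I by eventually_elim (simp add: env_le_1)
  show "\<forall>\<^sub>F x in at_left 1. (1 - x) * f 0 + x * f 1 \<le> g x"
    using I
  proof eventually_elim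
    case (elim x)
    then show ?case using chord_le_env[of 0 x 1] by auto
  qed
  have "((\<lambda>x. (1 - x) * f 0 + x * f 1) \<longlongrightarrow> (1 - 1) * f 0 + 1 * f 1) (at_left 1)"
    by (intro tendsto_intros)
  then show "((\<lambda>x. (1 - x) * f 0 + x * f 1) \<longlongrightarrow> g 1) (at_left 1)" using env_1 by simp
  show "((\<lambda>x. f 1) \<longlongrightarrow> g 1) (at_left 1)" using env_1 by simp
qed

lemma env'_nonneg:
  assumes x: "x \<in> {0<..<1}"
  shows "0 \<le> env' x"
proof -
  have "g 1 \<le> g x + env' x * (1 - x)" using env'_supergradient[OF x] by simp
  then have "0 \<le> env' x * (1 - x)" using env_le_1[of x] env_1 x by auto
  then show ?thesis using x by (simp add: zero_le_mult_iff)
qed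

lemma env'_measurable [measurable]: "(\<lambda>x. indicator {0<..<1} x * env' x) \<in> borel_measurable borel"
proof -
  have "mono_on {0<..<1} (\<lambda>x. - env' x)" using env'_antimono by (auto intro!: mono_onI)
  then have "(\<lambda>x. indicator {0<..<1} x * - env' x) \<in> borel_measurable borel"
    by (rule borel_measurable_indicator_mono_on) auto
  then show ?thesis by simp
qed

text \<open>The slope may be unbounded at 0 and is only defined inside the interval, so the density
  is integrated over closed subintervals that exhaust the open one; the limits of \<open>g\<close>
  at the ends supply the value.\<close>

lemma nn_integral_env':
  assumes c: "0 \<le> c" "c < 1"
  shows "(\<integral>\<^sup>+x. ennreal (env' x) * indicator {c<..<1} x \<partial>lborel) = ennreal (f 1 - g c)"
proof -
  define F where "F = (\<lambda>x. ennreal (indicator {0<..<1} x * env' x))"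
  have [measurable]: "F \<in> borel_measurable borel" unfolding F_def by measurable
  define N where "N = density lborel F"
  \<comment> \<open>The denominator starts at 2 so that \<open>c + h n\<close> never exceeds
    \<open>1 - h n\<close>.\<close>
  define h where "h = (\<lambda>n::nat. (1 - c) / (real n + 2))"
  have h0: "h n > 0" for n using c by (simp add: h_def)
  then have hne: "h n \<noteq> 0" for n by (metis less_irrefl)
  have h1: "2 * h n \<le> 1 - c" for n
  proof -
    have "h n \<le> (1 - c) / 2" unfolding h_def using c by (intro divide_left_mono) auto
    then show ?thesis by simp
  qed
  have hanti: "h m \<le> h n" if "n \<le> m" for n m
    unfolding h_def using c that by (intro divide_left_mono) auto
  have hlim: "h \<longlonglongrightarrow> 0" unfolding h_def by real_asymp
  define A where "A = (\<lambda>n. {c + h n..1 - h n})"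
  have inc: "incseq A" unfolding A_def incseq_def using hanti by fastforce
  have un: "(\<Union>n. A n) = {c<..<1}"
  proof
    show "(\<Union>n. A n) \<subseteq> {c<..<1}"
    proof
      fix x assume "x \<in> (\<Union>n. A n)"
      then obtain n where "c + h n \<le> x" "x \<le> 1 - h n" unfolding A_def by auto
      then show "x \<in> {c<..<1}" using h0[of n] by auto
    qed
    show "{c<..<1} \<subseteq> (\<Union>n. A n)"
    proof
      fix x assume x: "x \<in> {c<..<1}"
      then have "\<forall>\<^sub>F n in sequentially. h n < min (x - c) (1 - x)"
        by (intro order_tendstoD(2)[OF hlim]) auto
      then obtain n where "h n < min (x - c) (1 - x)"
        using eventually_sequentially by auto
      then show "x \<in> (\<Union>n. A n)" unfolding A_def by (auto intro!: exI[of _ n])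
    qed
  qed
  have "range A \<subseteq> sets N" by (auto simp: N_def A_def)
  then have "(\<lambda>n. emeasure N (A n)) \<longlonglongrightarrow> emeasure N {c<..<1}"
    unfolding un[symmetric] using inc by (rule Lim_emeasure_incseq)
  moreover have "emeasure N (A n) = ennreal (g (1 - h n) - g (c + h n))" for n
  proof -
    have hi: "(env' has_integral g (1 - h n) - g (c + h n)) {c + h n..1 - h n}"
      using h0[of n] h1[of n] c
      by (intro has_integral_of_monotone_slopes) (auto intro!: env'_sandwich)
    have sub: "A n \<subseteq> {0<..<1}" unfolding A_def using h0[of n] c by auto
    have "emeasure N (A n) = (\<integral>\<^sup>+x. F x * indicator (A n) x \<partial>lborel)"
      unfolding N_def A_def by (subst emeasure_density) auto
    also have "\<dots> = (\<integral>\<^sup>+x. ennreal (env' x) * indicator (A n) x \<partial>lborel)"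
      using sub unfolding F_def by (intro nn_integral_cong) (auto simp: indicator_def)
    also have "\<dots> = ennreal (g (1 - h n) - g (c + h n))"
      using hi sub env'_nonneg unfolding A_def by (intro nn_integral_has_integral_lebesgue') auto
    finally show ?thesis .
  qed
  moreover have "(\<lambda>n. ennreal (g (1 - h n) - g (c + h n))) \<longlonglongrightarrow> ennreal (g 1 - g c)"
  proof (intro tendsto_ennrealI tendsto_diff)
    have "filterlim (\<lambda>n. 1 - h n) (at_left 1) sequentially"
      using tendsto_diff[OF tendsto_const[of 1] hlim] h0 hne
      by (auto simp: filterlim_at intro!: eventually_sequentiallyI)
    then show "(\<lambda>n. g (1 - h n)) \<longlonglongrightarrow> g 1" using env_tendsto_1 by (rule filterlim_compose[rotated])
    have 1: "filterlim (\<lambda>n. c + h n) (at_right c) sequentially"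
      using tendsto_add[OF tendsto_const[of c] hlim] h0 hne
      by (auto simp: filterlim_at intro!: eventually_sequentiallyI)
    have "(g \<longlongrightarrow> g c) (at_right c)"
    proof (cases "c = 0")
      case False
      then have "isCont g c" using env_continuous c by (simp add: continuous_on_eq_continuous_at)
      then show ?thesis unfolding isCont_def using filterlim_at_split by blast
    qed (use env_tendsto_0 in auto)
    then show "(\<lambda>n. g (c + h n)) \<longlonglongrightarrow> g c" using 1 by (rule filterlim_compose)
  qed
  ultimately have "emeasure N {c<..<1} = ennreal (g 1 - g c)" by (simp add: LIMSEQ_unique)
  moreover have "emeasure N {c<..<1} = (\<integral>\<^sup>+x. F x * indicator {c<..<1} x \<partial>lborel)"
    unfolding N_def by (subst emeasure_density) auto
  moreover have "\<dots> = (\<integral>\<^sup>+x. ennreal (env' x) * indicator {c<..<1} x \<partial>lborel)"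
    using c unfolding F_def by (intro nn_integral_cong) (auto simp: indicator_def)
  ultimately show ?thesis using env_1 by simp
qed

end

section \<open>Layer cakes over the unit interval\<close>

abbreviation (input) unif :: "real measure" where
  "unif \<equiv> uniform_measure lborel {0<..<1}"

lemma prob_space_unif: "prob_space unif"
  by (rule prob_space_uniform_measure) auto

interpretation unif: prob_space unif by (rule prob_space_unif)

lemma AE_unif_in: "AE x in unif. x \<in> {0<..<1}"
  by (rule AE_uniform_measureI) auto

lemma AE_unif_iff: "(AE x in unif. P x) \<longleftrightarrow> (AE x in lborel. x \<in> {0<..<1} \<longrightarrow> P x)"
  by (subst AE_uniform_measure) auto

lemma nn_integral_unif:
  assumes "F \<in> borel_measurable borel"
  shows "(\<integral>\<^sup>+x. F x \<partial>unif) = (\<integral>\<^sup>+x. F x * indicator {0<..<1} x \<partial>lborel)"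
  using assms by (subst nn_integral_uniform_measure) (auto simp: divide_ennreal_def)

lemma emeasure_unif: "A \<in> sets borel \<Longrightarrow> emeasure unif A = emeasure lborel ({0<..<1} \<inter> A)"
  by (subst emeasure_uniform_measure) (auto simp: divide_ennreal_def)

lemma emeasure_unif_Ioi: "c \<in> {0..1} \<Longrightarrow> emeasure unif {c<..} = ennreal (1 - c)"
proof -
  assume "c \<in> {0..1}"
  then have "{0<..<1} \<inter> {c<..} = {c<..<1}" by auto
  then show ?thesis using \<open>c \<in> {0..1}\<close> by (simp add: emeasure_unif divide_ennreal_def)
qed

lemma measure_unif_Iic: "c \<in> {0..1} \<Longrightarrow> measure unif {..c} = c"
proof -
  assume c: "c \<in> {0..1}"
  have "{0<..<1} \<inter> {..c} = (if c = 1 then {0<..<1} else {0<..c})" using c by auto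
  then show ?thesis using c by (simp add: emeasure_unif measure_def divide_ennreal_def)
qed

lemma AE_unif_neq: "AE x in unif. x \<noteq> c"
  by (subst AE_unif_iff) (use AE_lborel_singleton[of c] in \<open>auto elim: eventually_mono\<close>)

text \<open>Tonelli for the region \<open>0 \<le> t < X x\<close>. The restriction to
  \<open>t \<ge> 0\<close> matches the truncation of negative values by
  \<open>ennreal\<close>.\<close>

lemma nn_integral_layer_cake:
  assumes "sigma_finite_measure N" and [measurable]: "X \<in> borel_measurable N"
  shows "(\<integral>\<^sup>+x. ennreal (X x) \<partial>N)
    = (\<integral>\<^sup>+t. emeasure N {x \<in> space N. t < X x} * indicator {0..} t \<partial>lborel)"
proof -
  interpret N: sigma_finite_measure N by fact
  interpret P: pair_sigma_finite N lborel ..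
  have "(\<integral>\<^sup>+x. ennreal (X x) \<partial>N)
      = (\<integral>\<^sup>+x. \<integral>\<^sup>+t. indicator {p \<in> space (N \<Otimes>\<^sub>M lborel). 0 \<le> snd p \<and> snd p < X (fst p)} (x, t) \<partial>lborel \<partial>N)"
  proof (rule nn_integral_cong)
    fix x assume x: "x \<in> space N"
    have "(\<integral>\<^sup>+t. indicator {p \<in> space (N \<Otimes>\<^sub>M lborel). 0 \<le> snd p \<and> snd p < X (fst p)} (x, t) \<partial>lborel)
        = (\<integral>\<^sup>+t. indicator {0..<X x} t \<partial>lborel)"
      using x by (intro nn_integral_cong) (auto simp: indicator_def space_pair_measure)
    also have "\<dots> = ennreal (X x)"
      by (cases "0 \<le> X x") (auto simp: ennreal_neg)
    finally show "ennreal (X x) = (\<integral>\<^sup>+t. indicator {p \<in> space (N \<Otimes>\<^sub>M lborel). 0 \<le> snd p \<and> snd p < X (fst p)} (x, t) \<partial>lborel)" ..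
  qed
  also have "\<dots> = (\<integral>\<^sup>+t. \<integral>\<^sup>+x. indicator {p \<in> space (N \<Otimes>\<^sub>M lborel). 0 \<le> snd p \<and> snd p < X (fst p)} (x, t) \<partial>N \<partial>lborel)"
    by (rule P.Fubini'[symmetric]) measurable
  also have "\<dots> = (\<integral>\<^sup>+t. emeasure N {x \<in> space N. t < X x} * indicator {0..} t \<partial>lborel)"
  proof (rule nn_integral_cong)
    fix t :: real
    have "(\<integral>\<^sup>+x. indicator {p \<in> space (N \<Otimes>\<^sub>M lborel). 0 \<le> snd p \<and> snd p < X (fst p)} (x, t) \<partial>N)
        = (\<integral>\<^sup>+x. indicator {x \<in> space N. t < X x} x * indicator {0..} t \<partial>N)"
      by (intro nn_integral_cong) (auto simp: indicator_def space_pair_measure)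
    also have "\<dots> = emeasure N {x \<in> space N. t < X x} * indicator {0..} t"
      by (subst nn_integral_multc) auto
    finally show "(\<integral>\<^sup>+x. indicator {p \<in> space (N \<Otimes>\<^sub>M lborel). 0 \<le> snd p \<and> snd p < X (fst p)} (x, t) \<partial>N)
        = emeasure N {x \<in> space N. t < X x} * indicator {0..} t" .
  qed
  finally show ?thesis .
qed

text \<open>A larger class than \<open>quantile_functions\<close>: right-continuity would be
  destroyed by \<open>flatten\<close> at the left end of a gap, and a prescribed value outside the
  unit interval would be destroyed by adding constants.\<close>

definition qfun :: "(real \<Rightarrow> real) \<Rightarrow> bool" where
  "qfun Q \<longleftrightarrow> mono_on {0<..<1} Q \<and> (\<forall>x\<in>{0<..<1}. 0 \<le> Q x) \<and> Q \<in> borel_measurable borel"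

text \<open>For an increasing \<open>Q\<close> the set \<open>Q \<le> t\<close> is an interval with left end 0, so up to one point its length
determines it. This makes prices functions of the levels alone.\<close>

definition level :: "(real \<Rightarrow> real) \<Rightarrow> real \<Rightarrow> real" where
  "level Q t = measure unif {x. Q x \<le> t}"

lemma qfun_measurable [measurable_dest]: "qfun Q \<Longrightarrow> Q \<in> borel_measurable borel"
  by (simp add: qfun_def)

lemma qfun_AE_nonneg: "qfun Q \<Longrightarrow> AE x in unif. 0 \<le> Q x"
  using AE_unif_in by eventually_elim (auto simp: qfun_def)

lemma level_bounds: "level Q t \<in> {0..1}"
  unfolding level_def by (simp add: unif.prob_le_1)

text \<open>If \<open>x\<close> were on the wrong side, monotonicity would put the set
  \<open>Q \<le> t\<close> almost everywhere inside, or around, the initial segment up to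
  \<open>x\<close>, contradicting its length. The point \<open>x = level Q t\<close> itself stays
  undecided.\<close>

lemma level_split:
  assumes Q: "qfun Q" and x: "x \<in> {0<..<1}"
  shows "x < level Q t \<Longrightarrow> Q x \<le> t" and "level Q t < x \<Longrightarrow> t < Q x"
proof -
  note [measurable] = qfun_measurable[OF Q]
  have mono: "Q y \<le> Q z" if "y \<in> {0<..<1}" "z \<in> {0<..<1}" "y \<le> z" for y z
    using Q that by (auto simp: qfun_def mono_on_def)
  have sets: "{x. Q x \<le> t} \<in> sets borel" by measurable
  show "Q x \<le> t" if "x < level Q t"
  proof (rule ccontr)
    assume "\<not> Q x \<le> t"
    have "AE y in unif. y \<in> {x. Q x \<le> t} \<longrightarrow> y \<in> {..x}"
      using AE_unif_in
    proof eventually_elim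
      case (elim y)
      show ?case using mono[OF x elim] \<open>\<not> Q x \<le> t\<close> by (cases "x \<le> y") auto
    qed
    then have "level Q t \<le> measure unif {..x}"
      unfolding level_def by (intro unif.finite_measure_mono_AE) auto
    then show False using that measure_unif_Iic[of x] x by simp
  qed
  show "t < Q x" if "level Q t < x"
  proof (rule ccontr)
    assume "\<not> t < Q x"
    have "AE y in unif. y \<in> {..x} \<longrightarrow> y \<in> {x. Q x \<le> t}"
      using AE_unif_in
    proof eventually_elim
      case (elim y)
      show ?case using mono[OF elim x] \<open>\<not> t < Q x\<close> by (cases "y \<le> x") auto
    qed
    then have "measure unif {..x} \<le> level Q t"
      unfolding level_def using sets by (intro unif.finite_measure_mono_AE) auto
    then show False using that measure_unif_Iic[of x] x by simp
  qed
qed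

text \<open>The common frame of the two pricing measures: having no atoms, they do not see the point
  that \<open>level_split\<close> leaves undecided.\<close>

locale diffuse =
  fixes N :: "real measure"
  assumes fin: "finite_measure N" and sets [measurable_cong, simp]: "sets N = sets borel"
    and supp: "AE x in N. x \<in> {0<..<1}" and diffuse: "\<And>c. AE x in N. x \<noteq> c"
begin

lemma space [simp]: "space N = UNIV"
  using sets_eq_imp_space_eq[OF sets] by simp

lemma emeasure_upper_level:
  assumes Q: "qfun Q"
  shows "emeasure N {x. t < Q x} = emeasure N {level Q t<..}"
proof (rule emeasure_eq_AE)
  note [measurable] = qfun_measurable[OF Q]
  show "{x. t < Q x} \<in> Sigma_Algebra.sets N" by simp
  show "AE x in N. (x \<in> {x. t < Q x}) = (x \<in> {level Q t<..})"
    using supp diffuse[of "level Q t"]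
  proof eventually_elim
    case (elim x)
    then show ?case
      using level_split(1)[OF Q elim(1), of t] level_split(2)[OF Q elim(1), of t]
      by (cases x "level Q t" rule: linorder_cases) simp_all
  qed
qed auto

lemma nn_integral_level:
  assumes Q: "qfun Q"
  shows "(\<integral>\<^sup>+x. ennreal (Q x) \<partial>N)
    = (\<integral>\<^sup>+t. emeasure N {level Q t<..} * indicator {0..} t \<partial>lborel)"
proof -
  interpret finite_measure N by (rule fin)
  note [measurable] = qfun_measurable[OF Q]
  show ?thesis
    by (subst nn_integral_layer_cake) (auto simp: emeasure_upper_level[OF Q] sigma_finite_measure_axioms)
qed

end

lemma diffuse_density_unif:
  assumes [measurable]: "F \<in> borel_measurable borel" and "(\<integral>\<^sup>+x. F x \<partial>unif) < \<infinity>"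
  shows "diffuse (density unif F)"
proof (intro diffuse.intro finite_measureI)
  show "emeasure (density unif F) (space (density unif F)) \<noteq> \<infinity>"
    using assms by (simp add: emeasure_density less_top)
  show "AE x in density unif F. x \<in> {0<..<1}"
    using AE_unif_in by (subst AE_density) (auto simp del: greaterThanLessThan_iff elim!: eventually_mono)
  show "AE x in density unif F. x \<noteq> c" for c
    using AE_unif_neq[of c] by (subst AE_density) (auto elim!: eventually_mono)
qed simp

lemma level_cong_AE:
  assumes [measurable]: "Q \<in> borel_measurable borel" "R \<in> borel_measurable borel"
    and "AE x in unif. Q x = R x"
  shows "level Q t = level R t"
  unfolding level_def by (rule unif.finite_measure_eq_AE) (use assms(3) in \<open>auto elim!: eventually_mono\<close>)

section \<open>Averaging over the gaps of the envelope\<close>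

text \<open>Tangent lines are the form of strict concavity that Jensen and the midpoint inequality
  use. They are required only at \<open>m > 0\<close>, since the slope at 0 may be infinite, and
  strictly only at \<open>y > 0\<close>, since the value at 0 is obtained by a limit.\<close>

locale concave_utility =
  fixes v :: "real \<Rightarrow> real"
  assumes v_mono: "mono v" and v_strict: "strict_mono_on {0..} v"
    and v_neg: "\<And>y. y \<le> 0 \<Longrightarrow> v y = 0"
    and v_tangent: "\<And>m. 0 < m \<Longrightarrow> \<exists>s. (\<forall>y\<ge>0. v y \<le> v m + s * (y - m)) \<and>
      (\<forall>y>0. y \<noteq> m \<longrightarrow> v y < v m + s * (y - m))"
begin

lemma v_measurable [measurable]: "v \<in> borel_measurable borel"
  by (rule borel_measurable_mono[OF v_mono])

lemma v_nonneg: "0 \<le> v y"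
  using v_neg[of 0] v_neg[of y] monoD[OF v_mono, of 0 y] by (cases "y \<le> 0") auto

text \<open>Both values are compared with the tangent at the midpoint, where the linear terms
  cancel. Strictness comes from the larger argument, which is positive; the smaller one may be 0,
  where the tangent inequality is only weak.\<close>

lemma v_midpoint:
  assumes "0 \<le> a" "0 \<le> b"
  shows "v a + v b \<le> 2 * v ((a + b) / 2)" and "a \<noteq> b \<Longrightarrow> v a + v b < 2 * v ((a + b) / 2)"
proof -
  have *: "v a + v b < 2 * v ((a + b) / 2)" if ab: "a < b" "0 \<le> a" for a b
  proof -
    define m where "m = (a + b) / 2"
    have m: "0 < m" "b \<noteq> m" "0 < b" "(a - m) + (b - m) = 0" using ab unfolding m_def by (auto simp: field_simps)
    obtain s where s: "\<forall>y\<ge>0. v y \<le> v m + s * (y - m)" "\<forall>y>0. y \<noteq> m \<longrightarrow> v y < v m + s * (y - m)"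
      using v_tangent[OF m(1)] by blast
    have "v a \<le> v m + s * (a - m)" "v b < v m + s * (b - m)" using s m ab by auto
    then have "v a + v b < 2 * v m + (s * (a - m) + s * (b - m))" by simp
    also have "s * (a - m) + s * (b - m) = s * ((a - m) + (b - m))" by (simp only: distrib_left)
    finally show ?thesis unfolding m(4) by (simp add: m_def)
  qed
  show strict: "v a + v b < 2 * v ((a + b) / 2)" if "a \<noteq> b"
    using *[of a b] *[of b a] assms that by (cases "a < b") (auto simp: add.commute)
  show "v a + v b \<le> 2 * v ((a + b) / 2)"
    using strict by (cases "a = b") auto
qed

lemma nn_jensen:
  assumes "prob_space P" and int: "integrable P X" and nn: "AE x in P. 0 \<le> X x"
  shows "(\<integral>\<^sup>+x. ennreal (v (X x)) \<partial>P) \<le> ennreal (v (\<integral>x. X x \<partial>P))"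
proof -
  interpret P: prob_space P by fact
  define m where "m = (\<integral>x. X x \<partial>P)"
  have m0: "0 \<le> m" unfolding m_def using nn by (rule integral_nonneg_AE)
  show ?thesis
  proof (cases "m = 0")
    \<comment> \<open>No tangent is available at 0, but a nonnegative variable with mean 0 vanishes
      almost surely.\<close>
    case True
    then have "AE x in P. X x = 0"
      using integral_nonneg_eq_0_iff_AE[OF int nn] unfolding m_def by simp
    then have "(\<integral>\<^sup>+x. ennreal (v (X x)) \<partial>P) = (\<integral>\<^sup>+x. 0 \<partial>P)"
      by (intro nn_integral_cong_AE) (auto elim!: eventually_mono simp: v_neg)
    then show ?thesis by simp
  next
    case False
    with m0 obtain s where s: "\<And>y. 0 \<le> y \<Longrightarrow> v y \<le> v m + s * (y - m)"
      using v_tangent[of m] by auto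
    have le: "AE x in P. v (X x) \<le> v m + s * (X x - m)"
      using nn by eventually_elim (rule s)
    have "(\<integral>\<^sup>+x. ennreal (v (X x)) \<partial>P) \<le> (\<integral>\<^sup>+x. ennreal (v m + s * (X x - m)) \<partial>P)"
      using le by (intro nn_integral_mono_AE) (auto elim!: eventually_mono intro!: ennreal_leI)
    \<comment> \<open>The tangent dominates \<open>v\<close>, hence is nonnegative along
      \<open>X\<close>, and its nonnegative integral is the Bochner integral.\<close>
    also have "\<dots> = ennreal (\<integral>x. v m + s * (X x - m) \<partial>P)"
    proof (rule nn_integral_eq_integral)
      show "integrable P (\<lambda>x. v m + s * (X x - m))" using int by auto
      show "AE x in P. 0 \<le> v m + s * (X x - m)"
        using le by eventually_elim (use v_nonneg order.trans in blast)
    qed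
    also have "(\<integral>x. v m + s * (X x - m) \<partial>P) = v m + s * ((\<integral>x. X x \<partial>P) - m)"
      using int by (simp add: P.prob_space)
    also have "\<dots> = v m" unfolding m_def by simp
    finally show ?thesis unfolding m_def .
  qed
qed

end

lemma connected_less_outside:
  fixes S :: "real set"
  assumes "connected S" "x \<in> S" "y \<notin> S" "a \<in> S"
  shows "x < y \<Longrightarrow> a < y" and "y < x \<Longrightarrow> y < a"
proof -
  have iv: "\<And>p q r. p \<in> S \<Longrightarrow> q \<in> S \<Longrightarrow> p \<le> r \<Longrightarrow> r \<le> q \<Longrightarrow> r \<in> S"
    using assms(1) unfolding is_interval_connected_1[symmetric] is_interval_1 by blast
  show "a < y" if "x < y" using iv[of x a y] assms that by (metis less_imp_le linorder_not_less)
  show "y < a" if "y < x" using iv[of a x y] assms that by (metis less_imp_le linorder_not_less)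
qed

text \<open>An open set of reals has only countably many components, so the integral splits into the
  part outside \<open>S\<close> and a countable sum, to be compared term by term.\<close>

lemma nn_integral_le_components:
  fixes F G :: "real \<Rightarrow> ennreal" and S A :: "real set"
  assumes [measurable]: "F \<in> borel_measurable borel" "G \<in> borel_measurable borel" "A \<in> sets borel"
    and S: "open S" "S \<subseteq> A"
    and outside: "\<And>x. x \<in> A \<Longrightarrow> x \<notin> S \<Longrightarrow> F x \<le> G x"
    and comp: "\<And>C. C \<in> components S \<Longrightarrow>
      (\<integral>\<^sup>+x. F x * indicator C x \<partial>lborel) \<le> (\<integral>\<^sup>+x. G x * indicator C x \<partial>lborel)"
  shows "(\<integral>\<^sup>+x. F x * indicator A x \<partial>lborel) \<le> (\<integral>\<^sup>+x. G x * indicator A x \<partial>lborel)"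
proof -
  have opn: "open C" if "C \<in> components S" for C using that open_components S by blast
  have cnt: "countable (components S)"
  proof (rule countable_disjoint_open_subsets)
    show "disjoint (components S)"
      using pairwise_disjoint_components[of S] by (simp add: pairwise_def disjnt_def)
  qed (rule opn)
  have dj: "disjoint_family_on (\<lambda>C. C) (components S)"
    using pairwise_disjoint_components[of S]
    by (auto simp: disjoint_family_on_def pairwise_def disjnt_def)
  have decomp: "(\<integral>\<^sup>+x. H x * indicator A x \<partial>lborel)
      = (\<integral>\<^sup>+x. H x * indicator (A - S) x \<partial>lborel)
        + (\<integral>\<^sup>+C. (\<integral>\<^sup>+x. H x * indicator C x \<partial>lborel) \<partial>count_space (components S))"
    if [measurable]: "H \<in> borel_measurable borel" for H :: "real \<Rightarrow> ennreal"
  proof -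
    have [measurable]: "S \<in> sets borel" using S by auto
    define N where "N = density lborel H"
    have N: "emeasure N B = (\<integral>\<^sup>+x. H x * indicator B x \<partial>lborel)" if "B \<in> sets borel" for B
      unfolding N_def using that by (subst emeasure_density) auto
    have "emeasure N A = emeasure N ((A - S) \<union> S)"
      using S by (intro arg_cong[where f = "emeasure N"]) auto
    also have "\<dots> = emeasure N (A - S) + emeasure N S"
      by (rule plus_emeasure[symmetric]) (auto simp: N_def)
    also have "emeasure N S = emeasure N (\<Union>C\<in>components S. C)"
      using Union_components[of S] by simp
    also have "\<dots> = (\<integral>\<^sup>+C. emeasure N C \<partial>count_space (components S))"
      by (rule emeasure_UN_countable) (use cnt dj opn in \<open>auto simp: N_def\<close>)
    also have "\<dots> = (\<integral>\<^sup>+C. (\<integral>\<^sup>+x. H x * indicator C x \<partial>lborel) \<partial>count_space (components S))"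
      by (intro nn_integral_cong) (use opn N in auto)
    finally show ?thesis by (simp add: N)
  qed
  have "(\<integral>\<^sup>+x. F x * indicator (A - S) x \<partial>lborel) \<le> (\<integral>\<^sup>+x. G x * indicator (A - S) x \<partial>lborel)"
    by (intro nn_integral_mono) (auto simp: indicator_def outside)
  moreover have "(\<integral>\<^sup>+C. (\<integral>\<^sup>+x. F x * indicator C x \<partial>lborel) \<partial>count_space (components S))
      \<le> (\<integral>\<^sup>+C. (\<integral>\<^sup>+x. G x * indicator C x \<partial>lborel) \<partial>count_space (components S))"
    by (rule nn_integral_mono) (simp add: comp)
  ultimately show ?thesis by (subst (1 2) decomp) (auto intro: add_mono)
qed

section \<open>Cost under the envelope, its gaps and their components\<close>

context increasing_envelope
begin

definition env_density :: "real \<Rightarrow> ennreal" where "env_density x = ennreal (indicator {0<..<1} x * env' x)"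

lemma env_density_measurable [measurable]: "env_density \<in> borel_measurable borel"
  unfolding env_density_def by measurable

text \<open>The budget of (E), written on the unit interval; \<open>cost_eq_expectation\<close>
  later identifies it with the expected price of \<open>Q\<close> applied to the uniform variable
  \<open>P\<close>.\<close>

definition cost :: "(real \<Rightarrow> real) \<Rightarrow> ennreal" where
  "cost Q = (\<integral>\<^sup>+x. env_density x * ennreal (Q x) \<partial>unif)"

lemma emeasure_env_density_Ioi:
  assumes c: "c \<in> {0..1}"
  shows "emeasure (density unif env_density) {c<..} = ennreal (f 1 - g c)"
proof (cases "c = 1")
  case True
  have "AE x in unif. env_density x * indicator {c<..} x = 0"
    using AE_unif_in by eventually_elim (simp add: True)
  then have "(\<integral>\<^sup>+x. env_density x * indicator {c<..} x \<partial>unif) = (\<integral>\<^sup>+x. 0 \<partial>unif)"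
    by (rule nn_integral_cong_AE)
  then show ?thesis using env_1 True by (subst emeasure_density) auto
next
  case False
  have "emeasure (density unif env_density) {c<..} = (\<integral>\<^sup>+x. env_density x * indicator {c<..} x * indicator {0<..<1} x \<partial>lborel)"
    by (subst emeasure_density) (auto simp: nn_integral_unif)
  also have "\<dots> = (\<integral>\<^sup>+x. ennreal (env' x) * indicator {c<..<1} x \<partial>lborel)"
    using c by (intro nn_integral_cong) (auto simp: env_density_def indicator_def)
  finally show ?thesis using nn_integral_env'[of c] c False by simp
qed

lemma nn_integral_env_density: "(\<integral>\<^sup>+x. env_density x \<partial>unif) = ennreal (f 1 - f 0)"
proof -
  have "emeasure (density unif env_density) {0<..} = (\<integral>\<^sup>+x. env_density x * indicator {0<..} x \<partial>unif)"
    by (subst emeasure_density) auto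
  also have "\<dots> = (\<integral>\<^sup>+x. env_density x \<partial>unif)"
    using AE_unif_in by (intro nn_integral_cong_AE) (auto elim!: eventually_mono)
  finally show ?thesis using emeasure_env_density_Ioi[of 0] env_0 by simp
qed

lemma diffuse_env_density: "diffuse (density unif env_density)"
  by (rule diffuse_density_unif) (auto simp: nn_integral_env_density)

lemma cost_eq: "qfun Q \<Longrightarrow> cost Q = (\<integral>\<^sup>+x. ennreal (Q x) \<partial>density unif env_density)"
  unfolding cost_def by (subst nn_integral_density) (auto dest: qfun_measurable)

lemma cost_level:
  assumes "qfun Q"
  shows "cost Q = (\<integral>\<^sup>+t. ennreal (f 1 - g (level Q t)) * indicator {0..} t \<partial>lborel)"
  unfolding cost_eq[OF assms] diffuse.nn_integral_level[OF diffuse_env_density assms]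
  by (simp add: emeasure_env_density_Ioi[OF level_bounds])

lemma cost_le:
  assumes N: "diffuse N" "\<And>c. c \<in> {0..1} \<Longrightarrow> emeasure N {c<..} = ennreal (f 1 - f c)"
    and Q: "qfun Q"
  shows "cost Q \<le> (\<integral>\<^sup>+x. ennreal (Q x) \<partial>N)"
  unfolding cost_level[OF Q] diffuse.nn_integral_level[OF N(1) Q]
  using le_env[OF level_bounds[of Q]]
  by (intro nn_integral_mono) (auto simp: N(2)[OF level_bounds] intro!: mult_right_mono ennreal_leI)

lemma cost_eq_if_contact:
  assumes N: "diffuse N" "\<And>c. c \<in> {0..1} \<Longrightarrow> emeasure N {c<..} = ennreal (f 1 - f c)"
    and Q: "qfun Q" and contact: "\<And>t. f (level Q t) = g (level Q t)"
  shows "cost Q = (\<integral>\<^sup>+x. ennreal (Q x) \<partial>N)"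
  unfolding cost_level[OF Q] diffuse.nn_integral_level[OF N(1) Q]
  by (simp add: N(2)[OF level_bounds] contact)

definition gap :: "real set" where "gap = {x \<in> {0<..<1}. f x < g x}"

lemma open_gap: "open gap"
proof -
  have "continuous_on {0<..<1} (\<lambda>x. g x - f x)"
    by (intro continuous_intros env_continuous continuous_on_subset[OF cont]) auto
  then have "open ({0<..<1} \<inter> (\<lambda>x. g x - f x) -` {0<..})"
    by (intro continuous_open_preimage) auto
  moreover have "gap = {0<..<1} \<inter> (\<lambda>x. g x - f x) -` {0<..}" unfolding gap_def by auto
  ultimately show ?thesis by simp
qed

abbreviation piece :: "real \<Rightarrow> real set" where "piece x \<equiv> connected_component_set gap x"

lemma piece:
  assumes x: "x \<in> gap"
  shows "open (piece x)" "x \<in> piece x" "connected (piece x)" "piece x \<subseteq> gap" "piece x \<subseteq> {0<..<1}"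
    "emeasure lborel (piece x) \<noteq> 0" "emeasure lborel (piece x) \<noteq> \<infinity>" "piece x \<in> sets borel"
proof -
  show o: "open (piece x)" using open_gap by (rule open_connected_component)
  show xx: "x \<in> piece x" using x by simp
  show "connected (piece x)" by simp
  show "piece x \<subseteq> gap" by (rule connected_component_subset)
  then show 01: "piece x \<subseteq> {0<..<1}" unfolding gap_def by auto
  show "piece x \<in> sets borel" using o by auto
  obtain e where e: "e > 0" "ball x e \<subseteq> piece x" using o xx open_contains_ball by blast
  have "emeasure lborel {x - e<..<x + e} \<le> emeasure lborel (piece x)"
    using e o by (intro emeasure_mono) (auto simp: ball_eq_greaterThanLessThan)
  then show "emeasure lborel (piece x) \<noteq> 0" using e by auto
  have "emeasure lborel (piece x) \<le> emeasure lborel {0<..<1::real}"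
    using 01 by (intro emeasure_mono) auto
  then show "emeasure lborel (piece x) \<noteq> \<infinity>" by (auto simp: top_unique)
qed

text \<open>The ends of an affine stretch around \<open>x\<close> are contact points, so they lie
  outside the gap and enclose the whole component. The slope is positive because \<open>f\<close>
  and \<open>g\<close> agree at these ends and \<open>f\<close> increases strictly between
  them.\<close>

lemma piece_slope:
  assumes x: "x \<in> gap"
  obtains s where "0 < s" "\<And>y. y \<in> piece x \<Longrightarrow> env' y = s"
proof -
  have x': "x \<in> {0<..<1}" "f x < g x" using x unfolding gap_def by auto
  obtain a b s where ab: "0 \<le> a" "a < x" "x < b" "b \<le> 1" "f a = g a" "f b = g b"
    and lin: "\<And>z. z \<in> {a..b} \<Longrightarrow> g z = g x + s * (z - x)"
    using env_affine_piece[OF x'] by metis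
  have "a \<notin> piece x" "b \<notin> piece x" using ab piece(4)[OF x] unfolding gap_def by auto
  then have sub: "piece x \<subseteq> {a<..<b}"
    using connected_less_outside[OF piece(3,2)[OF x]] ab by fastforce
  have "env' y = s" if "y \<in> piece x" for y
  proof (rule env'_affine)
    show "g z = (g x - s * x) + s * z" if "z \<in> {a..b}" for z
      unfolding lin[OF that] by (simp add: algebra_simps)
  qed (use sub that ab in auto)
  moreover have "0 < s"
  proof -
    have a: "a \<in> {a..b}" and b: "b \<in> {a..b}" using ab by auto
    have "f a < f b" using strict_mono_onD[OF mono, of a b] ab(1-4) by auto
    then have "g x + s * (a - x) < g x + s * (b - x)" using lin[OF a] lin[OF b] ab(5,6) by metis
    then have "0 < s * (b - a)" by (simp add: algebra_simps)
    then show ?thesis using ab by (simp add: zero_less_mult_iff)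
  qed
  ultimately show thesis using that by blast
qed

text \<open>On a component of the gap the envelope is affine, so that averaging there does not change the cost.\<close>

definition flatten :: "(real \<Rightarrow> real) \<Rightarrow> real \<Rightarrow> real" where
  "flatten Q x = (if x \<in> gap then \<integral>y. Q y \<partial>uniform_measure lborel (piece x) else Q x)"

lemma flatten_piece: "y \<in> piece x \<Longrightarrow> x \<in> gap \<Longrightarrow> flatten Q y = flatten Q x"
  unfolding flatten_def using piece(4)[of x] connected_component_eq[of y gap x] by auto

lemma prob_space_piece: "x \<in> gap \<Longrightarrow> prob_space (uniform_measure lborel (piece x))"
  using piece(6,7) by (intro prob_space_uniform_measure) auto

lemma AE_piece: "x \<in> gap \<Longrightarrow> AE y in uniform_measure lborel (piece x). y \<in> piece x"
  using piece(8) by (intro AE_uniform_measureI) auto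

lemma nn_integral_piece:
  assumes x: "x \<in> gap" and [measurable]: "F \<in> borel_measurable borel"
  shows "(\<integral>\<^sup>+y. F y * indicator (piece x) y \<partial>lborel)
    = emeasure lborel (piece x) * (\<integral>\<^sup>+y. F y \<partial>uniform_measure lborel (piece x))"
proof -
  have "(\<integral>\<^sup>+y. F y \<partial>uniform_measure lborel (piece x))
    = (\<integral>\<^sup>+y. F y * indicator (piece x) y \<partial>lborel) / emeasure lborel (piece x)"
    using piece[OF x] by (intro nn_integral_uniform_measure) auto
  then show ?thesis
    using ennreal_mult_divide_eq[OF piece(6)[OF x], of "\<integral>\<^sup>+y. F y * indicator (piece x) y \<partial>lborel"]
      piece(7)[OF x] by (simp add: ennreal_times_divide mult.commute)
qed

context
  fixes Q assumes Q: "qfun Q" and fin: "cost Q < \<infinity>"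
begin

text \<open>On a component the density is a positive constant, so finite cost bounds the integral of
  \<open>Q\<close> there. This makes the Bochner integral in \<open>flatten\<close> a true mean
  instead of the default value 0.\<close>

lemma integrable_piece:
  assumes x: "x \<in> gap"
  shows "integrable (uniform_measure lborel (piece x)) Q"
proof -
  note [measurable] = qfun_measurable[OF Q]
  obtain s where s: "0 < s" "\<And>y. y \<in> piece x \<Longrightarrow> env' y = s" using piece_slope[OF x] by blast
  have sub: "piece x \<subseteq> {0<..<1}" and [measurable]: "piece x \<in> sets borel" using piece[OF x] by auto
  have "ennreal s * (\<integral>\<^sup>+y. ennreal (Q y) * indicator (piece x) y \<partial>lborel)
      = (\<integral>\<^sup>+y. ennreal s * (ennreal (Q y) * indicator (piece x) y) \<partial>lborel)"
    by (rule nn_integral_cmult[symmetric]) measurable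
  also have "\<dots> \<le> (\<integral>\<^sup>+y. env_density y * ennreal (Q y) * indicator {0<..<1} y \<partial>lborel)"
    using sub s by (intro nn_integral_mono) (auto simp: indicator_def env_density_def)
  also have "\<dots> = cost Q" unfolding cost_def by (rule nn_integral_unif[symmetric]) measurable
  finally have "ennreal s * (\<integral>\<^sup>+y. ennreal (Q y) * indicator (piece x) y \<partial>lborel) < \<infinity>"
    using fin by simp
  then have "(\<integral>\<^sup>+y. ennreal (Q y) * indicator (piece x) y \<partial>lborel) < \<infinity>"
    using s by (auto simp: ennreal_mult_less_top ennreal_eq_0_iff)
  then have "(\<integral>\<^sup>+y. ennreal (Q y) \<partial>uniform_measure lborel (piece x)) < \<infinity>"
    using nn_integral_piece[OF x, of "\<lambda>y. ennreal (Q y)"] piece(6)[OF x]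
    by (auto simp: ennreal_mult_less_top)
  moreover have "AE y in uniform_measure lborel (piece x). 0 \<le> Q y"
    using AE_piece[OF x] by eventually_elim (use sub Q in \<open>auto simp: qfun_def\<close>)
  ultimately show ?thesis by (intro integrableI_nonneg) auto
qed

lemma flatten_le:
  assumes x: "x \<in> gap" and le: "\<And>y. y \<in> piece x \<Longrightarrow> Q y \<le> k"
  shows "flatten Q x \<le> k"
proof -
  interpret prob_space "uniform_measure lborel (piece x)" by (rule prob_space_piece[OF x])
  have "AE y in uniform_measure lborel (piece x). Q y \<le> k"
    using AE_piece[OF x] by eventually_elim (rule le)
  then show ?thesis using integral_le_const[OF integrable_piece[OF x], of k] x by (simp add: flatten_def)
qed

lemma flatten_ge:
  assumes x: "x \<in> gap" and le: "\<And>y. y \<in> piece x \<Longrightarrow> k \<le> Q y"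
  shows "k \<le> flatten Q x"
proof -
  interpret prob_space "uniform_measure lborel (piece x)" by (rule prob_space_piece[OF x])
  have "AE y in uniform_measure lborel (piece x). k \<le> Q y"
    using AE_piece[OF x] by eventually_elim (rule le)
  then show ?thesis using integral_ge_const[OF integrable_piece[OF x], of k] x by (simp add: flatten_def)
qed

lemma Q_mono: "y \<in> {0<..<1} \<Longrightarrow> z \<in> {0<..<1} \<Longrightarrow> y \<le> z \<Longrightarrow> Q y \<le> Q z"
  using Q by (auto simp: qfun_def mono_on_def)

text \<open>A mean over a component is bounded by the value of \<open>Q\<close> at any point outside
  that component on the appropriate side, since components are intervals.\<close>

lemma flatten_mono:
  assumes xy: "x \<in> {0<..<1}" "y \<in> {0<..<1}" "x \<le> y"
  shows "flatten Q x \<le> flatten Q y"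
proof -
  have outR: "flatten Q x \<le> Q b" if "x \<in> gap" "b \<in> {0<..<1}" "b \<notin> piece x" "x < b" for b
    using connected_less_outside(1)[OF piece(3,2)[OF that(1)] that(3)] piece(5)[OF that(1)] that
    by (intro flatten_le Q_mono) (auto simp: less_imp_le subset_iff)
  have outL: "Q a \<le> flatten Q y" if "y \<in> gap" "a \<in> {0<..<1}" "a \<notin> piece y" "a < y" for a
    using connected_less_outside(2)[OF piece(3,2)[OF that(1)] that(3)] piece(5)[OF that(1)] that
    by (intro flatten_ge Q_mono) (auto simp: less_imp_le subset_iff)
  show ?thesis
  proof (cases "x = y")
    case False
    then have lt: "x < y" using xy by simp
    consider "x \<notin> gap" "y \<notin> gap" | "x \<in> gap" "y \<notin> gap" | "x \<notin> gap" "y \<in> gap"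
      | "x \<in> gap" "y \<in> piece x" | "x \<in> gap" "y \<in> gap" "y \<notin> piece x" by blast
    then show ?thesis
    proof cases
      case 1 then show ?thesis using Q_mono xy by (simp add: flatten_def)
    next
      case 2 then show ?thesis using outR[of y] piece(4)[of x] lt xy by (auto simp: flatten_def)
    next
      case 3 then show ?thesis using outL[of x] piece(4)[of y] lt xy by (auto simp: flatten_def)
    next
      case 4 then show ?thesis using flatten_piece by simp
    next
      \<comment> \<open>Two different components: each point \<open>b\<close> of the right one
        bounds the left mean, and then the right mean is taken over these \<open>b\<close>.\<close>
      case 5
      have "flatten Q x \<le> Q b" if b: "b \<in> piece y" for b
      proof (rule outR[OF 5(1)])
        have "piece y = piece b" using b connected_component_eq by metis
        then have "x \<notin> piece y" "b \<notin> piece x" using 5 piece(2)[OF 5(2)] b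
          by (metis connected_component_eq piece(2))+
        then show "b \<notin> piece x" "x < b"
          using connected_less_outside(2)[OF piece(3,2)[OF 5(2)], of x b] b lt by auto
        show "b \<in> {0<..<1}" using b piece(5)[OF 5(2)] by auto
      qed
      then show ?thesis by (intro flatten_ge 5(2))
    qed
  qed simp
qed

lemma qfun_flatten: "qfun (flatten Q)"
  unfolding qfun_def
proof (intro conjI ballI)
  note [measurable] = qfun_measurable[OF Q]
  show m: "mono_on {0<..<1} (flatten Q)" using flatten_mono by (auto intro!: mono_onI)
  show "0 \<le> flatten Q x" if "x \<in> {0<..<1}" for x
  proof (cases "x \<in> gap")
    case True
    show ?thesis using Q piece(5)[OF True] by (intro flatten_ge True) (auto simp: qfun_def)
  next
    case False
    then show ?thesis using Q that by (simp add: qfun_def flatten_def)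
  qed
  have [measurable]: "(\<lambda>x. indicator {0<..<1} x * flatten Q x) \<in> borel_measurable borel"
    by (rule borel_measurable_indicator_mono_on[OF m]) auto
  have "flatten Q = (\<lambda>x. indicator {0<..<1} x * flatten Q x + indicator (- {0<..<1}) x * Q x)"
    by (auto simp: fun_eq_iff flatten_def gap_def indicator_def)
  moreover have "\<dots> \<in> borel_measurable borel" by measurable
  ultimately show "flatten Q \<in> borel_measurable borel" by simp
qed

lemma gap_component:
  assumes "C \<in> components gap"
  obtains x where "x \<in> gap" "C = piece x"
  using assms unfolding components_def by blast

lemma nn_integral_Q_piece:
  assumes x: "x \<in> gap"
  shows "(\<integral>\<^sup>+y. ennreal (Q y) \<partial>uniform_measure lborel (piece x)) = ennreal (flatten Q x)"
proof -
  have "AE y in uniform_measure lborel (piece x). 0 \<le> Q y"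
    using AE_piece[OF x] by eventually_elim (use piece(5)[OF x] Q in \<open>auto simp: qfun_def\<close>)
  then show ?thesis using nn_integral_eq_integral[OF integrable_piece[OF x]] x by (simp add: flatten_def)
qed

lemma nn_integral_density_piece:
  assumes x: "x \<in> gap"
  shows "(\<integral>\<^sup>+y. env_density y * ennreal (Q y) * indicator (piece x) y \<partial>lborel)
    = (\<integral>\<^sup>+y. env_density y * ennreal (flatten Q y) * indicator (piece x) y \<partial>lborel)"
proof -
  note [measurable] = qfun_measurable[OF Q] qfun_measurable[OF qfun_flatten]
  have [measurable]: "piece x \<in> sets borel" using piece[OF x] by auto
  obtain s where s: "0 < s" "\<And>y. y \<in> piece x \<Longrightarrow> env' y = s" using piece_slope[OF x] by blast
  have D: "env_density y = ennreal s" if "y \<in> piece x" for y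
    using s(2)[OF that] piece(5)[OF x] that by (auto simp: env_density_def)
  have "(\<integral>\<^sup>+y. env_density y * ennreal (Q y) * indicator (piece x) y \<partial>lborel)
      = (\<integral>\<^sup>+y. ennreal s * (ennreal (Q y) * indicator (piece x) y) \<partial>lborel)"
    by (intro nn_integral_cong) (auto simp: indicator_def D)
  also have "\<dots> = ennreal s * (emeasure lborel (piece x) * ennreal (flatten Q x))"
    by (subst nn_integral_cmult) (auto simp: nn_integral_piece[OF x] nn_integral_Q_piece[OF x])
  also have "\<dots> = (\<integral>\<^sup>+y. ennreal s * ennreal (flatten Q x) * indicator (piece x) y \<partial>lborel)"
    by (subst nn_integral_cmult_indicator) (auto simp: ac_simps)
  also have "\<dots> = (\<integral>\<^sup>+y. env_density y * ennreal (flatten Q y) * indicator (piece x) y \<partial>lborel)"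
    by (intro nn_integral_cong) (auto simp: indicator_def D flatten_piece[OF _ x])
  finally show ?thesis .
qed

text \<open>The density is constant on each component, where only the mean of \<open>Q\<close>
  counts. The equality is obtained as two inequalities from
  \<open>nn_integral_le_components\<close>.\<close>

lemma cost_flatten: "cost (flatten Q) = cost Q"
proof -
  note [measurable] = qfun_measurable[OF Q] qfun_measurable[OF qfun_flatten]
  have "(\<integral>\<^sup>+x. env_density x * ennreal (flatten Q x) * indicator {0<..<1} x \<partial>lborel)
      \<le> (\<integral>\<^sup>+x. env_density x * ennreal (Q x) * indicator {0<..<1} x \<partial>lborel)"
  proof (rule nn_integral_le_components[OF _ _ _ open_gap])
    show "gap \<subseteq> {0<..<1}" by (auto simp: gap_def)
    show "env_density x * ennreal (flatten Q x) \<le> env_density x * ennreal (Q x)" if "x \<notin> gap" for x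
      using that by (simp add: flatten_def)
    fix C assume "C \<in> components gap"
    then obtain x where x: "x \<in> gap" "C = piece x" by (rule gap_component)
    show "(\<integral>\<^sup>+x. env_density x * ennreal (flatten Q x) * indicator C x \<partial>lborel) \<le> (\<integral>\<^sup>+x. env_density x * ennreal (Q x) * indicator C x \<partial>lborel)"
      unfolding x(2) nn_integral_density_piece[OF x(1)] by simp
  qed measurable
  moreover have "(\<integral>\<^sup>+x. env_density x * ennreal (Q x) * indicator {0<..<1} x \<partial>lborel)
      \<le> (\<integral>\<^sup>+x. env_density x * ennreal (flatten Q x) * indicator {0<..<1} x \<partial>lborel)"
  proof (rule nn_integral_le_components[OF _ _ _ open_gap])
    show "gap \<subseteq> {0<..<1}" by (auto simp: gap_def)
    show "env_density x * ennreal (Q x) \<le> env_density x * ennreal (flatten Q x)" if "x \<notin> gap" for x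
      using that by (simp add: flatten_def)
    fix C assume "C \<in> components gap"
    then obtain x where x: "x \<in> gap" "C = piece x" by (rule gap_component)
    show "(\<integral>\<^sup>+x. env_density x * ennreal (Q x) * indicator C x \<partial>lborel) \<le> (\<integral>\<^sup>+x. env_density x * ennreal (flatten Q x) * indicator C x \<partial>lborel)"
      unfolding x(2) nn_integral_density_piece[OF x(1)] by simp
  qed measurable
  ultimately show ?thesis unfolding cost_def by (simp add: nn_integral_unif)
qed

lemma utility_flatten:
  assumes "concave_utility v"
  shows "(\<integral>\<^sup>+x. ennreal (v (Q x)) \<partial>unif) \<le> (\<integral>\<^sup>+x. ennreal (v (flatten Q x)) \<partial>unif)"
proof -
  interpret concave_utility v by fact
  note [measurable] = qfun_measurable[OF Q] qfun_measurable[OF qfun_flatten]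
  have piece_le: "(\<integral>\<^sup>+y. ennreal (v (Q y)) * indicator (piece x) y \<partial>lborel)
      \<le> (\<integral>\<^sup>+y. ennreal (v (flatten Q y)) * indicator (piece x) y \<partial>lborel)" if x: "x \<in> gap" for x
  proof -
    have [measurable]: "piece x \<in> sets borel" using piece[OF x] by auto
    have "AE y in uniform_measure lborel (piece x). 0 \<le> Q y"
      using AE_piece[OF x] by eventually_elim (use piece(5)[OF x] Q in \<open>auto simp: qfun_def\<close>)
    then have J: "(\<integral>\<^sup>+y. ennreal (v (Q y)) \<partial>uniform_measure lborel (piece x)) \<le> ennreal (v (flatten Q x))"
      using nn_jensen[OF prob_space_piece[OF x] integrable_piece[OF x]] x by (simp add: flatten_def)
    have "(\<integral>\<^sup>+y. ennreal (v (Q y)) * indicator (piece x) y \<partial>lborel)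
        = emeasure lborel (piece x) * (\<integral>\<^sup>+y. ennreal (v (Q y)) \<partial>uniform_measure lborel (piece x))"
      by (rule nn_integral_piece[OF x]) measurable
    also have "\<dots> \<le> emeasure lborel (piece x) * ennreal (v (flatten Q x))"
      using J by (rule mult_left_mono) simp
    also have "\<dots> = (\<integral>\<^sup>+y. ennreal (v (flatten Q x)) * indicator (piece x) y \<partial>lborel)"
      by (subst nn_integral_cmult_indicator) (auto simp: ac_simps)
    also have "\<dots> = (\<integral>\<^sup>+y. ennreal (v (flatten Q y)) * indicator (piece x) y \<partial>lborel)"
      by (intro nn_integral_cong) (auto simp: indicator_def flatten_piece[OF _ x])
    finally show ?thesis .
  qed
  have "(\<integral>\<^sup>+x. ennreal (v (Q x)) * indicator {0<..<1} x \<partial>lborel)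
      \<le> (\<integral>\<^sup>+x. ennreal (v (flatten Q x)) * indicator {0<..<1} x \<partial>lborel)"
  proof (rule nn_integral_le_components[OF _ _ _ open_gap])
    show "gap \<subseteq> {0<..<1}" by (auto simp: gap_def)
    show "ennreal (v (Q x)) \<le> ennreal (v (flatten Q x))" if "x \<notin> gap" for x
      using that by (simp add: flatten_def)
    fix C assume "C \<in> components gap"
    then obtain x where x: "x \<in> gap" "C = piece x" by (rule gap_component)
    show "(\<integral>\<^sup>+x. ennreal (v (Q x)) * indicator C x \<partial>lborel) \<le> (\<integral>\<^sup>+x. ennreal (v (flatten Q x)) * indicator C x \<partial>lborel)"
      unfolding x(2) by (rule piece_le[OF x(1)])
  qed measurable
  then show ?thesis by (simp add: nn_integral_unif)
qed

text \<open>If a level \<open>c\<close> fell into a gap, the flattened function would be constant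
  around \<open>c\<close>, although by \<open>level_split\<close> it is at most \<open>t\<close> to
  the left of \<open>c\<close> and above \<open>t\<close> to the right.\<close>

lemma flatten_contact: "f (level (flatten Q) t) = g (level (flatten Q) t)"
proof (rule ccontr)
  define c where "c = level (flatten Q) t"
  assume "f (level (flatten Q) t) \<noteq> g (level (flatten Q) t)"
  then have ne: "f c \<noteq> g c" by (simp add: c_def)
  have c01: "c \<in> {0..1}" unfolding c_def by (rule level_bounds)
  then have "c \<noteq> 0" "c \<noteq> 1" using ne env_0 env_1 by auto
  then have c: "c \<in> gap" using ne le_env[OF c01] c01 by (auto simp: gap_def)
  obtain e where e: "0 < e" "ball c e \<subseteq> piece c"
    using piece(1,2)[OF c] open_contains_ball by blast
  have in_piece: "c - e / 2 \<in> piece c" "c + e / 2 \<in> piece c"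
    using e by (auto simp: dist_real_def subset_iff simp del: connected_component_eq mem_Collect_eq)
  then have "c - e / 2 \<in> {0<..<1}" "c + e / 2 \<in> {0<..<1}" using piece(5)[OF c] by blast+
  then have "flatten Q (c - e / 2) \<le> t" "t < flatten Q (c + e / 2)"
    using level_split[OF qfun_flatten, of _ t] e(1) unfolding c_def by auto
  then show False using flatten_piece[OF _ c] in_piece by simp
qed

end

end

section \<open>Equivalence of the quantile problems\<close>

lemma qfun_add:
  assumes "qfun Q" "0 \<le> c"
  shows "qfun (\<lambda>x. Q x + c)"
  using assms by (auto simp: qfun_def mono_on_def)

lemma qfun_midpoint:
  assumes "qfun Q" "qfun R"
  shows "qfun (\<lambda>x. (Q x + R x) / 2)"
  using assms by (auto simp: qfun_def mono_on_def intro!: add_mono divide_right_mono)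

lemma (in diffuse) nn_integral_add_const:
  assumes Q: "qfun Q" and c: "0 \<le> c"
  shows "(\<integral>\<^sup>+x. ennreal (Q x + c) \<partial>N) = (\<integral>\<^sup>+x. ennreal (Q x) \<partial>N) + ennreal c * emeasure N UNIV"
proof -
  note [measurable] = qfun_measurable[OF Q]
  have "(\<integral>\<^sup>+x. ennreal (Q x + c) \<partial>N) = (\<integral>\<^sup>+x. ennreal (Q x) + ennreal c \<partial>N)"
  proof (rule nn_integral_cong_AE)
    show "AE x in N. ennreal (Q x + c) = ennreal (Q x) + ennreal c"
      using supp by eventually_elim (use Q c in \<open>auto simp: qfun_def intro!: ennreal_plus\<close>)
  qed
  then show ?thesis by (simp add: nn_integral_add)
qed

section \<open>Strict monotonicity and strict concavity of the total utility\<close>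

context concave_utility
begin

definition total :: "(real \<Rightarrow> real) \<Rightarrow> ennreal" where
  "total Q = (\<integral>\<^sup>+x. ennreal (v (Q x)) \<partial>unif)"

lemma total_add_mono:
  assumes "0 \<le> c"
  shows "total Q \<le> total (\<lambda>x. Q x + c)"
  unfolding total_def using assms by (intro nn_integral_mono ennreal_leI monoD[OF v_mono]) auto

lemma total_add_strict:
  assumes Q: "qfun Q" and c: "0 < c" and fin: "total Q < \<infinity>"
  shows "total Q < total (\<lambda>x. Q x + c)"
proof -
  note [measurable] = qfun_measurable[OF Q]
  have lt: "AE x in unif. ennreal (v (Q x)) < ennreal (v (Q x + c))"
    using qfun_AE_nonneg[OF Q]
  proof eventually_elim
    case (elim x)
    then have "v (Q x) < v (Q x + c)" using c by (intro strict_mono_onD[OF v_strict]) auto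
    then show ?case using v_nonneg by (simp add: ennreal_lessI le_less_trans[OF v_nonneg])
  qed
  show ?thesis unfolding total_def
  proof (rule nn_integral_less)
    show "AE x in unif. ennreal (v (Q x)) \<le> ennreal (v (Q x + c))"
      using lt by eventually_elim auto
    show "\<not> (AE x in unif. ennreal (v (Q x + c)) \<le> ennreal (v (Q x)))"
    proof
      assume "AE x in unif. ennreal (v (Q x + c)) \<le> ennreal (v (Q x))"
      with lt have "AE x in unif. False" by eventually_elim auto
      then show False by simp
    qed
  qed (use fin in \<open>auto simp: total_def\<close>)
qed

text \<open>The pointwise strict inequality holds wherever \<open>Q\<close> and \<open>R\<close>
  differ, which is not a null set; finiteness carries the strictness over to the integrals.\<close>

lemma total_midpoint:
  assumes Q: "qfun Q" and R: "qfun R" and fin: "total Q < \<infinity>" "total R < \<infinity>"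
    and ne: "\<not> (AE x in unif. Q x = R x)"
  shows "total Q + total R < 2 * total (\<lambda>x. (Q x + R x) / 2)"
proof -
  note [measurable] = qfun_measurable[OF Q] qfun_measurable[OF R]
  have eq: "total Q + total R = (\<integral>\<^sup>+x. ennreal (v (Q x) + v (R x)) \<partial>unif)"
    unfolding total_def by (subst nn_integral_add[symmetric]) (auto simp: ennreal_plus v_nonneg)
  have "\<dots> < (\<integral>\<^sup>+x. ennreal (2 * v ((Q x + R x) / 2)) \<partial>unif)"
  proof (rule nn_integral_less)
    show "AE x in unif. ennreal (v (Q x) + v (R x)) \<le> ennreal (2 * v ((Q x + R x) / 2))"
      using qfun_AE_nonneg[OF Q] qfun_AE_nonneg[OF R]
      by eventually_elim (intro ennreal_leI v_midpoint)
    show "\<not> (AE x in unif. ennreal (2 * v ((Q x + R x) / 2)) \<le> ennreal (v (Q x) + v (R x)))"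
    proof
      assume "AE x in unif. ennreal (2 * v ((Q x + R x) / 2)) \<le> ennreal (v (Q x) + v (R x))"
      then have "AE x in unif. Q x = R x"
        using qfun_AE_nonneg[OF Q] qfun_AE_nonneg[OF R]
      proof eventually_elim
        case (elim x)
        have "0 \<le> v (Q x) + v (R x)" using v_nonneg by simp
        then have "2 * v ((Q x + R x) / 2) \<le> v (Q x) + v (R x)" using elim(1) by simp
        then show ?case using v_midpoint(2)[OF elim(2,3)] by (meson not_le)
      qed
      then show False using ne by simp
    qed
    show "(\<integral>\<^sup>+x. ennreal (v (Q x) + v (R x)) \<partial>unif) \<noteq> \<infinity>"
      using fin unfolding eq[symmetric] by (metis ennreal_add_eq_top infinity_ennreal_def less_irrefl)
  qed measurable
  also have "\<dots> = 2 * total (\<lambda>x. (Q x + R x) / 2)"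
    unfolding total_def
    by (subst nn_integral_cmult[symmetric]) (auto simp: ennreal_mult v_nonneg)
  finally show ?thesis unfolding eq .
qed

end

locale quantile_problem = increasing_envelope + concave_utility +
  fixes N :: "real measure"
  assumes N: "diffuse N" and tail: "\<And>c. c \<in> {0..1} \<Longrightarrow> emeasure N {c<..} = ennreal (f 1 - f c)"
begin

definition price :: "(real \<Rightarrow> real) \<Rightarrow> ennreal" where
  "price Q = (\<integral>\<^sup>+x. ennreal (Q x) \<partial>N)"

lemma cost_le_price: "qfun Q \<Longrightarrow> cost Q \<le> price Q"
  unfolding price_def using cost_le N tail by blast

lemma price_flatten:
  assumes "qfun Q" "cost Q < \<infinity>"
  shows "price (flatten Q) = cost Q"
proof -
  have "cost (flatten Q) = price (flatten Q)"
    unfolding price_def using tail qfun_flatten[OF assms] flatten_contact[OF assms]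
    by (rule cost_eq_if_contact[OF N])
  then show ?thesis using cost_flatten[OF assms] by simp
qed

lemma mass_pos: "0 < f 1 - f 0"
  using strict_mono_onD[OF mono, of 0 1] by simp

lemma cost_add:
  assumes "qfun Q" "0 \<le> c"
  shows "cost (\<lambda>x. Q x + c) = cost Q + ennreal (c * (f 1 - f 0))"
proof -
  have "emeasure (density unif env_density) UNIV = ennreal (f 1 - f 0)"
    by (subst emeasure_density) (auto simp: nn_integral_env_density)
  then show ?thesis
    using diffuse.nn_integral_add_const[OF diffuse_env_density assms] assms mass_pos
    by (simp add: cost_eq qfun_add ennreal_mult)
qed

lemma price_add:
  assumes "qfun Q" "0 \<le> c"
  shows "price (\<lambda>x. Q x + c) = price Q + ennreal (c * (f 1 - f 0))"
proof -
  interpret N: diffuse N by (rule N)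
  have "emeasure N UNIV = emeasure N {0<..}"
    by (rule emeasure_eq_AE) (use N.supp in \<open>auto elim!: eventually_mono\<close>)
  then show ?thesis
    using N.nn_integral_add_const[OF assms] assms mass_pos tail[of 0]
    by (simp add: price_def ennreal_mult)
qed

text \<open>Finds the constant that uses up a leftover budget. By \<open>cost_add\<close> and
  \<open>price_add\<close> the same constant serves for costs and for prices.\<close>

lemma top_up:
  assumes le: "k \<le> ennreal x0"
  obtains c where "0 \<le> c" "k + ennreal (c * (f 1 - f 0)) = ennreal x0" "k < ennreal x0 \<Longrightarrow> 0 < c"
proof -
  obtain r where r: "k = ennreal r" "0 \<le> r" using le by (cases k) (auto simp: top_unique)
  \<comment> \<open>The sign of \<open>x0\<close> is not fixed at this point, and
    \<open>ennreal x0\<close> equals \<open>ennreal (max 0 x0)\<close>.\<close>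
  define c where "c = (max 0 x0 - r) / (f 1 - f 0)"
  have "r \<le> max 0 x0" using le r by (auto simp: ennreal_le_iff2)
  then have "0 \<le> c" unfolding c_def using mass_pos by simp
  moreover have "c * (f 1 - f 0) = max 0 x0 - r" unfolding c_def using mass_pos by simp
  then have "k + ennreal (c * (f 1 - f 0)) = ennreal (max 0 x0)"
    using r \<open>r \<le> max 0 x0\<close> by (simp add: ennreal_plus[symmetric] del: ennreal_plus)
  then have "k + ennreal (c * (f 1 - f 0)) = ennreal x0"
    by (cases "0 \<le> x0") (auto simp: ennreal_neg max_def)
  moreover have "0 < c" if "k < ennreal x0"
  proof -
    have "r < x0" using that r by (auto simp: ennreal_less_iff)
    then show ?thesis unfolding c_def using mass_pos by simp
  qed
  ultimately show thesis using that by blast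
qed

text \<open>After topping up, \<open>q\<close> beats everything of cost at most \<open>x0\<close>
  and must itself spend \<open>x0\<close>. Then \<open>q\<close> agrees almost everywhere with its
  flattening, so its levels are contact points and its price equals its cost.\<close>

lemma cost_maximizer:
  assumes q: "qfun q" and le: "cost q \<le> ennreal x0" and fin: "total q < \<infinity>"
    and opt: "\<And>R. qfun R \<Longrightarrow> cost R = ennreal x0 \<Longrightarrow> total R \<le> total q"
  shows "price q = ennreal x0"
    and "\<And>R. qfun R \<Longrightarrow> price R \<le> ennreal x0 \<Longrightarrow> total R \<le> total q"
proof -
  have ub: "total R \<le> total q" if R: "qfun R" "cost R \<le> ennreal x0" for R
  proof -
    obtain c where c: "0 \<le> c" "cost R + ennreal (c * (f 1 - f 0)) = ennreal x0"
      using top_up[OF R(2)] by blast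
    then have "total (\<lambda>x. R x + c) \<le> total q" using R by (intro opt qfun_add) (auto simp: cost_add)
    then show ?thesis using total_add_mono[OF c(1)] order.trans by blast
  qed
  then show "total R \<le> total q" if "qfun R" "price R \<le> ennreal x0" for R
    using that cost_le_price order.trans by blast
  have eq: "cost q = ennreal x0"
  proof (rule ccontr)
    assume "cost q \<noteq> ennreal x0"
    with le have "cost q < ennreal x0" by simp
    then obtain c where c: "0 < c" "cost q + ennreal (c * (f 1 - f 0)) = ennreal x0"
      using top_up[OF le] by blast
    then have "total (\<lambda>x. q x + c) \<le> total q" using q by (intro opt qfun_add) (auto simp: cost_add)
    then show False using total_add_strict[OF q c(1) fin] by simp
  qed
  then have fc: "cost q < \<infinity>" by simp
  let ?r = "flatten q"
  have r: "qfun ?r" "cost ?r = cost q" using qfun_flatten cost_flatten q fc by auto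
  have tr: "total ?r \<le> total q" using ub r eq by simp
  \<comment> \<open>Otherwise the midpoint of \<open>q\<close> and its flattening, which also costs
    \<open>x0\<close>, would exceed the maximum by strict concavity.\<close>
  have "AE x in unif. q x = ?r x"
  proof (rule ccontr)
    assume ne: "\<not> (AE x in unif. q x = ?r x)"
    have m: "qfun (\<lambda>x. (q x + ?r x) / 2)" by (intro qfun_midpoint q r)
    note [measurable] = qfun_measurable[OF q] qfun_measurable[OF r(1)]
    have "2 * cost (\<lambda>x. (q x + ?r x) / 2) = (\<integral>\<^sup>+x. env_density x * ennreal (q x) + env_density x * ennreal (?r x) \<partial>unif)"
      unfolding cost_def
    proof (subst nn_integral_cmult[symmetric], measurable, rule nn_integral_cong_AE)
      show "AE x in unif. 2 * (env_density x * ennreal ((q x + ?r x) / 2)) = env_density x * ennreal (q x) + env_density x * ennreal (?r x)"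
        using qfun_AE_nonneg[OF q] qfun_AE_nonneg[OF r(1)]
      proof eventually_elim
        case (elim x)
        have "2 * ennreal ((q x + ?r x) / 2) = ennreal (2 * ((q x + ?r x) / 2))"
          using elim by (subst ennreal_mult) auto
        also have "2 * ((q x + ?r x) / 2) = q x + ?r x" by simp
        also have "ennreal \<dots> = ennreal (q x) + ennreal (?r x)" using elim by (rule ennreal_plus)
        finally show ?case by (metis distrib_left mult.left_commute)
      qed
    qed
    also have "\<dots> = 2 * cost q"
      using r(2) unfolding cost_def by (subst nn_integral_add) (auto simp: mult_2)
    finally have "cost (\<lambda>x. (q x + ?r x) / 2) = cost q"
      by (simp add: ennreal_mult_cancel_left)
    then have "total (\<lambda>x. (q x + ?r x) / 2) \<le> total q" using opt m eq by simp
    moreover have "total q \<le> total ?r"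
      unfolding total_def by (rule utility_flatten[OF q fc]) (rule concave_utility_axioms)
    ultimately have "2 * total (\<lambda>x. (q x + ?r x) / 2) \<le> total q + total ?r"
      by (simp add: mult_2 add_mono order.trans)
    moreover have "total ?r < \<infinity>" using tr fin by (rule le_less_trans)
    ultimately show False using total_midpoint[OF q r(1) fin _ ne] by simp
  qed
  \<comment> \<open>Levels depend only on the almost everywhere class, so \<open>q\<close> inherits
    the contact property of its flattening.\<close>
  then have lev: "level q t = level ?r t" for t
    using q r by (intro level_cong_AE) (auto simp: qfun_def)
  show "price q = ennreal x0"
    unfolding price_def eq[symmetric]
    by (rule cost_eq_if_contact[OF N tail q, symmetric]) (auto simp: lev tail flatten_contact[OF q fc])
qed

text \<open>Any \<open>R\<close> of cost at most \<open>x0\<close> becomes, once flattened and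
  topped up, a competitor of price exactly \<open>x0\<close> with no less utility.\<close>

lemma price_maximizer:
  assumes q: "qfun q" and le: "price q \<le> ennreal x0" and fin: "total q < \<infinity>"
    and opt: "\<And>R. qfun R \<Longrightarrow> price R = ennreal x0 \<Longrightarrow> total R \<le> total q"
  shows "cost q = ennreal x0" and "price q = ennreal x0"
    and "\<And>R. qfun R \<Longrightarrow> cost R \<le> ennreal x0 \<Longrightarrow> total R \<le> total q"
proof -
  have flat: "total R \<le> total (flatten R)" if "qfun R" "cost R < \<infinity>" for R
    unfolding total_def by (rule utility_flatten[OF that]) (rule concave_utility_axioms)
  have up: "total (\<lambda>x. flatten R x + c) \<le> total q"
    if "qfun R" "cost R < \<infinity>" "0 \<le> c" "cost R + ennreal (c * (f 1 - f 0)) = ennreal x0" for R c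
    using that by (intro opt qfun_add qfun_flatten) (auto simp: price_add qfun_flatten price_flatten)
  show "total R \<le> total q" if R: "qfun R" "cost R \<le> ennreal x0" for R
  proof -
    obtain c where c: "0 \<le> c" "cost R + ennreal (c * (f 1 - f 0)) = ennreal x0"
      using top_up[OF R(2)] by blast
    have fc: "cost R < \<infinity>" using R(2) by (auto intro: le_less_trans)
    show ?thesis using flat[OF R(1) fc] total_add_mono[OF c(1), of "flatten R"] up[OF R(1) fc c]
      by (meson order.trans)
  qed
  have cle: "cost q \<le> ennreal x0" using cost_le_price[OF q] le by simp
  then have fc: "cost q < \<infinity>" by (auto intro: le_less_trans)
  show eq: "cost q = ennreal x0"
  proof (rule ccontr)
    assume "cost q \<noteq> ennreal x0"
    with cle have "cost q < ennreal x0" by simp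
    then obtain c where c: "0 < c" "cost q + ennreal (c * (f 1 - f 0)) = ennreal x0"
      using top_up[OF cle] by blast
    \<comment> \<open>A cheaper \<open>q\<close> is contradictory: its topped-up flattening has at
      most the utility of \<open>q\<close>, hence at most that of the flattening, although adding a
      positive constant increases utility strictly.\<close>
    have u: "total (\<lambda>x. flatten q x + c) \<le> total q" using up[OF q fc _ c(2)] c(1) by simp
    then have "total (flatten q) < \<infinity>"
      using total_add_mono[of c "flatten q"] c(1) fin by (meson le_less_trans less_imp_le order.trans)
    then have "total (flatten q) < total (\<lambda>x. flatten q x + c)"
      using total_add_strict[OF qfun_flatten[OF q fc] c(1)] by simp
    then show False using u flat[OF q fc] by simp
  qed
  show "price q = ennreal x0" using eq le cost_le_price[OF q] by simp
qed

end

section \<open>Rearrangement and comonotonicity\<close>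

context prob_space
begin

text \<open>One threshold in each interval is all that an almost everywhere statement about
  \<open>t\<close> can provide. Choosing one for each pair of rationals gives countably many
  thresholds that still separate any two distinct values.\<close>

lemma AE_eq_if_upper_sets_eq:
  fixes X Y :: "'a \<Rightarrow> real"
  assumes "\<And>a b. a < b \<Longrightarrow> \<exists>t\<in>{a<..<b}. AE \<omega> in M. (t < X \<omega>) = (t < Y \<omega>)"
  shows "AE \<omega> in M. X \<omega> = Y \<omega>"
proof -
  have "\<forall>a b. \<exists>t. a < b \<longrightarrow> t \<in> {a<..<b} \<and> (AE \<omega> in M. (t < X \<omega>) = (t < Y \<omega>))"
    using assms by blast
  then obtain t where t: "\<And>a b. a < b \<Longrightarrow> t a b \<in> {a<..<b} \<and> (AE \<omega> in M. (t a b < X \<omega>) = (t a b < Y \<omega>))"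
    by metis
  have "AE \<omega> in M. \<forall>a::rat. \<forall>b::rat. a < b \<longrightarrow>
      (t (of_rat a) (of_rat b) < X \<omega>) = (t (of_rat a) (of_rat b) < Y \<omega>)"
    unfolding AE_all_countable using t by (auto simp: of_rat_less)
  then show ?thesis
  proof eventually_elim
    case (elim \<omega>)
    have False if xy: "x < y"
      and sep: "\<And>a b::rat. a < b \<Longrightarrow> (t (of_rat a) (of_rat b) < x) = (t (of_rat a) (of_rat b) < y)" for x y
    proof -
      obtain a where a: "x < of_rat a" "of_rat a < y" using of_rat_dense[OF xy] by blast
      obtain b where b: "(of_rat a :: real) < of_rat b" "of_rat b < y" using of_rat_dense[OF a(2)] by blast
      have "t (of_rat a) (of_rat b) \<in> {of_rat a<..<of_rat b}" using t b(1) by blast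
      then show False using sep[of a b] a b by (auto simp: of_rat_less)
    qed
    from this[of "X \<omega>" "Y \<omega>"] this[of "Y \<omega>" "X \<omega>"] elim show ?case
      by (cases "X \<omega>" "Y \<omega>" rule: linorder_cases) auto
  qed
qed

lemma AE_iff_if_prob_diff_eq_0:
  assumes [measurable]: "A \<in> events" "B \<in> events" and "prob A = prob B" and "prob (A - B) = 0"
  shows "AE \<omega> in M. (\<omega> \<in> A) = (\<omega> \<in> B)"
proof -
  have "prob A = prob (A - B) + prob (A \<inter> B)" "prob B = prob (B - A) + prob (A \<inter> B)"
    by (subst finite_measure_Union[symmetric]; auto intro!: arg_cong[where f = prob])+
  then have "prob (B - A) = 0" using assms by simp
  then have "AE \<omega> in M. \<omega> \<notin> A - B" "AE \<omega> in M. \<omega> \<notin> B - A"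
    using assms(4) by (simp_all add: prob_eq_0)
  then show ?thesis by eventually_elim auto
qed

text \<open>Let \<open>A\<close> and \<open>B\<close> be the upper sets of \<open>X\<close> and
  \<open>Y\<close> at \<open>t\<close>. A pair of outcomes in
  \<open>(A - B) \<times> (B - A)\<close> would order \<open>X\<close> and \<open>U\<close>
  oppositely, so this product is null and one factor is null. Equal laws then make the other factor
  null too.\<close>

lemma comonotonic_same_law:
  assumes [measurable]: "X \<in> borel_measurable M" "Y \<in> borel_measurable M" "U \<in> borel_measurable M"
    and law: "distr M borel X = distr M borel Y"
    and como: "comonotonic M U X"
    and Y: "AE \<omega> in M. U \<omega> \<in> S \<and> Y \<omega> = h (U \<omega>)" and h: "mono_on S h"
  shows "AE \<omega> in M. X \<omega> = Y \<omega>"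
proof (rule AE_eq_if_upper_sets_eq)
  fix a b :: real assume "a < b"
  then obtain t where t: "t \<in> {a<..<b}" using dense by auto
  define A where "A = {\<omega> \<in> space M. t < X \<omega>}"
  define B where "B = {\<omega> \<in> space M. t < Y \<omega>}"
  have [measurable]: "A \<in> events" "B \<in> events" unfolding A_def B_def by measurable
  interpret P: pair_prob_space M M ..
  have "measure (distr M borel X) {t<..} = measure (distr M borel Y) {t<..}" using law by simp
  then have eq: "prob A = prob B"
    unfolding A_def B_def by (simp add: measure_distr vimage_def Int_def conj_commute)
  have 1: "AE p in M \<Otimes>\<^sub>M M. (X (snd p) - X (fst p)) * (U (snd p) - U (fst p)) \<ge> 0"
    using como unfolding comonotonic_def by (simp add: case_prod_beta mult.commute)
  have 2: "AE p in M \<Otimes>\<^sub>M M. U (fst p) \<in> S \<and> Y (fst p) = h (U (fst p))"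
  proof (rule AE_distrD[of fst])
    show "AE \<omega> in distr (M \<Otimes>\<^sub>M M) M fst. U \<omega> \<in> S \<and> Y \<omega> = h (U \<omega>)"
      unfolding distr_pair_fst by (rule Y)
  qed measurable
  have 3: "AE p in M \<Otimes>\<^sub>M M. U (snd p) \<in> S \<and> Y (snd p) = h (U (snd p))"
  proof -
    have "AE p in distr (M \<Otimes>\<^sub>M M) (M \<Otimes>\<^sub>M M) (\<lambda>(x, y). (y, x)). U (fst p) \<in> S \<and> Y (fst p) = h (U (fst p))"
      by (subst P.distr_pair_swap[symmetric]) (rule 2)
    then have "AE p in M \<Otimes>\<^sub>M M. U (fst (case p of (x, y) \<Rightarrow> (y, x))) \<in> S
        \<and> Y (fst (case p of (x, y) \<Rightarrow> (y, x))) = h (U (fst (case p of (x, y) \<Rightarrow> (y, x))))"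
      by (rule AE_distrD[rotated]) measurable
    then show ?thesis by (simp add: case_prod_beta)
  qed
  have "AE p in M \<Otimes>\<^sub>M M. p \<notin> (A - B) \<times> (B - A)"
    using 1 2 3
  proof eventually_elim
    case (elim p)
    show ?case
    proof
      assume "p \<in> (A - B) \<times> (B - A)"
      then have lt: "X (snd p) < X (fst p)" "Y (fst p) < Y (snd p)"
        by (auto simp: A_def B_def)
      have "U (fst p) < U (snd p)"
      proof (rule ccontr)
        assume "\<not> U (fst p) < U (snd p)"
        then have "h (U (snd p)) \<le> h (U (fst p))"
          using elim h by (auto simp: mono_on_def)
        then show False using elim lt by simp
      qed
      then have "(X (snd p) - X (fst p)) * (U (snd p) - U (fst p)) < 0"
        using lt by (intro mult_neg_pos) auto
      then show False using elim(1) by simp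
    qed
  qed
  then have "emeasure (M \<Otimes>\<^sub>M M) ((A - B) \<times> (B - A)) = 0"
    by (subst (asm) AE_iff_null_sets[symmetric]) auto
  then have "emeasure M (A - B) * emeasure M (B - A) = 0"
    by (subst (asm) emeasure_pair_measure_Times) auto
  then have "prob (A - B) = 0 \<or> prob (B - A) = 0"
    by (auto simp: emeasure_eq_measure)
  then have "AE \<omega> in M. (\<omega> \<in> A) = (\<omega> \<in> B)"
    using AE_iff_if_prob_diff_eq_0[of A B] AE_iff_if_prob_diff_eq_0[of B A] eq by auto
  then have "AE \<omega> in M. (t < X \<omega>) = (t < Y \<omega>)"
    using AE_space by eventually_elim (auto simp: A_def B_def)
  then show "\<exists>t\<in>{a<..<b}. AE \<omega> in M. (t < X \<omega>) = (t < Y \<omega>)" using t by blast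
qed

context
  fixes \<xi> X Z :: "'a \<Rightarrow> real"
  assumes int: "integrable M \<xi>" and \<xi>_nonneg: "AE \<omega> in M. 0 \<le> \<xi> \<omega>"
    and X [measurable]: "X \<in> borel_measurable M" and Z [measurable]: "Z \<in> borel_measurable M"
    and law: "distr M borel X = distr M borel Z"
    and anti: "\<And>t. (AE \<omega> in M. t < Z \<omega>) \<or>
      (\<exists>k. AE \<omega> in M. (t < Z \<omega> \<longrightarrow> \<xi> \<omega> \<le> k) \<and> (\<not> t < Z \<omega> \<longrightarrow> k \<le> \<xi> \<omega>))"
begin

lemma \<xi>_measurable: "\<xi> \<in> borel_measurable M"
  using int by (rule borel_measurable_integrable)

abbreviation upper :: "('a \<Rightarrow> real) \<Rightarrow> real \<Rightarrow> 'a set" where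
  "upper Y t \<equiv> {\<omega> \<in> space M. t < Y \<omega>}"

lemma prob_upper: "prob (upper X t) = prob (upper Z t)"
proof -
  have "measure (distr M borel X) {t<..} = measure (distr M borel Z) {t<..}" using law by simp
  then show ?thesis by (simp add: measure_distr vimage_def Int_def conj_commute)
qed

text \<open>A bathtub argument: where the two upper sets differ, \<open>\<xi> - k\<close> has the
  sign of the difference of the indicators, and the term with \<open>k\<close> integrates to 0
  because both sets have equal probability. The first alternative covers thresholds below almost all
  of \<open>Z\<close>, where the cutoff \<open>k\<close> might have to be infinite.\<close>

lemma upper_excess:
  obtains "AE \<omega> in M. t < X \<omega> \<and> t < Z \<omega>"
  | k where "AE \<omega> in M. 0 \<le> (\<xi> \<omega> - k) * (indicator (upper X t) \<omega> - indicator (upper Z t) \<omega>)"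
    "(\<integral>\<omega>. (\<xi> \<omega> - k) * (indicator (upper X t) \<omega> - indicator (upper Z t) \<omega>) \<partial>M)
      = (\<integral>\<omega>. \<xi> \<omega> * indicator (upper X t) \<omega> \<partial>M) - (\<integral>\<omega>. \<xi> \<omega> * indicator (upper Z t) \<omega> \<partial>M)"
    "integrable M (\<lambda>\<omega>. (\<xi> \<omega> - k) * (indicator (upper X t) \<omega> - indicator (upper Z t) \<omega>))"
proof (cases "AE \<omega> in M. t < Z \<omega>")
  case True
  then have "prob (upper Z t) = 1" by (subst prob_Collect_eq_1) auto
  then have "AE \<omega> in M. t < X \<omega>" using prob_upper[of t] prob_Collect_eq_1[of "\<lambda>\<omega>. t < X \<omega>"] by auto
  with True have "AE \<omega> in M. t < X \<omega> \<and> t < Z \<omega>" by eventually_elim auto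
  then show thesis by (rule that(1))
next
  case False
  then obtain k where k: "AE \<omega> in M. (t < Z \<omega> \<longrightarrow> \<xi> \<omega> \<le> k) \<and> (\<not> t < Z \<omega> \<longrightarrow> k \<le> \<xi> \<omega>)"
    using anti by blast
  have ii: "integrable M (\<lambda>\<omega>. \<xi> \<omega> * indicator (upper Y t) \<omega>)"
    if [measurable]: "Y \<in> borel_measurable M" for Y
    using int by (rule integrable_real_mult_indicator[rotated]) measurable
  have i2: "integrable M (indicator (upper Y t) :: _ \<Rightarrow> real)"
    if [measurable]: "Y \<in> borel_measurable M" for Y
    by (intro integrable_real_indicator) (auto simp: emeasure_eq_measure)
  have eq: "(\<lambda>\<omega>. (\<xi> \<omega> - k) * (indicator (upper X t) \<omega> - indicator (upper Z t) \<omega>))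
     = (\<lambda>\<omega>. (\<xi> \<omega> * indicator (upper X t) \<omega> - \<xi> \<omega> * indicator (upper Z t) \<omega>)
        - (k * indicator (upper X t) \<omega> - k * indicator (upper Z t) \<omega>))"
    by (simp add: fun_eq_iff algebra_simps)
  show thesis
  proof (rule that(2))
    show "AE \<omega> in M. 0 \<le> (\<xi> \<omega> - k) * (indicator (upper X t) \<omega> - indicator (upper Z t) \<omega>)"
      using k AE_space by eventually_elim (auto simp: indicator_def)
    show "integrable M (\<lambda>\<omega>. (\<xi> \<omega> - k) * (indicator (upper X t) \<omega> - indicator (upper Z t) \<omega>))"
      unfolding eq by (intro Bochner_Integration.integrable_diff ii integrable_mult_right i2 X Z)
    have "(\<integral>\<omega>. (\<xi> \<omega> * indicator (upper X t) \<omega> - \<xi> \<omega> * indicator (upper Z t) \<omega>)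
        - (k * indicator (upper X t) \<omega> - k * indicator (upper Z t) \<omega>) \<partial>M)
      = (\<integral>\<omega>. \<xi> \<omega> * indicator (upper X t) \<omega> \<partial>M) - (\<integral>\<omega>. \<xi> \<omega> * indicator (upper Z t) \<omega> \<partial>M)
        - (k * prob (upper X t) - k * prob (upper Z t))"
      by (simp add: Bochner_Integration.integral_diff ii i2 X Z)
    then show "(\<integral>\<omega>. (\<xi> \<omega> - k) * (indicator (upper X t) \<omega> - indicator (upper Z t) \<omega>) \<partial>M)
      = (\<integral>\<omega>. \<xi> \<omega> * indicator (upper X t) \<omega> \<partial>M) - (\<integral>\<omega>. \<xi> \<omega> * indicator (upper Z t) \<omega> \<partial>M)"
      unfolding eq prob_upper by simp
  qed
qed

lemma emeasure_upper:
  assumes [measurable]: "Y \<in> borel_measurable M"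
  shows "emeasure (density M (\<lambda>\<omega>. ennreal (\<xi> \<omega>))) (upper Y t)
    = ennreal (\<integral>\<omega>. \<xi> \<omega> * indicator (upper Y t) \<omega> \<partial>M)"
proof -
  note [measurable] = \<xi>_measurable
  have "emeasure (density M (\<lambda>\<omega>. ennreal (\<xi> \<omega>))) (upper Y t)
      = (\<integral>\<^sup>+\<omega>. ennreal (\<xi> \<omega>) * indicator (upper Y t) \<omega> \<partial>M)"
    by (rule emeasure_density) measurable
  also have "\<dots> = (\<integral>\<^sup>+\<omega>. ennreal (\<xi> \<omega> * indicator (upper Y t) \<omega>) \<partial>M)"
    by (intro nn_integral_cong) (auto simp: indicator_def)
  also have "\<dots> = ennreal (\<integral>\<omega>. \<xi> \<omega> * indicator (upper Y t) \<omega> \<partial>M)"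
  proof (rule nn_integral_eq_integral)
    show "integrable M (\<lambda>\<omega>. \<xi> \<omega> * indicator (upper Y t) \<omega>)"
      using int by (rule integrable_real_mult_indicator[rotated]) measurable
    show "AE \<omega> in M. 0 \<le> \<xi> \<omega> * indicator (upper Y t) \<omega>"
      using \<xi>_nonneg by eventually_elim auto
  qed
  finally show ?thesis .
qed

lemma nn_integral_upper:
  assumes [measurable]: "Y \<in> borel_measurable M"
  shows "(\<integral>\<^sup>+\<omega>. ennreal (\<xi> \<omega>) * ennreal (Y \<omega>) \<partial>M)
    = (\<integral>\<^sup>+t. ennreal (\<integral>\<omega>. \<xi> \<omega> * indicator (upper Y t) \<omega> \<partial>M) * indicator {0..} t \<partial>lborel)"
proof -
  note [measurable] = \<xi>_measurable
  let ?N = "density M (\<lambda>\<omega>. ennreal (\<xi> \<omega>))"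
  have "(\<integral>\<^sup>+\<omega>. ennreal (\<xi> \<omega>) \<partial>M) \<noteq> \<infinity>"
    using nn_integral_eq_integral[OF int \<xi>_nonneg] by simp
  then have "finite_measure ?N" by (intro finite_measureI) (auto simp: emeasure_density cong: nn_integral_cong)
  then have "sigma_finite_measure ?N" by (simp add: finite_measure_def)
  then have "(\<integral>\<^sup>+\<omega>. ennreal (Y \<omega>) \<partial>?N)
      = (\<integral>\<^sup>+t. emeasure ?N {\<omega> \<in> space ?N. t < Y \<omega>} * indicator {0..} t \<partial>lborel)"
    by (rule nn_integral_layer_cake) measurable
  then show ?thesis by (simp add: nn_integral_density emeasure_upper)
qed

lemma upper_le:
  "(\<integral>\<omega>. \<xi> \<omega> * indicator (upper Z t) \<omega> \<partial>M) \<le> (\<integral>\<omega>. \<xi> \<omega> * indicator (upper X t) \<omega> \<partial>M)"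
proof (cases rule: upper_excess[of t])
  note [measurable] = \<xi>_measurable
  case 1
  then have "AE \<omega> in M. \<xi> \<omega> * indicator (upper Z t) \<omega> = \<xi> \<omega> * indicator (upper X t) \<omega>"
    by eventually_elim (auto simp: indicator_def)
  then have "(\<integral>\<omega>. \<xi> \<omega> * indicator (upper Z t) \<omega> \<partial>M) = (\<integral>\<omega>. \<xi> \<omega> * indicator (upper X t) \<omega> \<partial>M)"
    by (intro integral_cong_AE) auto
  then show ?thesis by simp
next
  case (2 k)
  then show ?thesis using integral_nonneg_AE[OF 2(1)] by simp
qed

lemma antimonotone_minimises:
  "(\<integral>\<^sup>+\<omega>. ennreal (\<xi> \<omega>) * ennreal (Z \<omega>) \<partial>M) \<le> (\<integral>\<^sup>+\<omega>. ennreal (\<xi> \<omega>) * ennreal (X \<omega>) \<partial>M)"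
  unfolding nn_integral_upper[OF X] nn_integral_upper[OF Z]
  by (intro nn_integral_mono mult_right_mono ennreal_leI upper_le) auto

text \<open>Equal finite prices force equal layers for almost every \<open>t \<ge> 0\<close>. At
  such \<open>t\<close> the nonnegative excess has integral 0, hence vanishes, and since \<xi>
  almost surely avoids the cutoff the indicators agree.\<close>

lemma antimonotone_unique:
  assumes diffuse: "\<And>k. AE \<omega> in M. \<xi> \<omega> \<noteq> k"
    and X0: "AE \<omega> in M. 0 \<le> X \<omega>" and Z0: "AE \<omega> in M. 0 \<le> Z \<omega>"
    and le: "(\<integral>\<^sup>+\<omega>. ennreal (\<xi> \<omega>) * ennreal (X \<omega>) \<partial>M) \<le> (\<integral>\<^sup>+\<omega>. ennreal (\<xi> \<omega>) * ennreal (Z \<omega>) \<partial>M)"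
    and fin: "(\<integral>\<^sup>+\<omega>. ennreal (\<xi> \<omega>) * ennreal (Z \<omega>) \<partial>M) < \<infinity>"
  shows "AE \<omega> in M. X \<omega> = Z \<omega>"
proof (rule AE_eq_if_upper_sets_eq)
  note [measurable] = \<xi>_measurable
  define I where "I = (\<lambda>Y t. \<integral>\<omega>. \<xi> \<omega> * indicator (upper Y t) \<omega> \<partial>M)"
  have meas: "(\<lambda>t. I Y t) \<in> borel_measurable lborel" if [measurable]: "Y \<in> borel_measurable M" for Y
  proof -
    have "(\<lambda>t. \<integral>\<omega>. \<xi> \<omega> * indicator {p \<in> space (lborel \<Otimes>\<^sub>M M). fst p < Y (snd p)} (t, \<omega>) \<partial>M) \<in> borel_measurable lborel"
      by measurable
    moreover have "(\<lambda>t. \<integral>\<omega>. \<xi> \<omega> * indicator {p \<in> space (lborel \<Otimes>\<^sub>M M). fst p < Y (snd p)} (t, \<omega>) \<partial>M) = I Y"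
      unfolding I_def by (intro ext Bochner_Integration.integral_cong) (auto simp: indicator_def space_pair_measure)
    ultimately show ?thesis by simp
  qed
  note [measurable] = meas[OF X] meas[OF Z]
  have I0: "0 \<le> I Y t" for Y t
    unfolding I_def by (rule integral_nonneg_AE) (use \<xi>_nonneg in \<open>auto elim!: eventually_mono\<close>)
  have "AE t in lborel. ennreal (I X t) * indicator {0..} t \<le> ennreal (I Z t) * indicator {0..} t"
  proof (rule ccontr)
    assume "\<not> ?thesis"
    then have "(\<integral>\<^sup>+t. ennreal (I Z t) * indicator {0..} t \<partial>lborel) < (\<integral>\<^sup>+t. ennreal (I X t) * indicator {0..} t \<partial>lborel)"
    proof (intro nn_integral_less)
      show "AE t in lborel. ennreal (I Z t) * indicator {0..} t \<le> ennreal (I X t) * indicator {0..} t"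
        unfolding I_def by (intro AE_I2 mult_right_mono ennreal_leI upper_le) auto
      show "(\<integral>\<^sup>+t. ennreal (I Z t) * indicator {0..} t \<partial>lborel) \<noteq> \<infinity>"
        using fin unfolding nn_integral_upper[OF Z] I_def by simp
    qed measurable
    then show False using le unfolding nn_integral_upper[OF X] nn_integral_upper[OF Z] I_def by simp
  qed
  then have good: "AE t in lborel. 0 \<le> t \<longrightarrow> I X t = I Z t"
  proof eventually_elim
    case (elim t)
    then show ?case using upper_le[of t] I0[of Z t] unfolding I_def by (auto simp: indicator_def)
  qed
  fix a b :: real assume ab: "a < b"
  show "\<exists>t\<in>{a<..<b}. AE \<omega> in M. (t < X \<omega>) = (t < Z \<omega>)"
  \<comment> \<open>The layers say nothing about negative \<open>t\<close>, but there both upper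
    sets have probability one.\<close>
  proof (cases "b \<le> 0")
    case True
    obtain t where t: "a < t" "t < b" using dense[OF ab] by blast
    have "AE \<omega> in M. (t < X \<omega>) = (t < Z \<omega>)"
      using X0 Z0 by eventually_elim (use True t in auto)
    then show ?thesis using t by auto
  next
    case False
    have "\<exists>t\<in>{max a 0<..<b}. I X t = I Z t"
    proof (rule ccontr)
      assume ne: "\<not> ?thesis"
      have "AE t in lborel. t \<notin> {max a 0<..<b}"
        using good by eventually_elim (use ne in force)
      then have "emeasure lborel {max a 0<..<b} = 0"
        by (subst (asm) AE_iff_null_sets[symmetric]) auto
      then show False using ab False by auto
    qed
    then obtain t where t: "t \<in> {max a 0<..<b}" "I X t = I Z t" by blast
    have "AE \<omega> in M. (t < X \<omega>) = (t < Z \<omega>)"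
    proof (cases rule: upper_excess[of t])
      case 1
      then show ?thesis by eventually_elim auto
    next
      case (2 k)
      have "AE \<omega> in M. (\<xi> \<omega> - k) * (indicator (upper X t) \<omega> - indicator (upper Z t) \<omega>) = 0"
        using integral_nonneg_eq_0_iff_AE[OF 2(3,1)] 2(2) t(2) unfolding I_def by simp
      then show ?thesis using diffuse[of k] AE_space
        by eventually_elim (auto simp: indicator_def split: if_splits)
    qed
    then show ?thesis using t by auto
  qed
qed

end

end

section \<open>Quantiles and extended integrals\<close>

lemma qfun_extensional:
  assumes "R \<in> extensional {0<..<1}" "mono_on {0<..<1} R" "\<And>x. x \<in> {0<..<1} \<Longrightarrow> 0 \<le> R x"
  shows "qfun R"
proof -
  have [measurable]: "(\<lambda>x. indicator {0<..<1} x * R x) \<in> borel_measurable borel"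
    by (rule borel_measurable_indicator_mono_on[OF assms(2)]) auto
  have "R = (\<lambda>x. indicator {0<..<1} x * R x + indicator (- {0<..<1}) x * undefined)"
    using assms(1) by (auto simp: fun_eq_iff indicator_def extensional_def)
  moreover have "\<dots> \<in> borel_measurable borel" by measurable
  ultimately have "R \<in> borel_measurable borel" by simp
  then show ?thesis using assms by (auto simp: qfun_def)
qed

text \<open>The two conditions leave \<open>x = c\<close>, a null set, undecided. This is exactly
  what the strict inequality in \<open>quantile_le\<close> and the weak one in
  \<open>le_dist_fun\<close> deliver.\<close>

lemma level_eqI:
  assumes "qfun R" and "c \<in> {0..1}"
    and "\<And>x. x \<in> {0<..<1} \<Longrightarrow> x < c \<Longrightarrow> R x \<le> t" "\<And>x. x \<in> {0<..<1} \<Longrightarrow> R x \<le> t \<Longrightarrow> x \<le> c"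
  shows "level R t = c"
proof -
  note [measurable] = qfun_measurable[OF assms(1)]
  have "level R t = measure unif {..c}"
    unfolding level_def
  proof (rule unif.finite_measure_eq_AE)
    show "AE x in unif. (x \<in> {x. R x \<le> t}) = (x \<in> {..c})"
      using AE_unif_in AE_unif_neq[of c]
    proof eventually_elim
      case (elim x)
      then show ?case using assms(3,4)[OF elim(1)] by (cases x c rule: linorder_cases) auto
    qed
  qed measurable
  also have "\<dots> = c" by (rule measure_unif_Iic[OF assms(2)])
  finally show ?thesis .
qed

lemma distr_unif_eqI:
  assumes N: "real_distribution N" and R: "qfun R" and "\<And>t. cdf N t = level R t"
  shows "distr unif borel R = N"
proof (rule cdf_unique[OF _ N])
  note [measurable] = qfun_measurable[OF R]
  have m: "R \<in> borel_measurable unif" by measurable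
  then show "real_distribution (distr unif borel R)" by (rule unif.real_distribution_distr)
  have "cdf (distr unif borel R) t = level R t" for t
    unfolding cdf_def level_def using m by (subst measure_distr) (auto simp: vimage_def)
  then show "cdf (distr unif borel R) = cdf N" using assms(3) by (simp add: fun_eq_iff)
qed

text \<open>Carries the extended objective for \<open>u\<close> over to the nonnegative integral of
  \<open>v\<close>, including infinite values. Subtraction is postponed: an identity between
  positive and negative parts is integrated first, and only the finite terms are cancelled.\<close>

lemma ext_integral_shift:
  assumes "prob_space P" and h [measurable]: "h \<in> borel_measurable P" and h0: "\<And>x. 0 \<le> h x"
    and f: "AE x in P. f x = h x + c"
  shows "ext_integral P f = enn2ereal (\<integral>\<^sup>+x. ennreal (h x) \<partial>P) + ereal c"
proof -
  interpret P: prob_space P by fact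
  define A where "A = (\<integral>\<^sup>+x. ennreal (h x + c) \<partial>P)"
  define B where "B = (\<integral>\<^sup>+x. ennreal (- (h x + c)) \<partial>P)"
  define H where "H = (\<integral>\<^sup>+x. ennreal (h x) \<partial>P)"
  have "(\<integral>\<^sup>+x. ennreal (f x) \<partial>P) = A" "(\<integral>\<^sup>+x. ennreal (- f x) \<partial>P) = B"
    unfolding A_def B_def using f by (auto intro!: nn_integral_cong_AE elim!: eventually_mono)
  then have ext: "ext_integral P f = enn2ereal A - enn2ereal B" by (simp add: ext_integral_def)
  \<comment> \<open>With \<open>ennreal\<close> as positive part this is the identity
    \<open>h + c = (h + c)\<close> with every negative part moved to the opposite side.\<close>
  have point: "ennreal (h x + c) + ennreal (- c) = ennreal (h x) + ennreal c + ennreal (- (h x + c))" for x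
  proof (cases "0 \<le> c")
    case True
    then show ?thesis using h0[of x] by (simp add: ennreal_neg ennreal_plus)
  next
    case c: False
    show ?thesis
    proof (cases "0 \<le> h x + c")
      case True
      have "ennreal (h x + c) + ennreal (- c) = ennreal (h x + c + - c)"
        using True c by (intro ennreal_plus[symmetric]) auto
      then show ?thesis using c True by (simp add: ennreal_neg)
    next
      case False
      have "ennreal (h x) + ennreal (- (h x + c)) = ennreal (h x + - (h x + c))"
        using False h0[of x] by (intro ennreal_plus[symmetric]) auto
      then show ?thesis using c False by (simp add: ennreal_neg)
    qed
  qed
  have "A + ennreal (- c) = (\<integral>\<^sup>+x. ennreal (h x + c) + ennreal (- c) \<partial>P)"
  proof -
    have "(\<integral>\<^sup>+x. ennreal (h x + c) + ennreal (- c) \<partial>P) = A + (\<integral>\<^sup>+x. ennreal (- c) \<partial>P)"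
      unfolding A_def by (rule nn_integral_add) measurable
    then show ?thesis by (simp add: P.emeasure_space_1)
  qed
  also have "\<dots> = H + ennreal c + B"
  proof -
    have "(\<integral>\<^sup>+x. ennreal (h x) + ennreal c + ennreal (- (h x + c)) \<partial>P)
        = (\<integral>\<^sup>+x. ennreal (h x) + ennreal c \<partial>P) + B"
      unfolding B_def by (rule nn_integral_add) measurable
    moreover have "(\<integral>\<^sup>+x. ennreal (h x) + ennreal c \<partial>P) = H + (\<integral>\<^sup>+x. ennreal c \<partial>P)"
      unfolding H_def by (rule nn_integral_add) measurable
    ultimately show ?thesis by (simp add: point P.emeasure_space_1)
  qed
  finally have eq: "A + ennreal (- c) = H + ennreal c + B" .
  \<comment> \<open>Since \<open>h \<ge> 0\<close>, the negative part is at most that of the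
    constant \<open>c\<close>, hence finite.\<close>
  have "B \<le> (\<integral>\<^sup>+x. ennreal (- c) \<partial>P)"
    unfolding B_def using h0 by (intro nn_integral_mono ennreal_leI) auto
  then have "B \<le> ennreal (- c)" by (simp add: P.emeasure_space_1)
  then obtain b where b: "B = ennreal b" "0 \<le> b" by (cases B) (auto simp: top_unique)
  show ?thesis
  proof (cases H)
    case real
    then obtain r where r: "H = ennreal r" "0 \<le> r" by auto
    have "A + ennreal (- c) \<noteq> \<top>" unfolding eq r b by simp
    then have "A \<noteq> \<top>" by auto
    then obtain a where a: "A = ennreal a" "0 \<le> a" by (cases A) auto
    have m: "ennreal y = ennreal (max 0 y)" for y by (simp add: max_def ennreal_neg)
    have "ennreal (a + max 0 (- c)) = A + ennreal (- c)"
      unfolding a(1) m[of "- c"] using a(2) by (intro ennreal_plus) auto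
    also have "\<dots> = ennreal r + ennreal (max 0 c) + ennreal b"
      unfolding eq b(1) r(1) m[of c] ..
    also have "\<dots> = ennreal (r + max 0 c) + ennreal b"
      using r(2) by (subst ennreal_plus) auto
    also have "\<dots> = ennreal (r + max 0 c + b)"
      using r(2) b(2) by (intro ennreal_plus[symmetric]) auto
    finally have "a + max 0 (- c) = r + max 0 c + b"
      using a(2) b(2) r(2) by (subst (asm) ennreal_inj) auto
    moreover have "max 0 c - max 0 (- c) = c" by (simp add: max_def)
    ultimately have "a - b = r + c" by linarith
    moreover have "enn2ereal A - enn2ereal B = ereal (a - b)" using a b by simp
    moreover have "enn2ereal H + ereal c = ereal (r + c)" using r by simp
    ultimately show ?thesis unfolding ext H_def[symmetric] by simp
  next
    case top
    then have "A + ennreal (- c) = \<top>" using eq by simp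
    then have "A = \<top>" by simp
    then show ?thesis unfolding ext H_def[symmetric] using top b by simp
  qed
qed

section \<open>Distribution functions and their right-continuous inverses\<close>

context prob_space
begin

context
  fixes X :: "'a \<Rightarrow> real"
  assumes X [measurable]: "X \<in> borel_measurable M"
begin

abbreviation (input) F :: "real \<Rightarrow> real" where "F \<equiv> dist_fun M X"
abbreviation (input) q :: "real \<Rightarrow> real" where "q \<equiv> quantile M X"

interpretation D: real_distribution "distr M borel X" by (rule real_distribution_distr) fact

lemma dist_fun_prob: "F t = prob {\<omega> \<in> space M. X \<omega> \<le> t}"
  unfolding cdf_def by (subst measure_distr) (auto simp: vimage_def Int_def conj_commute)

lemma dist_fun_bounds: "F t \<in> {0..1}"
  unfolding dist_fun_prob by simp

lemma dist_fun_mono: "s \<le> t \<Longrightarrow> F s \<le> F t"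
  by (rule D.cdf_nondecreasing)

lemma quantile_eq: "x \<in> {0<..<1} \<Longrightarrow> q x = Sup {t. F t \<le> x}"
  by (simp add: quantile_def)

lemma sublevel_nonempty: "x \<in> {0<..<1} \<Longrightarrow> {t. F t \<le> x} \<noteq> {}"
proof -
  assume x: "x \<in> {0<..<1}"
  have "\<forall>\<^sub>F t in at_bot. F t < x"
    by (rule order_tendstoD(2)[OF D.cdf_lim_at_bot]) (use x in auto)
  then obtain t where "F t < x" using eventually_at_bot_linorder by (metis order_refl)
  then show ?thesis by (auto intro: less_imp_le)
qed

lemma sublevel_bdd: "x \<in> {0<..<1} \<Longrightarrow> bdd_above {t. F t \<le> x}"
proof -
  assume x: "x \<in> {0<..<1}"
  have "\<forall>\<^sub>F t in at_top. x < F t"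
    by (rule order_tendstoD(1)[OF D.cdf_lim_at_top_prob]) (use x in auto)
  then obtain t where "x < F t" using eventually_at_top_linorder by (metis order_refl)
  have "s \<le> t" if "F s \<le> x" for s
    using \<open>x < F t\<close> that dist_fun_mono[of t s] by (cases "s \<le> t") auto
  then show ?thesis by (intro bdd_aboveI[of _ t]) auto
qed

lemma le_quantile: "x \<in> {0<..<1} \<Longrightarrow> F t \<le> x \<Longrightarrow> t \<le> q x"
  by (subst quantile_eq) (auto intro!: cSup_upper sublevel_bdd)

lemma quantile_le: "x \<in> {0<..<1} \<Longrightarrow> x < F t \<Longrightarrow> q x \<le> t"
proof -
  assume x: "x \<in> {0<..<1}" and lt: "x < F t"
  have "s \<le> t" if "F s \<le> x" for s
    using lt that dist_fun_mono[of t s] by (cases "s \<le> t") auto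
  then show ?thesis unfolding quantile_eq[OF x] using sublevel_nonempty[OF x] by (intro cSup_least) auto
qed

lemma le_dist_fun:
  assumes x: "x \<in> {0<..<1}" and le: "q x \<le> t"
  shows "x \<le> F t"
proof -
  have "(F \<longlongrightarrow> F t) (at_right t)"
    using D.cdf_is_right_cont[of t] by (simp add: continuous_within)
  moreover have "\<forall>\<^sub>F s in at_right t. x \<le> F s"
  proof (rule eventually_at_rightI[of t "t + 1"])
    fix s assume "s \<in> {t<..<t + 1}"
    then show "x \<le> F s" using le_quantile[OF x, of s] le by (cases "F s \<le> x") auto
  qed simp
  ultimately show ?thesis by (rule tendsto_lowerbound) simp
qed

lemma quantile_mono: "mono_on {0<..<1} q"
proof (rule mono_onI)
  fix x y :: real assume x: "x \<in> {0<..<1}" and y: "y \<in> {0<..<1}" and "x \<le> y"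
  then show "q x \<le> q y"
    using sublevel_nonempty[OF x] sublevel_bdd[OF y]
    by (subst (1 2) quantile_eq) (auto intro!: cSup_subset_mono)
qed

lemma qfun_quantile:
  assumes "AE \<omega> in M. 0 \<le> X \<omega>"
  shows "qfun q"
proof (rule qfun_extensional)
  show "q \<in> extensional {0<..<1}" by (simp add: quantile_def)
  fix x :: real assume x: "x \<in> {0<..<1}"
  have "t \<le> q x" if "t < 0" for t
  proof (rule le_quantile[OF x])
    have "AE \<omega> in M. \<not> X \<omega> \<le> t" using assms by eventually_elim (use that in auto)
    then have "F t = 0" unfolding dist_fun_prob by (subst prob_Collect_eq_0) auto
    then show "F t \<le> x" using x by simp
  qed
  then show "0 \<le> q x" by (metis dense not_less)
qed (rule quantile_mono)

lemma level_quantile: "AE \<omega> in M. 0 \<le> X \<omega> \<Longrightarrow> level q t = F t"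
  using level_eqI[OF qfun_quantile dist_fun_bounds, of t t] quantile_le le_dist_fun by blast

lemma distr_quantile: "AE \<omega> in M. 0 \<le> X \<omega> \<Longrightarrow> distr unif borel q = distr M borel X"
  by (intro distr_unif_eqI D.real_distribution_axioms qfun_quantile) (simp_all add: level_quantile)

end
end

section \<open>The pricing kernel and the distorted scale\<close>

text \<open>These rules would rewrite \<open>unif\<close> to Lebesgue measure before the facts about \<open>unif\<close> can apply.\<close>

declare measure_uniform_measure [simp del] emeasure_uniform_measure [simp del]

lemma distr_unif_reflect: "distr unif borel (\<lambda>x. 1 - x) = unif"
proof -
  have N: "real_distribution (distr unif borel (\<lambda>x::real. 1 - x))"
    by (rule unif.real_distribution_distr) simp
  have id: "qfun (\<lambda>x. x)" by (auto simp: qfun_def mono_on_def)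
  have c: "cdf (distr unif borel (\<lambda>x. 1 - x)) t = measure unif {1 - t..}" for t :: real
    unfolding cdf_def by (subst measure_distr) (auto intro!: arg_cong[where f = "measure unif"])
  have Ici: "measure unif {1 - x..} = x" if "x \<in> {0..1}" for x :: real
  proof -
    have "emeasure unif {1 - x..} = emeasure unif {1 - x<..}"
      by (rule emeasure_eq_AE) (use AE_unif_neq[of "1 - x"] in \<open>auto elim!: eventually_mono\<close>)
    also have "\<dots> = ennreal x" using emeasure_unif_Ioi[of "1 - x"] that by simp
    finally show ?thesis using that by (simp add: measure_def)
  qed
  have "distr unif borel (\<lambda>x. x) = distr unif borel (\<lambda>x::real. 1 - x)"
  proof (rule distr_unif_eqI[OF N id])
    fix t
    have m: "measure unif {1 - s..} \<le> measure unif {1 - s'..}" if "s \<le> s'" for s s' :: real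
      using that by (intro unif.finite_measure_mono) auto
    have "level (\<lambda>x. x) t = measure unif {1 - t..}"
    proof (rule level_eqI[OF id])
      show "measure unif {1 - t..} \<in> {0..1}" by (simp add: unif.prob_le_1)
      fix x :: real assume x: "x \<in> {0<..<1}"
      show "x \<le> measure unif {1 - t..}" if "x \<le> t" using m[OF that] Ici[of x] x by simp
      show "x \<le> t" if lt: "x < measure unif {1 - t..}"
      proof (rule ccontr)
        assume "\<not> x \<le> t"
        then have "measure unif {1 - t..} \<le> x" using m[of t x] Ici[of x] x by simp
        then show False using lt by simp
      qed
    qed
    then show "cdf (distr unif borel (\<lambda>x. 1 - x)) t = level (\<lambda>x. x) t" using c by simp
  qed
  moreover have "distr unif borel (\<lambda>x. x) = unif" by (rule distr_id2) simp
  ultimately show ?thesis by simp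
qed

lemma distr_unif_reflect_rv:
  assumes "U \<in> borel_measurable M" "distr M borel U = unif"
  shows "distr M borel (\<lambda>\<omega>. 1 - U \<omega>) = unif"
proof -
  have "distr M borel (\<lambda>\<omega>. 1 - U \<omega>) = distr (distr M borel U) borel (\<lambda>x. 1 - x)"
    using assms(1) by (subst distr_distr) (auto simp: comp_def)
  then show ?thesis unfolding assms(2) distr_unif_reflect .
qed

context prob_space
begin

context
  fixes X :: "'a \<Rightarrow> real"
  assumes X [measurable]: "X \<in> borel_measurable M"
    and cont: "continuous_on UNIV (dist_fun M X)"
begin

interpretation D: real_distribution "distr M borel X" by (rule real_distribution_distr) fact

abbreviation (input) FX :: "real \<Rightarrow> real" where "FX \<equiv> dist_fun M X"
abbreviation (input) qX :: "real \<Rightarrow> real" where "qX \<equiv> quantile M X"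

text \<open>Below the quantile the distribution function is at most \<open>x\<close>; continuity
  rules out a jump across \<open>x\<close>.\<close>

lemma dist_fun_quantile:
  assumes x: "x \<in> {0<..<1}"
  shows "FX (qX x) = x"
proof (rule antisym)
  have "isCont FX (qX x)" using cont by (simp add: continuous_on_eq_continuous_at)
  then have "(FX \<longlongrightarrow> FX (qX x)) (at_left (qX x))"
    unfolding isCont_def by (rule filterlim_mono) (auto intro: at_le)
  moreover have "\<forall>\<^sub>F t in at_left (qX x). FX t \<le> x"
  proof (rule eventually_at_leftI[of "qX x - 1"])
    fix t assume "t \<in> {qX x - 1<..<qX x}"
    then show "FX t \<le> x" using quantile_le[OF X x, of t] by (cases "FX t \<le> x") auto
  qed simp
  ultimately show "FX (qX x) \<le> x" by (rule tendsto_upperbound) simp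
  show "x \<le> FX (qX x)" by (rule le_dist_fun[OF X x]) simp
qed

lemma dist_fun_le_iff: "x \<in> {0<..<1} \<Longrightarrow> FX t \<le> x \<longleftrightarrow> t \<le> qX x"
  using le_quantile[OF X] dist_fun_quantile dist_fun_mono[OF X, of t "qX x"] by fastforce

lemma borel_measurable_dist_fun [measurable]: "FX \<in> borel_measurable borel"
  using cont by (rule borel_measurable_continuous_onI)

text \<open>The probability integral transform. The distribution function is computed only inside
  the unit interval; monotonicity covers the remaining \<open>t\<close>.\<close>

lemma distr_dist_fun: "distr M borel (\<lambda>\<omega>. FX (X \<omega>)) = unif"
proof -
  have N: "real_distribution (distr M borel (\<lambda>\<omega>. FX (X \<omega>)))"
    by (rule real_distribution_distr) measurable
  have id: "qfun (\<lambda>x. x)" by (auto simp: qfun_def mono_on_def)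
  define G where "G = (\<lambda>t. prob {\<omega> \<in> space M. FX (X \<omega>) \<le> t})"
  have c: "cdf (distr M borel (\<lambda>\<omega>. FX (X \<omega>))) t = G t" for t
    unfolding cdf_def[of "distr M borel (\<lambda>\<omega>. FX (X \<omega>))"] G_def
    by (subst measure_distr) (auto simp: vimage_def Int_def conj_commute)
  have G: "G x = x" if "x \<in> {0<..<1}" for x
    unfolding G_def dist_fun_le_iff[OF that] dist_fun_prob[OF X, symmetric] by (rule dist_fun_quantile[OF that])
  have m: "G s \<le> G s'" if "s \<le> s'" for s s'
    unfolding G_def using that by (intro finite_measure_mono) auto
  have "distr unif borel (\<lambda>x. x) = distr M borel (\<lambda>\<omega>. FX (X \<omega>))"
  proof (rule distr_unif_eqI[OF N id])
    fix t
    have "level (\<lambda>x. x) t = G t"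
    proof (rule level_eqI[OF id])
      show "G t \<in> {0..1}" by (simp add: G_def)
      fix x :: real assume x: "x \<in> {0<..<1}"
      show "x \<le> G t" if "x \<le> t" using m[OF that] G[OF x] by simp
      show "x \<le> t" if lt: "x < G t" using m[of t x] G[OF x] lt by (cases "x \<le> t") auto
    qed
    then show "cdf (distr M borel (\<lambda>\<omega>. FX (X \<omega>))) t = level (\<lambda>x. x) t" using c by simp
  qed
  moreover have "distr unif borel (\<lambda>x. x) = unif" by (rule distr_id2) simp
  ultimately show ?thesis by simp
qed

lemma AE_dist_fun:
  assumes "AE x in unif. Q x"
  shows "AE \<omega> in M. Q (FX (X \<omega>))"
proof (rule AE_distrD[of "\<lambda>\<omega>. FX (X \<omega>)" M borel Q])
  show "AE x in distr M borel (\<lambda>\<omega>. FX (X \<omega>)). Q x" unfolding distr_dist_fun by (rule assms)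
qed measurable

lemma AE_neq: "AE \<omega> in M. X \<omega> \<noteq> k"
proof -
  have "isCont FX k" using cont by (simp add: continuous_on_eq_continuous_at)
  then have "measure (distr M borel X) {k} = 0" by (simp add: D.isCont_cdf)
  then have "prob {\<omega> \<in> space M. X \<omega> = k} = 0"
    by (simp add: measure_distr vimage_def Int_def conj_commute)
  then show ?thesis by (subst (asm) prob_Collect_eq_0) auto
qed

text \<open>On a flat stretch of the distribution function the inverse overshoots, so in general
  only \<open>X \<le> qX (FX X)\<close> holds. Both sides have the same law, however, and nested
  upper sets of equal probability agree almost surely.\<close>

lemma quantile_dist_fun:
  assumes pos: "AE \<omega> in M. 0 \<le> X \<omega>"
  shows "AE \<omega> in M. qX (FX (X \<omega>)) = X \<omega>"
proof (rule AE_eq_if_upper_sets_eq)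
  fix a b :: real assume "a < b"
  then obtain t where t: "t \<in> {a<..<b}" using dense by auto
  note [measurable] = qfun_measurable[OF qfun_quantile[OF X pos]]
  define A where "A = {\<omega> \<in> space M. t < X \<omega>}"
  define B where "B = {\<omega> \<in> space M. t < qX (FX (X \<omega>))}"
  have [measurable]: "A \<in> events" "B \<in> events" unfolding A_def B_def by measurable
  have "distr M borel (\<lambda>\<omega>. qX (FX (X \<omega>))) = distr (distr M borel (\<lambda>\<omega>. FX (X \<omega>))) borel qX"
    by (subst distr_distr) (auto simp: comp_def)
  also have "\<dots> = distr M borel X"
    unfolding distr_dist_fun by (rule distr_quantile[OF X pos])
  finally have "measure (distr M borel (\<lambda>\<omega>. qX (FX (X \<omega>)))) {t<..} = measure (distr M borel X) {t<..}"
    by simp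
  then have eq: "prob A = prob B"
    unfolding A_def B_def by (simp add: measure_distr vimage_def Int_def conj_commute)
  have "AE \<omega> in M. \<omega> \<notin> A - B"
    using AE_dist_fun[OF AE_unif_in]
  proof eventually_elim
    case (elim \<omega>)
    then have "X \<omega> \<le> qX (FX (X \<omega>))" using dist_fun_le_iff by blast
    then show ?case unfolding A_def B_def by auto
  qed
  then have "prob (A - B) = 0" by (simp add: prob_eq_0)
  then have "AE \<omega> in M. (\<omega> \<in> A) = (\<omega> \<in> B)"
    using eq by (intro AE_iff_if_prob_diff_eq_0) auto
  then have "AE \<omega> in M. (t < qX (FX (X \<omega>))) = (t < X \<omega>)"
    using AE_space by eventually_elim (auto simp: A_def B_def)
  then show "\<exists>t\<in>{a<..<b}. AE \<omega> in M. (t < qX (FX (X \<omega>))) = (t < X \<omega>)" using t by blast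
qed

end
end

locale pricing_model = prob_space M for M :: "'a measure" +
  fixes \<rho> :: "'a \<Rightarrow> real" and w :: "real \<Rightarrow> real"
  assumes w_cont: "continuous_on {0..1} w" and w_strict: "strict_mono_on {0..1} w"
    and w0: "w 0 = 0" and w1: "w 1 = 1"
    and \<rho>_meas [measurable]: "\<rho> \<in> borel_measurable M" and \<rho>_pos: "AE \<omega> in M. 0 < \<rho> \<omega>"
    and \<rho>_int: "integrable M \<rho>" and \<rho>_cont: "continuous_on UNIV (dist_fun M \<rho>)"
begin

abbreviation "F\<rho> \<equiv> dist_fun M \<rho>"
abbreviation "wi \<equiv> inv_into {0..1} w"

text \<open>\<open>P\<close> is uniform and runs against \<rho>. The functions \<open>psi\<close>
  and \<open>nu\<close> are inverse to each other on the unit interval, and \<open>V\<close> is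
  \<open>psi\<close> applied to \<open>P\<close>: quantiles read at \<open>P\<close> belong to (E),
  those read at \<open>V\<close> to (R).\<close>

definition P :: "'a \<Rightarrow> real" where "P \<omega> = 1 - F\<rho> (\<rho> \<omega>)"
definition psi :: "real \<Rightarrow> real" where "psi y = 1 - w (1 - y)"
definition nu :: "real \<Rightarrow> real" where "nu x = 1 - wi (1 - x)"
definition V :: "'a \<Rightarrow> real" where "V \<omega> = 1 - w (F\<rho> (\<rho> \<omega>))"

lemma w_le: "a \<in> {0..1} \<Longrightarrow> b \<in> {0..1} \<Longrightarrow> w a \<le> w b \<longleftrightarrow> a \<le> b"
  using strict_mono_onD[OF w_strict, of a b] strict_mono_onD[OF w_strict, of b a]
  by (cases a b rule: linorder_cases) auto

lemma w_image: "w ` {0..1} = {0..1}"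
proof
  show "w ` {0..1} \<subseteq> {0..1}" using w_le[of 0] w_le[of _ 1] w0 w1 by auto
  show "{0..1} \<subseteq> w ` {0..1}"
    using IVT'[of w 0 _ 1] w_cont w0 w1 by force
qed

lemma wi_w: "y \<in> {0..1} \<Longrightarrow> wi (w y) = y"
  using w_strict by (intro inv_into_f_f strict_mono_on_imp_inj_on)

lemma w_wi: "x \<in> {0..1} \<Longrightarrow> w (wi x) = x" "x \<in> {0..1} \<Longrightarrow> wi x \<in> {0..1}"
  using w_image by (metis f_inv_into_f, metis inv_into_into)

lemma psi_le: "a \<in> {0..1} \<Longrightarrow> b \<in> {0..1} \<Longrightarrow> psi a \<le> psi b \<longleftrightarrow> a \<le> b"
  unfolding psi_def using w_le[of "1 - b" "1 - a"] by auto

lemma psi_less: "a \<in> {0..1} \<Longrightarrow> b \<in> {0..1} \<Longrightarrow> psi a < psi b \<longleftrightarrow> a < b"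
  using psi_le[of b a] by linarith

lemma psi_01 [simp]: "psi 0 = 0" "psi 1 = 1" by (simp_all add: psi_def w0 w1)

lemma psi_in: "a \<in> {0..1} \<Longrightarrow> psi a \<in> {0..1}"
  using psi_le[of 0 a] psi_le[of a 1] by simp

lemma psi_in_open: "a \<in> {0<..<1} \<Longrightarrow> psi a \<in> {0<..<1}"
  using psi_less[of 0 a] psi_less[of a 1] by simp

lemma nu_psi: "y \<in> {0..1} \<Longrightarrow> nu (psi y) = y"
  unfolding psi_def nu_def using wi_w[of "1 - y"] by simp

lemma psi_nu: "x \<in> {0..1} \<Longrightarrow> psi (nu x) = x" "x \<in> {0..1} \<Longrightarrow> nu x \<in> {0..1}"
  unfolding psi_def nu_def using w_wi[of "1 - x"] by auto

lemma nu_in_open: "x \<in> {0<..<1} \<Longrightarrow> nu x \<in> {0<..<1}"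
  using psi_nu[of x] psi_01 by (auto simp: less_le)

lemma nu_le_iff: "x \<in> {0..1} \<Longrightarrow> y \<in> {0..1} \<Longrightarrow> nu x \<le> y \<longleftrightarrow> x \<le> psi y"
  using psi_le[of "nu x" y] psi_nu[of x] by simp

lemma nu_less_iff: "x \<in> {0..1} \<Longrightarrow> y \<in> {0..1} \<Longrightarrow> nu x < y \<longleftrightarrow> x < psi y"
  using psi_less[of "nu x" y] psi_nu[of x] by simp

lemma nu_mono: "x \<in> {0..1} \<Longrightarrow> y \<in> {0..1} \<Longrightarrow> x \<le> y \<Longrightarrow> nu x \<le> nu y"
  using nu_le_iff[of x "nu y"] psi_nu[of y] by simp

lemma P_bounds: "P \<omega> \<in> {0..1}"
  unfolding P_def using dist_fun_bounds[OF \<rho>_meas, of "\<rho> \<omega>"] by auto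

lemma P_measurable [measurable]: "P \<in> borel_measurable M"
proof -
  note [measurable] = borel_measurable_dist_fun[OF \<rho>_meas \<rho>_cont]
  show ?thesis unfolding P_def by measurable
qed

lemma V_eq: "V \<omega> = psi (P \<omega>)"
  unfolding V_def psi_def P_def by simp

lemma psi_measurable [measurable]: "(\<lambda>y. psi (max 0 (min 1 y))) \<in> borel_measurable borel"
proof (rule borel_measurable_mono, rule monoI)
  fix x y :: real assume "x \<le> y"
  then show "psi (max 0 (min 1 x)) \<le> psi (max 0 (min 1 y))" by (subst psi_le) auto
qed

lemma V_measurable [measurable]: "V \<in> borel_measurable M"
proof -
  have "max 0 (min 1 (P \<omega>)) = P \<omega>" for \<omega> using P_bounds[of \<omega>] by auto
  then have "V = (\<lambda>\<omega>. psi (max 0 (min 1 (P \<omega>))))" by (simp add: fun_eq_iff V_eq)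
  moreover have "\<dots> \<in> borel_measurable M" by measurable
  ultimately show ?thesis by simp
qed

lemma distr_P: "distr M borel P = unif"
proof -
  note [measurable] = borel_measurable_dist_fun[OF \<rho>_meas \<rho>_cont]
  show ?thesis unfolding P_def[abs_def]
    by (rule distr_unif_reflect_rv[OF _ distr_dist_fun[OF \<rho>_meas \<rho>_cont]]) measurable
qed

lemma AE_P:
  assumes "AE x in unif. Q x"
  shows "AE \<omega> in M. Q (P \<omega>)"
proof (rule AE_distrD[of P M borel Q])
  show "AE x in distr M borel P. Q x" unfolding distr_P by (rule assms)
qed measurable

lemma P_in: "AE \<omega> in M. P \<omega> \<in> {0<..<1}"
  by (rule AE_P[OF AE_unif_in])

lemma V_in: "AE \<omega> in M. V \<omega> \<in> {0<..<1}"
  using P_in by eventually_elim (simp only: V_eq psi_in_open)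

lemma V_neq: "AE \<omega> in M. V \<omega> \<noteq> c"
proof (cases "c \<in> {0..1}")
  case True
  show ?thesis using AE_P[OF AE_unif_neq[of "nu c"]]
    by eventually_elim (use nu_psi P_bounds V_eq in metis)
next
  case False
  show ?thesis using V_in by eventually_elim (use False in auto)
qed

lemma nn_integral_P:
  assumes [measurable]: "H \<in> borel_measurable borel"
  shows "(\<integral>\<^sup>+\<omega>. H (P \<omega>) \<partial>M) = (\<integral>\<^sup>+x. H x \<partial>unif)"
  unfolding distr_P[symmetric] by (subst nn_integral_distr) auto

text \<open>The inverse image under \<open>psi\<close> is a nondegenerate interval for the uniform
  \<open>P\<close>. That \<open>V\<close> charges every interval gives the strict increase of
  \<open>phi\<close> and the uniqueness of the quantile function in part (2).\<close>

lemma prob_V: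
  assumes "0 \<le> x" "x < y" "y \<le> 1"
  shows "0 < prob {\<omega> \<in> space M. x < V \<omega> \<and> V \<omega> \<le> y}"
proof -
  have xy: "x \<in> {0..1}" "y \<in> {0..1}" using assms by auto
  have "{\<omega> \<in> space M. x < V \<omega> \<and> V \<omega> \<le> y} = P -` {nu x<..nu y} \<inter> space M"
  proof -
    have "x < V \<omega> \<longleftrightarrow> nu x < P \<omega>" "V \<omega> \<le> y \<longleftrightarrow> P \<omega> \<le> nu y" for \<omega>
      using psi_less[of "nu x" "P \<omega>"] psi_le[of "P \<omega>" "nu y"] psi_nu xy P_bounds[of \<omega>] by (simp_all add: V_eq)
    then show ?thesis by auto
  qed
  then have "prob {\<omega> \<in> space M. x < V \<omega> \<and> V \<omega> \<le> y} = measure unif {nu x<..nu y}"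
    unfolding distr_P[symmetric] by (subst measure_distr) auto
  also have "\<dots> = measure unif {..nu y} - measure unif {..nu x}"
  proof -
    have "nu x \<le> nu y" using nu_mono xy assms by simp
    then have "{nu x<..nu y} = {..nu y} - {..nu x}" "{..nu x} \<subseteq> {..nu y}" by auto
    then show ?thesis by (simp only:) (subst unif.finite_measure_Diff, auto)
  qed
  also have "\<dots> = nu y - nu x" using psi_nu(2) xy by (simp only: measure_unif_Iic)
  also have "\<dots> > 0" using nu_less_iff[of x "nu y"] psi_nu xy assms by simp
  finally show ?thesis .
qed

end

section \<open>From random variables to quantiles\<close>

lemma admissible_iff:
  assumes \<xi> [measurable]: "\<xi> \<in> borel_measurable M" and \<xi>0: "AE \<omega> in M. 0 \<le> \<xi> \<omega>" and "0 \<le> x0"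
  shows "Y \<in> admissible M \<xi> x0 \<longleftrightarrow> Y \<in> borel_measurable M \<and> (AE \<omega> in M. 0 \<le> Y \<omega>) \<and>
    (\<integral>\<^sup>+\<omega>. ennreal (\<xi> \<omega>) * ennreal (Y \<omega>) \<partial>M) = ennreal x0"
proof (cases "Y \<in> borel_measurable M \<and> (AE \<omega> in M. 0 \<le> Y \<omega>)")
  case True
  then have [measurable]: "Y \<in> borel_measurable M" and Y0: "AE \<omega> in M. 0 \<le> Y \<omega>" by auto
  have nn: "AE \<omega> in M. 0 \<le> \<xi> \<omega> * Y \<omega>" using \<xi>0 Y0 by eventually_elim simp
  have "(\<integral>\<^sup>+\<omega>. ennreal (\<xi> \<omega>) * ennreal (Y \<omega>) \<partial>M) = (\<integral>\<^sup>+\<omega>. ennreal (\<xi> \<omega> * Y \<omega>) \<partial>M)"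
    by (rule nn_integral_cong_AE) (use \<xi>0 Y0 in eventually_elim, simp add: ennreal_mult)
  then show ?thesis
    using True assms(3) nn nn_integral_eq_integrable[of "\<lambda>\<omega>. \<xi> \<omega> * Y \<omega>" M x0]
    unfolding admissible_def by auto
qed (auto simp: admissible_def)

lemma optimal_solution_iff:
  assumes J: "\<And>Y. Y \<in> A \<Longrightarrow> J Y = enn2ereal (T Y) + ereal c"
  shows "optimal_solution J A X \<longleftrightarrow> X \<in> A \<and> (\<forall>Y\<in>A. T Y \<le> T X) \<and> T X < \<infinity>"
proof (cases "X \<in> A")
  case True
  have "J X = (SUP Y\<in>A. J Y) \<longleftrightarrow> (\<forall>Y\<in>A. J Y \<le> J X)"
    using True by (metis SUP_least SUP_upper antisym)
  moreover have "J Y \<le> J X \<longleftrightarrow> T Y \<le> T X" if "Y \<in> A" for Y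
    using J[OF that] J[OF True] by (simp add: ereal_add_le_add_iff2 less_eq_ennreal.rep_eq)
  moreover have "\<bar>J X\<bar> \<noteq> \<infinity> \<longleftrightarrow> T X < \<infinity>"
    using J[OF True] by (cases "T X") auto
  ultimately show ?thesis using True unfolding optimal_solution_def by auto
qed (simp add: optimal_solution_def)

section \<open>The pricing measure, the modified kernel and rearranged variables\<close>

context pricing_model
begin

text \<open>As the image under \<open>V\<close> of the measure with density \<rho>, it turns the
  expected price of \<open>Q\<close> at \<open>V\<close> into an integral of \<open>Q\<close>
  without a change of variables through the derivative of \<open>nu\<close>.\<close>

definition N :: "real measure" where "N = distr (density M (\<lambda>\<omega>. ennreal (\<rho> \<omega>))) borel V"

abbreviation "q\<rho> \<equiv> quantile M \<rho>"

lemma \<rho>_nonneg: "AE \<omega> in M. 0 \<le> \<rho> \<omega>"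
  using \<rho>_pos by eventually_elim simp

lemma nn_integral_N:
  assumes [measurable]: "H \<in> borel_measurable borel"
  shows "(\<integral>\<^sup>+x. H x \<partial>N) = (\<integral>\<^sup>+\<omega>. ennreal (\<rho> \<omega>) * H (V \<omega>) \<partial>M)"
  unfolding N_def by (subst nn_integral_distr) (auto simp: nn_integral_density)

lemma diffuse_N: "diffuse N"
proof (intro diffuse.intro finite_measureI)
  have "(\<integral>\<^sup>+\<omega>. ennreal (\<rho> \<omega>) \<partial>M) \<noteq> \<infinity>"
    using nn_integral_eq_integral[OF \<rho>_int \<rho>_nonneg] by simp
  then show "emeasure N (space N) \<noteq> \<infinity>"
    using nn_integral_N[of "\<lambda>_. 1"] by simp
  show "sets N = sets borel" by (simp add: N_def)
  show "AE x in N. x \<in> {0<..<1}"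
    unfolding N_def using V_in
    by (subst AE_distr_iff) (auto simp: AE_density simp del: greaterThanLessThan_iff elim!: eventually_mono)
  show "AE x in N. x \<noteq> c" for c
    unfolding N_def using V_neq[of c] by (subst AE_distr_iff) (auto simp: AE_density elim!: eventually_mono)
qed

sublocale N: diffuse N by (rule diffuse_N)
sublocale N: finite_measure N by (rule N.fin)

text \<open>The integral of the quantile function up to \<open>b\<close> is an expectation over the
  uniform variable \<open>F\<rho> (\<rho>)\<close>, at which that quantile function returns \<rho>
  almost surely; and \<open>F\<rho> (\<rho>) < b\<close> means \<open>c < V\<close>.\<close>

lemma phi_eq:
  assumes c: "c \<in> {0..1}"
  shows "phi M \<rho> w c = - measure N {c<..}"
proof -
  define b where "b = wi (1 - c)"
  have b: "b \<in> {0..1}" "w b = 1 - c" unfolding b_def using w_wi[of "1 - c"] c by auto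
  have q: "qfun q\<rho>" by (rule qfun_quantile[OF \<rho>_meas \<rho>_nonneg])
  note [measurable] = qfun_measurable[OF q] borel_measurable_dist_fun[OF \<rho>_meas \<rho>_cont]
  have q0: "0 \<le> q\<rho> y" if "y \<in> {0<..<1}" for y using q that by (simp add: qfun_def)
  have "(LINT y:{0<..<b}|lborel. q\<rho> y) = enn2real (\<integral>\<^sup>+y. ennreal (indicator {0<..<b} y * q\<rho> y) \<partial>lborel)"
    unfolding set_lebesgue_integral_def
    by (subst integral_eq_nn_integral) (use q0 b in \<open>auto simp: indicator_def\<close>)
  also have "(\<integral>\<^sup>+y. ennreal (indicator {0<..<b} y * q\<rho> y) \<partial>lborel)
      = (\<integral>\<^sup>+y. ennreal (q\<rho> y) * indicator {..<b} y * indicator {0<..<1} y \<partial>lborel)"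
    using b by (intro nn_integral_cong) (auto simp: indicator_def)
  also have "\<dots> = (\<integral>\<^sup>+y. ennreal (q\<rho> y) * indicator {..<b} y \<partial>unif)"
    by (rule nn_integral_unif[symmetric]) measurable
  also have "\<dots> = (\<integral>\<^sup>+\<omega>. ennreal (q\<rho> (F\<rho> (\<rho> \<omega>))) * indicator {..<b} (F\<rho> (\<rho> \<omega>)) \<partial>M)"
    unfolding distr_dist_fun[OF \<rho>_meas \<rho>_cont, symmetric] by (subst nn_integral_distr) auto
  also have "\<dots> = (\<integral>\<^sup>+\<omega>. ennreal (\<rho> \<omega>) * indicator {c<..} (V \<omega>) \<partial>M)"
  proof (rule nn_integral_cong_AE)
    have "F\<rho> (\<rho> \<omega>) < b \<longleftrightarrow> c < V \<omega>" for \<omega>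
    proof -
      have "w b \<le> w (F\<rho> (\<rho> \<omega>)) \<longleftrightarrow> b \<le> F\<rho> (\<rho> \<omega>)"
        by (rule w_le[OF b(1) dist_fun_bounds[OF \<rho>_meas]])
      then show ?thesis unfolding V_def b(2) by auto
    qed
    then show "AE \<omega> in M. ennreal (q\<rho> (F\<rho> (\<rho> \<omega>))) * indicator {..<b} (F\<rho> (\<rho> \<omega>))
        = ennreal (\<rho> \<omega>) * indicator {c<..} (V \<omega>)"
      using quantile_dist_fun[OF \<rho>_meas \<rho>_cont \<rho>_nonneg]
      by (auto elim!: eventually_mono simp: indicator_def)
  qed
  also have "\<dots> = emeasure N {c<..}"
    using nn_integral_N[of "indicator {c<..}"] by simp
  finally show ?thesis unfolding phi_def b_def measure_def by simp
qed

lemma phi_1: "phi M \<rho> w 1 = 0"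
proof -
  have "AE x in N. x \<notin> {1<..}" using N.supp by eventually_elim auto
  then have "{1<..} \<in> null_sets N" by (subst AE_iff_null_sets) simp_all
  then have "measure N {1<..} = 0" by (rule measure_eq_0_null_sets)
  then show ?thesis using phi_eq[of 1] by simp
qed

lemma N_tail: "c \<in> {0..1} \<Longrightarrow> emeasure N {c<..} = ennreal (phi M \<rho> w 1 - phi M \<rho> w c)"
  using phi_eq[of c] phi_1 by (simp add: N.emeasure_eq_measure)

text \<open>Continuity holds because \<open>N\<close> has no atoms, and strict increase because
  \<rho> is positive and \<open>V\<close> charges every interval.\<close>

sublocale H: increasing_envelope "phi M \<rho> w"
proof
  interpret B: finite_borel_measure N by unfold_locales simp
  have tail: "measure N {c<..} = measure N UNIV - cdf N c" for c
  proof -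
    have di: "{c<..} = UNIV - {..c}" by auto
    show ?thesis unfolding cdf_def di by (rule N.finite_measure_Diff) auto
  qed
  have "measure N {c} = 0" for c
  proof -
    have "AE x in N. x \<notin> {c}" using N.diffuse[of c] by eventually_elim simp
    then have "{c} \<in> null_sets N" by (subst AE_iff_null_sets) simp_all
    then show ?thesis by (rule measure_eq_0_null_sets)
  qed
  then have "continuous_on UNIV (cdf N)" by (simp add: continuous_on_eq_continuous_at B.isCont_cdf)
  then have "continuous_on {0..1} (\<lambda>c. cdf N c - measure N UNIV)"
    by (intro continuous_intros) (auto intro: continuous_on_subset)
  then show "continuous_on {0..1} (phi M \<rho> w)"
    by (rule continuous_on_eq) (simp add: phi_eq tail)
  show "strict_mono_on {0..1} (phi M \<rho> w)"
  proof (rule strict_mono_onI)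
    fix x y :: real assume x: "x \<in> {0..1}" and y: "y \<in> {0..1}" and xy: "x < y"
    have "0 < emeasure N {x<..y}"
    proof (rule ccontr)
      assume "\<not> 0 < emeasure N {x<..y}"
      then have "(\<integral>\<^sup>+\<omega>. ennreal (\<rho> \<omega>) * indicator {x<..y} (V \<omega>) \<partial>M) = 0"
        using nn_integral_N[of "indicator {x<..y}"] by (simp add: zero_less_iff_neq_zero)
      then have "AE \<omega> in M. ennreal (\<rho> \<omega>) * indicator {x<..y} (V \<omega>) = 0"
        by (subst (asm) nn_integral_0_iff_AE) auto
      then have "AE \<omega> in M. \<not> (x < V \<omega> \<and> V \<omega> \<le> y)"
        using \<rho>_pos
      proof eventually_elim
        case (elim \<omega>)
        then show ?case by (cases "x < V \<omega> \<and> V \<omega> \<le> y") simp_all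
      qed
      then have "prob {\<omega> \<in> space M. x < V \<omega> \<and> V \<omega> \<le> y} = 0"
        by (subst prob_Collect_eq_0) auto
      then show False using prob_V[of x y] x y xy by simp
    qed
    moreover have "measure N {x<..} = measure N {x<..y} + measure N {y<..}"
    proof -
      have un: "{x<..} = {x<..y} \<union> {y<..}" using xy by auto
      show ?thesis unfolding un by (rule N.finite_measure_Union) auto
    qed
    ultimately show "phi M \<rho> w x < phi M \<rho> w y"
      using phi_eq[OF x] phi_eq[OF y] by (simp add: N.emeasure_eq_measure)
  qed
qed

lemma delta'_eq: "delta' M \<rho> w = H.env'"
  by (simp add: fun_eq_iff delta'_def H.env'_def delta_def)

lemma rho_tilde_eq: "rho_tilde M \<rho> w \<omega> = H.env' (P \<omega>)"
  by (simp add: rho_tilde_def delta'_eq P_def)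

text \<open>Monotonicity controls \<open>H.env'\<close> only inside the unit interval, so the two
  end values that \<open>P\<close> may take are split off.\<close>

lemma rho_tilde_measurable [measurable]: "rho_tilde M \<rho> w \<in> borel_measurable M"
proof -
  have "rho_tilde M \<rho> w = (\<lambda>\<omega>. indicator {0<..<1} (P \<omega>) * H.env' (P \<omega>)
      + indicator {0} (P \<omega>) * H.env' 0 + indicator {1} (P \<omega>) * H.env' 1)"
  proof
    fix \<omega>
    consider "P \<omega> = 0" | "P \<omega> = 1" | "P \<omega> \<in> {0<..<1}"
      using P_bounds[of \<omega>] by fastforce
    then show "rho_tilde M \<rho> w \<omega> = indicator {0<..<1} (P \<omega>) * H.env' (P \<omega>)
      + indicator {0} (P \<omega>) * H.env' 0 + indicator {1} (P \<omega>) * H.env' 1"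
      by cases (auto simp: rho_tilde_eq)
  qed
  moreover have "\<dots> \<in> borel_measurable M"
    using measurable_compose[OF P_measurable H.env'_measurable] by measurable
  ultimately show ?thesis by simp
qed

lemma rho_tilde_nonneg: "AE \<omega> in M. 0 \<le> rho_tilde M \<rho> w \<omega>"
  using P_in by eventually_elim (simp only: rho_tilde_eq H.env'_nonneg)

lemma rho_tilde_env_density: "AE \<omega> in M. ennreal (rho_tilde M \<rho> w \<omega>) = H.env_density (P \<omega>)"
  using P_in by eventually_elim (simp add: rho_tilde_eq H.env_density_def)

lemma nn_integral_rho_tilde:
  assumes [measurable]: "H \<in> borel_measurable borel"
  shows "(\<integral>\<^sup>+\<omega>. ennreal (rho_tilde M \<rho> w \<omega>) * H (P \<omega>) \<partial>M) = (\<integral>\<^sup>+x. H.env_density x * H x \<partial>unif)"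
proof -
  have "(\<integral>\<^sup>+\<omega>. ennreal (rho_tilde M \<rho> w \<omega>) * H (P \<omega>) \<partial>M) = (\<integral>\<^sup>+\<omega>. H.env_density (P \<omega>) * H (P \<omega>) \<partial>M)"
    by (rule nn_integral_cong_AE) (use rho_tilde_env_density in eventually_elim, simp)
  then show ?thesis using nn_integral_P[of "\<lambda>x. H.env_density x * H x"] by simp
qed

lemma rho_tilde_integrable: "integrable M (rho_tilde M \<rho> w)"
proof (rule integrableI_nonneg)
  show "(\<integral>\<^sup>+\<omega>. ennreal (rho_tilde M \<rho> w \<omega>) \<partial>M) < \<infinity>"
    using nn_integral_rho_tilde[of "\<lambda>_. 1"] H.nn_integral_env_density by simp
qed (auto simp: rho_tilde_nonneg)

lemma cost_eq_expectation: "qfun R \<Longrightarrow> H.cost R = (\<integral>\<^sup>+\<omega>. ennreal (rho_tilde M \<rho> w \<omega>) * ennreal (R (P \<omega>)) \<partial>M)"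
  unfolding H.cost_def by (subst nn_integral_rho_tilde) (auto dest: qfun_measurable)

lemma price_eq_expectation: "qfun R \<Longrightarrow> (\<integral>\<^sup>+x. ennreal (R x) \<partial>N) = (\<integral>\<^sup>+\<omega>. ennreal (\<rho> \<omega>) * ennreal (R (V \<omega>)) \<partial>M)"
  by (subst nn_integral_N) (auto dest: qfun_measurable)

lemma distr_qfun_P:
  assumes R: "qfun R"
  shows "distr M borel (\<lambda>\<omega>. R (P \<omega>)) = distr unif borel R"
proof -
  note [measurable] = qfun_measurable[OF R]
  show ?thesis unfolding distr_P[symmetric] by (subst distr_distr) (auto simp: comp_def)
qed

lemma qfun_P_upper:
  assumes R: "qfun R"
  shows "(level R t = 0 \<longrightarrow> (AE \<omega> in M. t < R (P \<omega>))) \<and> (level R t = 1 \<longrightarrow> (AE \<omega> in M. \<not> t < R (P \<omega>)))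
    \<and> (AE \<omega> in M. (t < R (P \<omega>) \<longrightarrow> level R t < P \<omega>) \<and> (\<not> t < R (P \<omega>) \<longrightarrow> P \<omega> < level R t))"
proof -
  have *: "AE \<omega> in M. (t < R (P \<omega>) \<longrightarrow> level R t < P \<omega>) \<and> (\<not> t < R (P \<omega>) \<longrightarrow> P \<omega> < level R t)"
    using P_in AE_P[OF AE_unif_neq[of "level R t"]]
  proof eventually_elim
    case (elim \<omega>)
    then show ?case using level_split[OF R elim(1), of t]
      by (cases "P \<omega>" "level R t" rule: linorder_cases) auto
  qed
  moreover have "AE \<omega> in M. t < R (P \<omega>)" if "level R t = 0"
    using * P_in by eventually_elim (use that in auto)
  moreover have "AE \<omega> in M. \<not> t < R (P \<omega>)" if "level R t = 1"
    using * P_in by eventually_elim (use that in auto)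
  ultimately show ?thesis by blast
qed

lemma antimonotone_\<rho>:
  assumes R: "qfun R"
  shows "(AE \<omega> in M. t < R (P \<omega>)) \<or>
    (\<exists>k. AE \<omega> in M. (t < R (P \<omega>) \<longrightarrow> \<rho> \<omega> \<le> k) \<and> (\<not> t < R (P \<omega>) \<longrightarrow> k \<le> \<rho> \<omega>))"
proof -
  note up = qfun_P_upper[OF R, of t]
  consider "level R t = 0" | "level R t = 1" | "1 - level R t \<in> {0<..<1}"
    using level_bounds[of R t] by fastforce
  then show ?thesis
  proof cases
    \<comment> \<open>Here \<open>R\<close> at \<open>P\<close> almost surely stays at or below
      \<open>t\<close>, so 0 serves as the cutoff for the nonnegative kernel.\<close>
    case 2
    have "AE \<omega> in M. (t < R (P \<omega>) \<longrightarrow> \<rho> \<omega> \<le> 0) \<and> (\<not> t < R (P \<omega>) \<longrightarrow> 0 \<le> \<rho> \<omega>)"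
      using up[THEN conjunct2, THEN conjunct1, rule_format, OF 2] \<rho>_nonneg by eventually_elim auto
    then show ?thesis by blast
  next
    case 3
    have "AE \<omega> in M. (t < R (P \<omega>) \<longrightarrow> \<rho> \<omega> \<le> q\<rho> (1 - level R t)) \<and> (\<not> t < R (P \<omega>) \<longrightarrow> q\<rho> (1 - level R t) \<le> \<rho> \<omega>)"
      using up[THEN conjunct2, THEN conjunct2]
    proof eventually_elim
      case (elim \<omega>)
      have "F\<rho> (\<rho> \<omega>) \<le> 1 - level R t \<longleftrightarrow> \<rho> \<omega> \<le> q\<rho> (1 - level R t)"
        by (rule dist_fun_le_iff[OF \<rho>_meas \<rho>_cont 3])
      then show ?case using elim by (cases "t < R (P \<omega>)") (auto simp: P_def)
    qed
    then show ?thesis by blast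
  qed (use up in blast)
qed

text \<open>Unlike \<rho>, the modified kernel may have atoms, so its cutoff is read off directly
  from the decreasing slope at the level.\<close>

lemma antimonotone_rho_tilde:
  assumes R: "qfun R"
  shows "(AE \<omega> in M. t < R (P \<omega>)) \<or>
    (\<exists>k. AE \<omega> in M. (t < R (P \<omega>) \<longrightarrow> rho_tilde M \<rho> w \<omega> \<le> k) \<and> (\<not> t < R (P \<omega>) \<longrightarrow> k \<le> rho_tilde M \<rho> w \<omega>))"
proof -
  note up = qfun_P_upper[OF R, of t]
  consider "level R t = 0" | "level R t = 1" | "level R t \<in> {0<..<1}"
    using level_bounds[of R t] by fastforce
  then show ?thesis
  proof cases
    case 2
    have "AE \<omega> in M. (t < R (P \<omega>) \<longrightarrow> rho_tilde M \<rho> w \<omega> \<le> 0) \<and> (\<not> t < R (P \<omega>) \<longrightarrow> 0 \<le> rho_tilde M \<rho> w \<omega>)"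
      using up[THEN conjunct2, THEN conjunct1, rule_format, OF 2] rho_tilde_nonneg by eventually_elim auto
    then show ?thesis by blast
  next
    case 3
    have "AE \<omega> in M. (t < R (P \<omega>) \<longrightarrow> rho_tilde M \<rho> w \<omega> \<le> H.env' (level R t)) \<and>
        (\<not> t < R (P \<omega>) \<longrightarrow> H.env' (level R t) \<le> rho_tilde M \<rho> w \<omega>)"
      using up[THEN conjunct2, THEN conjunct2] P_in
    proof eventually_elim
      case (elim \<omega>)
      then show ?case using 3 H.env'_antimono[of "level R t" "P \<omega>"] H.env'_antimono[of "P \<omega>" "level R t"]
        by (cases "t < R (P \<omega>)") (auto simp: rho_tilde_eq)
    qed
    then show ?thesis by blast
  qed (use up in blast)
qed

text \<open>In the notation of the paper this is the quantile function of \<open>Y\<close> composed with the function nu; on this scale the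
rank-dependent utility becomes a Lebesgue integral.\<close>

definition pull :: "('a \<Rightarrow> real) \<Rightarrow> real \<Rightarrow> real" where
  "pull Y = restrict (\<lambda>x. quantile M Y (nu x)) {0<..<1}"

lemma pull_V: "AE \<omega> in M. pull Y (V \<omega>) = quantile M Y (P \<omega>)"
  using P_in
proof eventually_elim
  case (elim \<omega>)
  have "V \<omega> \<in> {0<..<1}" unfolding V_eq by (rule psi_in_open[OF elim])
  moreover have "nu (V \<omega>) = P \<omega>" unfolding V_eq by (rule nu_psi) (use elim in auto)
  ultimately show ?case by (simp add: pull_def)
qed

context
  fixes Y :: "'a \<Rightarrow> real"
  assumes Y [measurable]: "Y \<in> borel_measurable M" and Y0: "AE \<omega> in M. 0 \<le> Y \<omega>"
begin

lemma qfun_pull: "qfun (pull Y)"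
proof (rule qfun_extensional)
  show "pull Y \<in> extensional {0<..<1}" by (simp add: pull_def)
  show "mono_on {0<..<1} (pull Y)"
  proof (rule mono_onI)
    fix x y :: real assume xy: "x \<in> {0<..<1}" "y \<in> {0<..<1}" "x \<le> y"
    have "quantile M Y (nu x) \<le> quantile M Y (nu y)"
      by (rule mono_onD[OF quantile_mono[OF Y] nu_in_open[OF xy(1)] nu_in_open[OF xy(2)]])
        (use xy in \<open>auto intro!: nu_mono\<close>)
    then show "pull Y x \<le> pull Y y" using xy by (simp add: pull_def)
  qed
  fix x :: real assume x: "x \<in> {0<..<1}"
  then show "0 \<le> pull Y x"
    using qfun_quantile[OF Y Y0] nu_in_open[OF x] by (simp add: qfun_def pull_def)
qed

text \<open>The distorted distribution function, which is the integrator in \<open>rdu\<close>, is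
  therefore the distribution function of \<open>pull Y\<close> under the uniform law.\<close>

lemma level_pull: "level (pull Y) t = psi (dist_fun M Y t)"
proof (rule level_eqI[OF qfun_pull psi_in[OF dist_fun_bounds[OF Y]]])
  fix x :: real assume x: "x \<in> {0<..<1}"
  then have x': "x \<in> {0..1}" by auto
  show "pull Y x \<le> t" if "x < psi (dist_fun M Y t)"
    using quantile_le[OF Y nu_in_open[OF x]] nu_less_iff[OF x' dist_fun_bounds[OF Y]] that x by (simp add: pull_def)
  show "x \<le> psi (dist_fun M Y t)" if "pull Y x \<le> t"
    using le_dist_fun[OF Y nu_in_open[OF x]] nu_le_iff[OF x' dist_fun_bounds[OF Y]] that x by (simp add: pull_def)
qed

lemma law_quantile_P: "distr M borel Y = distr M borel (\<lambda>\<omega>. quantile M Y (P \<omega>))"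
  using distr_qfun_P[OF qfun_quantile[OF Y Y0]] distr_quantile[OF Y Y0] by simp

lemma cost_quantile_le:
  "H.cost (quantile M Y) \<le> (\<integral>\<^sup>+\<omega>. ennreal (rho_tilde M \<rho> w \<omega>) * ennreal (Y \<omega>) \<partial>M)"
proof -
  note q = qfun_quantile[OF Y Y0]
  note [measurable] = qfun_measurable[OF q]
  show ?thesis unfolding cost_eq_expectation[OF q]
    by (rule antimonotone_minimises[OF rho_tilde_integrable rho_tilde_nonneg Y _ law_quantile_P
          antimonotone_rho_tilde[OF q]]) measurable
qed

lemma price_pull: "(\<integral>\<^sup>+x. ennreal (pull Y x) \<partial>N) = (\<integral>\<^sup>+\<omega>. ennreal (\<rho> \<omega>) * ennreal (quantile M Y (P \<omega>)) \<partial>M)"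
  unfolding price_eq_expectation[OF qfun_pull]
  by (rule nn_integral_cong_AE) (use pull_V[of Y] in eventually_elim, simp)

lemma price_pull_le:
  "(\<integral>\<^sup>+x. ennreal (pull Y x) \<partial>N) \<le> (\<integral>\<^sup>+\<omega>. ennreal (\<rho> \<omega>) * ennreal (Y \<omega>) \<partial>M)"
proof -
  note q = qfun_quantile[OF Y Y0]
  note [measurable] = qfun_measurable[OF q]
  show ?thesis unfolding price_pull
    by (rule antimonotone_minimises[OF \<rho>_int \<rho>_nonneg Y _ law_quantile_P antimonotone_\<rho>[OF q]]) measurable
qed

text \<open>A variable no dearer than its antimonotone rearrangement coincides with it, because
  \<rho> is atomless.\<close>

lemma price_pull_eqD:
  assumes le: "(\<integral>\<^sup>+\<omega>. ennreal (\<rho> \<omega>) * ennreal (Y \<omega>) \<partial>M) \<le> (\<integral>\<^sup>+x. ennreal (pull Y x) \<partial>N)"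
    and fin: "(\<integral>\<^sup>+x. ennreal (pull Y x) \<partial>N) < \<infinity>"
  shows "AE \<omega> in M. Y \<omega> = pull Y (V \<omega>)"
proof -
  note q = qfun_quantile[OF Y Y0]
  note [measurable] = qfun_measurable[OF q]
  have Z0: "AE \<omega> in M. 0 \<le> quantile M Y (P \<omega>)" by (rule AE_P[OF qfun_AE_nonneg[OF q]])
  have "AE \<omega> in M. Y \<omega> = quantile M Y (P \<omega>)"
    by (rule antimonotone_unique[OF \<rho>_int \<rho>_nonneg Y _ law_quantile_P antimonotone_\<rho>[OF q]
          AE_neq[OF \<rho>_meas \<rho>_cont] Y0 Z0 le[unfolded price_pull] fin[unfolded price_pull]]) measurable
  with pull_V[of Y] show ?thesis by eventually_elim simp
qed

end

text \<open>\<open>R\<close> need not be right-continuous, so pulling back \<open>R\<close> composed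
  with \<open>V\<close> can change its values at jumps. Its levels are recovered exactly, and the
  total utility depends only on these.\<close>

lemma psi_dist_fun_V:
  assumes R: "qfun R"
  shows "psi (dist_fun M (\<lambda>\<omega>. R (V \<omega>)) t) = level R t"
proof -
  note [measurable] = qfun_measurable[OF R]
  have c: "level R t \<in> {0..1}" by (rule level_bounds)
  have "dist_fun M (\<lambda>\<omega>. R (V \<omega>)) t = prob {\<omega> \<in> space M. R (V \<omega>) \<le> t}"
    by (rule dist_fun_prob) measurable
  also have "\<dots> = prob (P -` {..nu (level R t)} \<inter> space M)"
  proof (rule finite_measure_eq_AE)
    show "AE \<omega> in M. (\<omega> \<in> {\<omega> \<in> space M. R (V \<omega>) \<le> t}) = (\<omega> \<in> P -` {..nu (level R t)} \<inter> space M)"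
      using V_in V_neq[of "level R t"] AE_space
    proof eventually_elim
      case (elim \<omega>)
      have "P \<omega> \<le> nu (level R t) \<longleftrightarrow> V \<omega> \<le> level R t"
        using psi_le[OF P_bounds psi_nu(2)[OF c], of \<omega>] psi_nu(1)[OF c] by (simp add: V_eq)
      then show ?case using level_split[OF R elim(1), of t] elim
        by (cases "V \<omega>" "level R t" rule: linorder_cases) auto
    qed
  qed measurable
  also have "\<dots> = measure (distr M borel P) {..nu (level R t)}" by (subst measure_distr) auto
  also have "\<dots> = nu (level R t)" unfolding distr_P by (rule measure_unif_Iic[OF psi_nu(2)[OF c]])
  finally show ?thesis using psi_nu(1)[OF c] by simp
qed

end

section \<open>Passing between the two optima\<close>

lemma mono_on_tendsto_at_left:
  fixes R :: "real \<Rightarrow> real"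
  assumes R: "mono_on {0<..<1} R" and x: "x \<in> {0<..<1}"
  shows "\<exists>l. (R \<longlongrightarrow> l) (at_left x)"
proof -
  have near: "\<forall>\<^sub>F y in at_left x. y \<in> {c<..<x}" if "c < x" for c
    using that by (rule eventually_at_left_real)
  have bdd: "bdd_above (R ` {0<..<x})"
    using x by (intro bdd_aboveI2[of _ _ "R x"] mono_onD[OF R]) auto
  have "(R \<longlongrightarrow> Sup (R ` {0<..<x})) (at_left x)"
  proof (rule increasing_tendsto)
    show "\<forall>\<^sub>F y in at_left x. R y \<le> Sup (R ` {0<..<x})"
      using near[of 0] x by (auto elim!: eventually_mono intro!: cSUP_upper bdd)
    fix a assume "a < Sup (R ` {0<..<x})"
    then obtain y where y: "y \<in> {0<..<x}" "a < R y"
      using less_cSUP_iff[OF _ bdd, of a] x by auto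
    have "\<forall>\<^sub>F z in at_left x. z \<in> {y<..<x}" using near y by auto
    then show "\<forall>\<^sub>F z in at_left x. a < R z"
    proof eventually_elim
      case (elim z)
      then have "R y \<le> R z" using y x by (intro mono_onD[OF R]) auto
      then show ?case using y by simp
    qed
  qed
  then show ?thesis ..
qed

context pricing_model
begin

lemma pull_quantile_functions:
  assumes Y: "Y \<in> borel_measurable M" and Y0: "AE \<omega> in M. 0 \<le> Y \<omega>"
  shows "pull Y \<in> quantile_functions"
proof -
  have q: "qfun (pull Y)" by (rule qfun_pull[OF Y Y0])
  then have mono: "mono_on {0<..<1} (pull Y)" and nn: "\<And>x. x \<in> {0<..<1} \<Longrightarrow> 0 \<le> pull Y x"
    by (auto simp: qfun_def)
  have right: "(pull Y \<longlongrightarrow> pull Y x) (at_right x)" if x: "x \<in> {0<..<1}" for x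
  proof (rule decreasing_tendsto)
    have near: "\<forall>\<^sub>F y in at_right x. y \<in> {x<..<c}" if "x < c" for c
      using that by (rule eventually_at_right_real)
    show "\<forall>\<^sub>F y in at_right x. pull Y x \<le> pull Y y"
      using near[of 1] x by (auto elim!: eventually_mono intro!: mono_onD[OF mono])
    fix a assume "pull Y x < a"
    then obtain t where t: "pull Y x < t" "t < a" using dense by blast
    have x': "x \<in> {0..1}" using x by auto
    \<comment> \<open>Because the quantile is a supremum, any \<open>t\<close> above
      \<open>pull Y x\<close> has a distribution value strictly above \<open>nu x\<close>; this
      strictness leaves room to the right of \<open>x\<close> where \<open>pull Y\<close> is still
      at most \<open>t\<close>.\<close>
    have "\<not> dist_fun M Y t \<le> nu x"
      using le_quantile[OF Y nu_in_open[OF x], of t] t(1) x by (auto simp: pull_def)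
    then have "x < psi (dist_fun M Y t)"
      using nu_less_iff[OF x' dist_fun_bounds[OF Y], of t] by simp
    then have "\<forall>\<^sub>F y in at_right x. y \<in> {x<..<min 1 (level (pull Y) t)}"
      using near[of "min 1 (level (pull Y) t)"] x by (simp add: level_pull[OF Y Y0])
    then show "\<forall>\<^sub>F y in at_right x. pull Y y < a"
    proof eventually_elim
      case (elim y)
      then have "pull Y y \<le> t" using x by (intro level_split(1)[OF q]) auto
      then show ?case using t(2) by simp
    qed
  qed
  show ?thesis
    unfolding quantile_functions_def
    using mono nn right mono_on_tendsto_at_left[OF mono]
    by (auto simp: continuous_within PiE_def pull_def simp del: greaterThanLessThan_iff)
qed

text \<open>Right-continuous functions that differ at \<open>x\<close> differ on an interval to its
  right, which \<open>V\<close> hits with positive probability.\<close>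

lemma quantile_functions_unique:
  assumes Q: "Q \<in> quantile_functions" and R: "R \<in> quantile_functions"
    and eq: "AE \<omega> in M. Q (V \<omega>) = R (V \<omega>)"
  shows "Q = R"
proof
  fix x
  show "Q x = R x"
  proof (cases "x \<in> {0<..<1}")
    case False
    then show ?thesis using Q R by (auto simp: quantile_functions_def PiE_def extensional_def)
  next
    case x: True
    show ?thesis
    proof (rule ccontr)
      assume "Q x \<noteq> R x"
      have "(Q \<longlongrightarrow> Q x) (at_right x)" "(R \<longlongrightarrow> R x) (at_right x)"
        using Q R x by (auto simp: quantile_functions_def continuous_within)
      then have "((\<lambda>y. Q y - R y) \<longlongrightarrow> Q x - R x) (at_right x)" by (rule tendsto_diff)
      then have "\<forall>\<^sub>F y in at_right x. Q y - R y \<noteq> 0"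
        by (rule tendsto_imp_eventually_ne) (use \<open>Q x \<noteq> R x\<close> in simp)
      then obtain b where b: "x < b" "\<And>y. x < y \<Longrightarrow> y < b \<Longrightarrow> Q y \<noteq> R y"
        unfolding eventually_at_right_field by auto
      define y where "y = min ((x + b) / 2) 1"
      have y: "x < y" "y < b" "y \<le> 1"
        using b(1) x by (auto simp: y_def min_def field_simps)
      have "AE \<omega> in M. \<not> (x < V \<omega> \<and> V \<omega> \<le> y)"
        using eq by eventually_elim (use b(2) y in force)
      then have "prob {\<omega> \<in> space M. x < V \<omega> \<and> V \<omega> \<le> y} = 0"
        by (subst prob_Collect_eq_0) auto
      then show False using prob_V[of x y] x y by simp
    qed
  qed
qed

end

section \<open>Both portfolio problems in terms of total utility, cost and price\<close>

locale portfolio = pricing_model M \<rho> w + concave_utility v for M :: "'a measure" and \<rho> w v +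
  fixes u :: "real \<Rightarrow> real" and x0 :: real
  assumes u_v: "\<And>y. 0 \<le> y \<Longrightarrow> u y = v y + u 0" and x0: "0 < x0"
begin

sublocale Pr: quantile_problem "phi M \<rho> w" v N
  by unfold_locales (rule N_tail)

lemma total_law: "qfun R \<Longrightarrow> total R = (\<integral>\<^sup>+x. ennreal (v x) \<partial>distr unif borel R)"
  unfolding total_def by (subst nn_integral_distr) (auto dest: qfun_measurable)

lemma total_cong_law: "qfun Q \<Longrightarrow> qfun R \<Longrightarrow> distr unif borel Q = distr unif borel R \<Longrightarrow> total Q = total R"
  by (simp add: total_law)

lemma cdf_unif_qfun:
  assumes R: "qfun R"
  shows "real_distribution (distr unif borel R)" "cdf (distr unif borel R) t = level R t"
proof -
  note [measurable] = qfun_measurable[OF R]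
  have m: "R \<in> borel_measurable unif" by measurable
  then show "real_distribution (distr unif borel R)" by (rule unif.real_distribution_distr)
  show "cdf (distr unif borel R) t = level R t"
    unfolding cdf_def level_def using m by (subst measure_distr) (auto simp: vimage_def)
qed

lemma total_cong_level:
  assumes "qfun Q" "qfun R" "\<And>t. level Q t = level R t"
  shows "total Q = total R"
proof (rule total_cong_law[OF assms(1,2)])
  show "distr unif borel Q = distr unif borel R"
    by (rule distr_unif_eqI[OF cdf_unif_qfun(1)[OF assms(2)] assms(1)])
      (simp add: cdf_unif_qfun(2)[OF assms(2)] assms(3))
qed

lemma expected_utility_eq:
  assumes Y [measurable]: "Y \<in> borel_measurable M" and Y0: "AE \<omega> in M. 0 \<le> Y \<omega>"
  shows "expected_utility M u Y = enn2ereal (total (quantile M Y)) + ereal (u 0)"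
proof -
  have "total (quantile M Y) = (\<integral>\<^sup>+\<omega>. ennreal (v (Y \<omega>)) \<partial>M)"
    unfolding total_law[OF qfun_quantile[OF Y Y0]] distr_quantile[OF Y Y0]
    by (rule nn_integral_distr) measurable
  moreover have "expected_utility M u Y = enn2ereal (\<integral>\<^sup>+\<omega>. ennreal (v (Y \<omega>)) \<partial>M) + ereal (u 0)"
    unfolding expected_utility_def
  proof (rule ext_integral_shift[OF prob_space_axioms _ v_nonneg])
    show "AE \<omega> in M. u (Y \<omega>) = v (Y \<omega>) + u 0" using Y0 by eventually_elim (rule u_v)
  qed measurable
  ultimately show ?thesis by simp
qed

lemma total_quantile:
  assumes R: "qfun R" and W: "W \<in> borel_measurable M" "distr M borel W = unif"
  shows "(\<lambda>\<omega>. R (W \<omega>)) \<in> borel_measurable M" "AE \<omega> in M. 0 \<le> R (W \<omega>)"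
    "total (quantile M (\<lambda>\<omega>. R (W \<omega>))) = total R"
proof -
  note [measurable] = qfun_measurable[OF R] W(1)
  show m: "(\<lambda>\<omega>. R (W \<omega>)) \<in> borel_measurable M" by measurable
  show nn: "AE \<omega> in M. 0 \<le> R (W \<omega>)"
  proof (rule AE_distrD[of W M borel])
    show "AE x in distr M borel W. 0 \<le> R x" unfolding W(2) by (rule qfun_AE_nonneg[OF R])
  qed measurable
  have "distr unif borel (quantile M (\<lambda>\<omega>. R (W \<omega>))) = distr (distr M borel W) borel R"
    unfolding distr_quantile[OF m nn] by (subst distr_distr) (auto simp: comp_def)
  then show "total (quantile M (\<lambda>\<omega>. R (W \<omega>))) = total R"
    unfolding W(2) by (rule total_cong_law[OF qfun_quantile[OF m nn] R])
qed

text \<open>By \<open>level_pull\<close> the Stieltjes measure is the law of \<open>pull Y\<close>,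
  a probability on the half-line, so the constant \<open>u 0\<close> splits off.\<close>

lemma rdu_eq:
  assumes Y: "Y \<in> borel_measurable M" and Y0: "AE \<omega> in M. 0 \<le> Y \<omega>"
  shows "rdu M w u Y = enn2ereal (total (pull Y)) + ereal (u 0)"
proof -
  let ?R = "pull Y"
  have R: "qfun ?R" by (rule qfun_pull[OF Y Y0])
  note [measurable] = qfun_measurable[OF R]
  interpret D: real_distribution "distr unif borel ?R" by (rule cdf_unif_qfun[OF R])
  have cdf: "cdf (distr unif borel ?R) = level ?R" using cdf_unif_qfun[OF R] by auto
  have "(\<lambda>t. 1 - w (1 - dist_fun M Y t)) = level ?R"
    by (simp add: fun_eq_iff level_pull[OF Y Y0] psi_def)
  moreover have "distr unif borel ?R = interval_measure (level ?R)"
  proof (rule distr_unif_eqI[OF _ R])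
    show "real_distribution (interval_measure (level ?R))"
      using D.cdf_nondecreasing D.cdf_is_right_cont D.cdf_lim_at_bot D.cdf_lim_at_top_prob
      unfolding cdf by (intro real_distribution_interval_measure) auto
    show "cdf (interval_measure (level ?R)) t = level ?R t" for t
      using D.cdf_nondecreasing D.cdf_is_right_cont D.cdf_lim_at_bot
      unfolding cdf by (subst cdf_interval_measure) auto
  qed
  ultimately have "rdu M w u Y = ext_integral (distr unif borel ?R) (\<lambda>x. indicator {0..} x * u x)"
    unfolding rdu_def by simp
  also have "\<dots> = enn2ereal (\<integral>\<^sup>+x. ennreal (v x) \<partial>distr unif borel ?R) + ereal (u 0)"
  proof (rule ext_integral_shift)
    have "AE x in distr unif borel ?R. 0 \<le> x"
      using qfun_AE_nonneg[OF R] by (subst AE_distr_iff) auto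
    then show "AE x in distr unif borel ?R. indicator {0..} x * u x = v x + u 0"
      by eventually_elim (simp add: u_v[symmetric])
  qed (auto simp: v_nonneg D.prob_space_axioms)
  finally show ?thesis unfolding total_law[OF R] .
qed

lemma total_pull_V:
  assumes R: "qfun R"
  shows "(\<lambda>\<omega>. R (V \<omega>)) \<in> borel_measurable M" "AE \<omega> in M. 0 \<le> R (V \<omega>)"
    "total (pull (\<lambda>\<omega>. R (V \<omega>))) = total R"
proof -
  note [measurable] = qfun_measurable[OF R]
  show m: "(\<lambda>\<omega>. R (V \<omega>)) \<in> borel_measurable M" by measurable
  show nn: "AE \<omega> in M. 0 \<le> R (V \<omega>)"
    using V_in by eventually_elim (use R in \<open>auto simp: qfun_def\<close>)
  show "total (pull (\<lambda>\<omega>. R (V \<omega>))) = total R"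
    by (rule total_cong_level[OF qfun_pull[OF m nn] R]) (simp add: level_pull[OF m nn] psi_dist_fun_V[OF R])
qed

lemma admissible_E_iff:
  "Y \<in> admissible M (rho_tilde M \<rho> w) x0 \<longleftrightarrow> Y \<in> borel_measurable M \<and> (AE \<omega> in M. 0 \<le> Y \<omega>) \<and>
    (\<integral>\<^sup>+\<omega>. ennreal (rho_tilde M \<rho> w \<omega>) * ennreal (Y \<omega>) \<partial>M) = ennreal x0"
  using admissible_iff[OF rho_tilde_measurable rho_tilde_nonneg] x0 by auto

lemma admissible_R_iff:
  "Y \<in> admissible M \<rho> x0 \<longleftrightarrow> Y \<in> borel_measurable M \<and> (AE \<omega> in M. 0 \<le> Y \<omega>) \<and>
    (\<integral>\<^sup>+\<omega>. ennreal (\<rho> \<omega>) * ennreal (Y \<omega>) \<partial>M) = ennreal x0"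
  using admissible_iff[OF \<rho>_meas \<rho>_nonneg] x0 by auto

lemma optimal_E_iff:
  "optimal_E M u w \<rho> x0 X \<longleftrightarrow> X \<in> admissible M (rho_tilde M \<rho> w) x0 \<and>
    (\<forall>Y\<in>admissible M (rho_tilde M \<rho> w) x0. total (quantile M Y) \<le> total (quantile M X)) \<and>
    total (quantile M X) < \<infinity>"
  unfolding optimal_E_def
  by (rule optimal_solution_iff[where T = "\<lambda>Y. total (quantile M Y)"])
    (auto simp: admissible_E_iff expected_utility_eq)

lemma optimal_R_iff:
  "optimal_R M u w \<rho> x0 X \<longleftrightarrow> X \<in> admissible M \<rho> x0 \<and>
    (\<forall>Y\<in>admissible M \<rho> x0. total (pull Y) \<le> total (pull X)) \<and> total (pull X) < \<infinity>"
  unfolding optimal_R_def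
  by (rule optimal_solution_iff[where T = "\<lambda>Y. total (pull Y)"])
    (auto simp: admissible_R_iff rdu_eq)

lemma price_V: "qfun R \<Longrightarrow> Pr.price R = (\<integral>\<^sup>+\<omega>. ennreal (\<rho> \<omega>) * ennreal (R (V \<omega>)) \<partial>M)"
  unfolding Pr.price_def by (rule price_eq_expectation)

lemma V_admissible: "qfun R \<Longrightarrow> Pr.price R = ennreal x0 \<Longrightarrow> (\<lambda>\<omega>. R (V \<omega>)) \<in> admissible M \<rho> x0"
  using total_pull_V[of R] price_V[of R] by (simp add: admissible_R_iff)

lemma admissible_R_price:
  "Y \<in> admissible M \<rho> x0 \<Longrightarrow> qfun (pull Y) \<and> Pr.price (pull Y) \<le> ennreal x0"
  using price_pull_le[of Y] qfun_pull[of Y] by (auto simp: admissible_R_iff Pr.price_def)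

lemma P_admissible: "qfun R \<Longrightarrow> H.cost R = ennreal x0 \<Longrightarrow> (\<lambda>\<omega>. R (P \<omega>)) \<in> admissible M (rho_tilde M \<rho> w) x0"
  using total_quantile[OF _ P_measurable distr_P, of R] cost_eq_expectation[of R] by (simp add: admissible_E_iff)

lemma admissible_E_cost:
  "Y \<in> admissible M (rho_tilde M \<rho> w) x0 \<Longrightarrow> qfun (quantile M Y) \<and> H.cost (quantile M Y) \<le> ennreal x0"
  using cost_quantile_le[of Y] qfun_quantile[of Y] by (auto simp: admissible_E_iff)

lemma optimal_R_of_optimal_E:
  assumes "optimal_E M u w \<rho> x0 X"
  shows "optimal_R M u w \<rho> x0 (\<lambda>\<omega>. quantile M X (V \<omega>))"
proof -
  let ?q = "quantile M X"
  have q: "qfun ?q" "H.cost ?q \<le> ennreal x0" and fin: "total ?q < \<infinity>"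
    using assms admissible_E_cost by (auto simp: optimal_E_iff)
  have opt: "total R \<le> total ?q" if "qfun R" "H.cost R = ennreal x0" for R
    using assms P_admissible[OF that] total_quantile(3)[OF that(1) P_measurable distr_P]
    by (auto simp: optimal_E_iff)
  note max = Pr.cost_maximizer[OF q fin opt]
  have "total (pull Y) \<le> total ?q" if "Y \<in> admissible M \<rho> x0" for Y
    using admissible_R_price[OF that] max(2) by blast
  then show ?thesis
    using V_admissible[OF q(1) max(1)] fin by (simp add: optimal_R_iff total_pull_V(3)[OF q(1)])
qed

text \<open>An optimal \<open>X\<close> spends \<open>x0\<close>, and \<open>price_maximizer\<close>
  shows that its cheapest rearrangement also needs all of \<open>x0\<close>. Hence \<open>X\<close>
  is no dearer than that rearrangement and equals it.\<close>

lemma optimal_R_maximizer: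
  assumes "optimal_R M u w \<rho> x0 X"
  shows "AE \<omega> in M. X \<omega> = pull X (V \<omega>)" "qfun (pull X)" "H.cost (pull X) = ennreal x0"
    "\<And>R. qfun R \<Longrightarrow> H.cost R \<le> ennreal x0 \<Longrightarrow> total R \<le> total (pull X)" "total (pull X) < \<infinity>"
proof -
  have X: "X \<in> admissible M \<rho> x0" using assms by (simp add: optimal_R_iff)
  show q: "qfun (pull X)" and fin: "total (pull X) < \<infinity>"
    using assms admissible_R_price by (auto simp: optimal_R_iff)
  have le: "Pr.price (pull X) \<le> ennreal x0" using admissible_R_price[OF X] by simp
  have opt: "total R \<le> total (pull X)" if "qfun R" "Pr.price R = ennreal x0" for R
    using assms V_admissible[OF that] total_pull_V(3)[OF that(1)] by (auto simp: optimal_R_iff)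
  note max = Pr.price_maximizer[OF q le fin opt]
  show "H.cost (pull X) = ennreal x0" by (rule max(1))
  show "total R \<le> total (pull X)" if "qfun R" "H.cost R \<le> ennreal x0" for R by (rule max(3)[OF _ _ that])
  have X': "X \<in> borel_measurable M" "AE \<omega> in M. 0 \<le> X \<omega>"
    "(\<integral>\<^sup>+\<omega>. ennreal (\<rho> \<omega>) * ennreal (X \<omega>) \<partial>M) = ennreal x0"
    using X by (auto simp: admissible_R_iff)
  show "AE \<omega> in M. X \<omega> = pull X (V \<omega>)"
    by (rule price_pull_eqD[OF X'(1,2)]) (use max(2) X'(3) in \<open>auto simp: Pr.price_def\<close>)
qed

text \<open>When the modified kernel has atoms, \<open>U\<close> need not be \<open>1 - P\<close>.
  Still the kernel and the decreasing slope evaluated at \<open>1 - U\<close> have the same law and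
  are both ordered like \<open>U\<close>, so they coincide almost surely.\<close>

lemma rho_tilde_comonotonic:
  assumes U [measurable]: "U \<in> borel_measurable M" and law: "distr M borel U = unif"
    and como: "comonotonic M U (rho_tilde M \<rho> w)"
  shows "AE \<omega> in M. ennreal (rho_tilde M \<rho> w \<omega>) = H.env_density (1 - U \<omega>)"
proof -
  define D where "D = (\<lambda>x. indicator {0<..<1} x * H.env' x)"
  have [measurable]: "D \<in> borel_measurable borel" unfolding D_def by measurable
  note law' = distr_unif_reflect_rv[OF U law]
  have Uin: "AE \<omega> in M. U \<omega> \<in> {0<..<1}"
  proof (rule AE_distrD[of U M borel])
    show "AE x in distr M borel U. x \<in> {0<..<1}" unfolding law by (rule AE_unif_in)
  qed measurable
  have "distr M borel (rho_tilde M \<rho> w) = distr M borel (\<lambda>\<omega>. D (P \<omega>))"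
  proof (rule distr_cong_AE)
    show "AE \<omega> in M. rho_tilde M \<rho> w \<omega> = D (P \<omega>)"
      using P_in by eventually_elim (simp add: rho_tilde_eq D_def)
  qed measurable
  also have "\<dots> = distr (distr M borel P) borel D" by (subst distr_distr) (auto simp: comp_def)
  also have "\<dots> = distr (distr M borel (\<lambda>\<omega>. 1 - U \<omega>)) borel D" unfolding distr_P law' ..
  also have "\<dots> = distr M borel (\<lambda>\<omega>. D (1 - U \<omega>))" by (subst distr_distr) (auto simp: comp_def)
  finally have eq: "distr M borel (rho_tilde M \<rho> w) = distr M borel (\<lambda>\<omega>. D (1 - U \<omega>))" .
  have "AE \<omega> in M. rho_tilde M \<rho> w \<omega> = D (1 - U \<omega>)"
  proof (rule comonotonic_same_law[OF _ _ U eq como])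
    show "AE \<omega> in M. U \<omega> \<in> {0<..<1} \<and> D (1 - U \<omega>) = (\<lambda>y. D (1 - y)) (U \<omega>)"
      using Uin by eventually_elim simp
    show "mono_on {0<..<1} (\<lambda>y. D (1 - y))"
      unfolding D_def by (rule mono_onI) (auto intro!: H.env'_antimono)
  qed measurable
  then show ?thesis by eventually_elim (simp add: H.env_density_def D_def)
qed

lemma optimal_E_of_optimal_R:
  assumes opt: "optimal_R M u w \<rho> x0 X"
    and U [measurable]: "U \<in> borel_measurable M" and law: "distr M borel U = unif"
    and como: "comonotonic M U (rho_tilde M \<rho> w)"
  shows "optimal_E M u w \<rho> x0 (\<lambda>\<omega>. pull X (1 - U \<omega>))"
proof -
  note max = optimal_R_maximizer[OF opt]
  note [measurable] = qfun_measurable[OF max(2)]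
  have W [measurable]: "(\<lambda>\<omega>. 1 - U \<omega>) \<in> borel_measurable M" by measurable
  note law' = distr_unif_reflect_rv[OF U law]
  note Q = total_quantile[OF max(2) W law']
  have "(\<integral>\<^sup>+\<omega>. ennreal (rho_tilde M \<rho> w \<omega>) * ennreal (pull X (1 - U \<omega>)) \<partial>M)
      = (\<integral>\<^sup>+\<omega>. H.env_density (1 - U \<omega>) * ennreal (pull X (1 - U \<omega>)) \<partial>M)"
    by (rule nn_integral_cong_AE) (use rho_tilde_comonotonic[OF U law como] in eventually_elim, simp)
  also have "\<dots> = H.cost (pull X)"
    unfolding H.cost_def law'[symmetric] by (subst nn_integral_distr) auto
  finally have "(\<lambda>\<omega>. pull X (1 - U \<omega>)) \<in> admissible M (rho_tilde M \<rho> w) x0"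
    using Q max(3) by (simp add: admissible_E_iff)
  moreover have "total (quantile M Y) \<le> total (pull X)" if "Y \<in> admissible M (rho_tilde M \<rho> w) x0" for Y
    using admissible_E_cost[OF that] max(4) by blast
  ultimately show ?thesis using max(5) by (simp add: optimal_E_iff Q(3))
qed

end

text \<open>The mean value theorem with a strictly decreasing derivative. At 0 no derivative is
  assumed; the inequality passes to the limit and loses strictness.\<close>

lemma strictly_concave_tangent:
  fixes u :: "real \<Rightarrow> real"
  assumes lim: "(u \<longlongrightarrow> u 0) (at_right 0)"
    and d1: "\<And>y. y > 0 \<Longrightarrow> u differentiable (at y)"
    and d2: "\<And>y. y > 0 \<Longrightarrow> deriv u differentiable (at y)"
    and neg: "\<And>y. y > 0 \<Longrightarrow> deriv (deriv u) y < 0"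
    and m: "0 < m"
  shows "\<And>y. 0 < y \<Longrightarrow> y \<noteq> m \<Longrightarrow> u y < u m + deriv u m * (y - m)"
    and "u 0 \<le> u m + deriv u m * (0 - m)"
proof -
  have D1: "(u has_real_derivative deriv u y) (at y)" if "y > 0" for y
    using d1[OF that] by (simp add: DERIV_deriv_iff_real_differentiable)
  have D2: "(deriv u has_real_derivative deriv (deriv u) y) (at y)" if "y > 0" for y
    using d2[OF that] by (simp add: DERIV_deriv_iff_real_differentiable)
  have dec: "deriv u b < deriv u a" if "0 < a" "a < b" for a b
  proof (rule DERIV_neg_imp_decreasing[OF that(2)])
    fix x assume "a \<le> x" "x \<le> b"
    then show "\<exists>y. (deriv u has_real_derivative y) (at x) \<and> y < 0"
      using D2[of x] neg[of x] that by (intro exI[of _ "deriv (deriv u) x"]) auto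
  qed
  show strict: "u y < u m + deriv u m * (y - m)" if y: "0 < y" "y \<noteq> m" for y
  proof (cases "y < m")
    case True
    obtain z where z: "y < z" "z < m" "u m - u y = (m - y) * deriv u z"
      using MVT2[OF True, of u "deriv u"] D1 y by force
    have "(m - y) * deriv u m < (m - y) * deriv u z"
      using dec[of z m] z y True by (intro mult_strict_left_mono) auto
    then show ?thesis using z(3) by (simp add: algebra_simps)
  next
    case False
    then have lt: "m < y" using y by simp
    obtain z where z: "m < z" "z < y" "u y - u m = (y - m) * deriv u z"
      using MVT2[OF lt, of u "deriv u"] D1 m by force
    have "(y - m) * deriv u z < (y - m) * deriv u m"
      using dec[of m z] z m lt by (intro mult_strict_left_mono) auto
    then show ?thesis using z(3) by (simp add: algebra_simps)
  qed
  show "u 0 \<le> u m + deriv u m * (0 - m)"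
  proof (rule tendsto_le[OF _ _ lim])
    show "((\<lambda>y. u m + deriv u m * (y - m)) \<longlongrightarrow> u m + deriv u m * (0 - m)) (at_right 0)"
      by (intro tendsto_intros)
    have "\<forall>\<^sub>F y in at_right 0. y \<in> {0<..<m}" using m by (rule eventually_at_right_real)
    then show "\<forall>\<^sub>F y in at_right 0. u y \<le> u m + deriv u m * (y - m)"
      by eventually_elim (use strict in \<open>auto intro!: less_imp_le\<close>)
  qed simp
qed

theorem theorem3:
  fixes M :: "'a measure" and u w :: "real \<Rightarrow> real" and \<rho> :: "'a \<Rightarrow> real" and x0 :: real
  assumes "prob_space M"
    and "strict_mono_on {0..} u"
    and "(u \<longlongrightarrow> u 0) (at_right 0)"
    and "\<And>y. y > 0 \<Longrightarrow> u differentiable (at y)"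
    and "\<And>y. y > 0 \<Longrightarrow> deriv u differentiable (at y)"
    and "\<And>y. y > 0 \<Longrightarrow> deriv (deriv u) y < 0"
    and "\<And>p x. p > 0 \<Longrightarrow> x \<in> {0<..<1} \<Longrightarrow>
           \<exists>y\<ge>0. \<forall>z\<ge>0. u z - p * delta' M \<rho> w x * z \<le> u y - p * delta' M \<rho> w x * y"
    and "w \<in> {0..1} \<rightarrow> {0..1}"
    and "w differentiable_on {0..1}"
    and "strict_mono_on {0..1} w"
    and "w 0 = 0" and "w 1 = 1"
    and "\<rho> \<in> borel_measurable M"
    and "AE \<omega> in M. \<rho> \<omega> > 0"
    and "integrable M \<rho>"
    and "continuous_on UNIV (dist_fun M \<rho>)"
    and "x0 > 0"
  shows
    "(\<forall>Xt. optimal_E M u w \<rho> x0 Xt \<longrightarrow>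
        optimal_R M u w \<rho> x0 (\<lambda>\<omega>. quantile M Xt (1 - w (dist_fun M \<rho> (\<rho> \<omega>))))) \<and>
     (\<forall>X. optimal_R M u w \<rho> x0 X \<longrightarrow>
        (\<exists>!Q. Q \<in> quantile_functions \<and>
              (AE \<omega> in M. X \<omega> = Q (1 - w (dist_fun M \<rho> (\<rho> \<omega>))))) \<and>
        (\<forall>Q U. Q \<in> quantile_functions \<and>
               (AE \<omega> in M. X \<omega> = Q (1 - w (dist_fun M \<rho> (\<rho> \<omega>)))) \<and>
               U \<in> borel_measurable M \<and>
               distr M borel U = uniform_measure lborel {0<..<1} \<and>
               comonotonic M U (rho_tilde M \<rho> w) \<longrightarrow>
             optimal_E M u w \<rho> x0 (\<lambda>\<omega>. Q (1 - U \<omega>))))"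
proof -
  \<comment> \<open>Clamping at 0 makes \<open>v\<close> monotone on the whole line and removes the
    arbitrary values of \<open>u\<close> at negative arguments, which admissible variables may take
    on null sets.\<close>
  define v where "v = (\<lambda>y. u (max 0 y) - u 0)"
  have u_mono: "u x < u y" if "0 \<le> x" "x < y" for x y
    using strict_mono_onD[OF assms(2), of x y] that by simp
  have tangent: "u y < u m + deriv u m * (y - m)" if "0 < m" "0 < y" "y \<noteq> m" for m y
    by (rule strictly_concave_tangent(1)[OF assms(3) _ _ _ that]) (fact assms(4-6))+
  have tangent0: "u 0 \<le> u m + deriv u m * (0 - m)" if "0 < m" for m
    by (rule strictly_concave_tangent(2)[OF assms(3) _ _ _ that]) (fact assms(4-6))+
  interpret prob_space M by fact
  interpret portfolio M \<rho> w v u x0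
  proof
    show "continuous_on {0..1} w" by (rule differentiable_imp_continuous_on[OF assms(9)])
    show "mono v" using u_mono by (auto simp: v_def mono_def max_def le_less)
    show "strict_mono_on {0..} v" using u_mono by (auto simp: v_def strict_mono_on_def)
    show "v y = 0" if "y \<le> 0" for y using that by (simp add: v_def)
    show "u y = v y + u 0" if "0 \<le> y" for y using that by (simp add: v_def)
    show "\<exists>s. (\<forall>y\<ge>0. v y \<le> v m + s * (y - m)) \<and> (\<forall>y>0. y \<noteq> m \<longrightarrow> v y < v m + s * (y - m))"
      if m: "0 < m" for m
    proof (intro exI conjI allI impI)
      show strict: "v y < v m + deriv u m * (y - m)" if "0 < y" "y \<noteq> m" for y
        using tangent[OF m that] that m by (simp add: v_def)
      show "v y \<le> v m + deriv u m * (y - m)" if "0 \<le> y" for y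
      proof (cases "y = 0 \<or> y = m")
        case True
        then show ?thesis using tangent0[OF m] m by (auto simp: v_def)
      next
        case False
        then show ?thesis using strict[of y] that by simp
      qed
    qed
    show "strict_mono_on {0..1} w" "w 0 = 0" "w 1 = 1" "\<rho> \<in> borel_measurable M"
      "AE \<omega> in M. 0 < \<rho> \<omega>" "integrable M \<rho>" "continuous_on UNIV (dist_fun M \<rho>)" "0 < x0"
      by (rule assms)+
  qed
  have V: "1 - w (dist_fun M \<rho> (\<rho> \<omega>)) = V \<omega>" for \<omega> by (simp add: V_def)
  show ?thesis
    unfolding V
  proof (intro conjI allI impI)
    show "optimal_R M u w \<rho> x0 (\<lambda>\<omega>. quantile M Xt (V \<omega>))" if "optimal_E M u w \<rho> x0 Xt" for Xt
      using that by (rule optimal_R_of_optimal_E)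
    fix X assume X: "optimal_R M u w \<rho> x0 X"
    then have X': "X \<in> borel_measurable M" "AE \<omega> in M. 0 \<le> X \<omega>"
      by (simp_all add: optimal_R_iff admissible_R_iff)
    have ex: "pull X \<in> quantile_functions" "AE \<omega> in M. X \<omega> = pull X (V \<omega>)"
      using pull_quantile_functions[OF X'] optimal_R_maximizer(1)[OF X] by auto
    have uniq: "Q = pull X" if "Q \<in> quantile_functions" "AE \<omega> in M. X \<omega> = Q (V \<omega>)" for Q
      by (rule quantile_functions_unique[OF that(1) ex(1)]) (use that(2) ex(2) in eventually_elim, simp)
    show "\<exists>!Q. Q \<in> quantile_functions \<and> (AE \<omega> in M. X \<omega> = Q (V \<omega>))"
      using ex uniq by blast
    fix Q U
    assume "Q \<in> quantile_functions \<and> (AE \<omega> in M. X \<omega> = Q (V \<omega>)) \<and> U \<in> borel_measurable M \<and>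
      distr M borel U = unif \<and> comonotonic M U (rho_tilde M \<rho> w)"
    then show "optimal_E M u w \<rho> x0 (\<lambda>\<omega>. Q (1 - U \<omega>))"
      using uniq optimal_E_of_optimal_R[OF X] by metis
  qed
qed

end
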